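(* Let $p\ge 1$, let $A\in\mathbb{R}^{p\times p}$, let $\Sigma_{\mathbf w}\succ 0$ and $\Sigma_{\mathbf x_0}\succ 0$ be $p\times p$ covariance matrices, and let $(\mathbf x_t)_{t\ge 0}$ be the time-invariant $\mathbb{R}^p$-valued Gauss-Markov process $\mathbf x_{t+1}=A\mathbf x_t+\mathbf w_t$, where $\mathbf x_0\sim\mathcal N(0,\Sigma_{\mathbf x_0})$ and $(\mathbf w_t)$ is white Gaussian noise, $\mathbf w_t\sim\mathcal N(0,\Sigma_{\mathbf w})$, independent of $\mathbf x_0$. Then for every $D>0$ the asymptotic sequential rate-distortion function $R^{\mathrm{SRD}}(D)$ of $(\mathbf x_t)$ (defined in the context) has the semidefinite representation $$R^{\mathrm{SRD}}(D)=\min_{P,Q}\ \Big(-\tfrac12\log\det Q+\tfrac12\log\det\Sigma_{\mathbf w}\Big),$$ where the minimum is over symmetric matrices $P,Q\in\mathbb{R}^{p\times p}$ with $P\succ0$, $Q\succ 0$ satisfying $$P\preceq APA^{T}+\Sigma_{\mathbf w},\qquad \operatorname{trace}(P)\le D,\qquad \begin{bmatrix}P-Q & PA^{T}\\ AP & APA^{T}+\Sigma_{\mathbf w}\end{bmatrix}\succeq 0 .$$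
   Context: Causal reconstruction: a reconstruction process $(\mathbf y_t)$ with values in $\mathbb{R}^p$ is specified by a sequence of conditional distributions (stochastic kernels) $\mathbf P(dy_t\mid y^{t-1},x^t)$, $t=0,1,\dots$, where $x^t=(x_0,\dots,x_t)$, $y^{t-1}=(y_0,\dots,y_{t-1})$, and for $t=0$ the kernel is $\mathbf P(dy_0\mid x_0)$. For a horizon $n$ write $\mathbf P(dy^n\|x^n)=\prod_{t=0}^n\mathbf P(dy_t\mid y^{t-1},x^t)$. The joint law of $(\mathbf x^n,\mathbf y^n)$ is $\mathbf P(dx^n)\otimes\mathbf P(dy^n\|x^n)$, where $\mathbf P(dx^n)$ is the given law of the source. Expectation and the mutual information $I(\mathbf x^n;\mathbf y^n)$ are taken with respect to this joint law. The logarithm base is the same in the mutual information and in the formula. Finite-time sequential rate-distortion (SRD) function: $$R^{\mathrm{SRD}}_{0,n}(D)=\inf_{\mathbf P(dy^n\|x^n)}\frac{1}{n+1}I(\mathbf x^n;\mathbf y^n)\quad\text{subject to}\quad \mathbb{E}\|\mathbf x_t-\mathbf y_t\|^2\le D\ \text{ for all } t=0,\dots,n,$$ with $\|\cdot\|$ the Euclidean norm. Asymptotic SRD function: $R^{\mathrm{SRD}}(D)=\lim_{n\to\infty}R^{\mathrm{SRD}}_{0,n}(D)$, provided the limit exists. *)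

theory Defs
  imports "HOL-Probability.Probability"
begin

subsection \<open>Matrices\<close>

definition pos_semidef :: "real^'n^'n \<Rightarrow> bool" where
  "pos_semidef S \<longleftrightarrow> transpose S = S \<and> (\<forall>v. 0 \<le> v \<bullet> (S *v v))"

definition pos_def :: "real^'n^'n \<Rightarrow> bool" where
  "pos_def S \<longleftrightarrow> transpose S = S \<and> (\<forall>v. v \<noteq> 0 \<longrightarrow> 0 < v \<bullet> (S *v v))"

definition loewner_le :: "real^'n^'n \<Rightarrow> real^'n^'n \<Rightarrow> bool"  (infix \<open>\<preceq>\<^sub>L\<close> 50) where
  "S \<preceq>\<^sub>L T \<longleftrightarrow> pos_semidef (T - S)"

definition block_matrix ::
    "real^'n^'m \<Rightarrow> real^'k^'m \<Rightarrow> real^'n^'l \<Rightarrow> real^'k^'l \<Rightarrow> real^('n + 'k)^('m + 'l)" where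
  "block_matrix S11 S12 S21 S22 =
     (\<chi> i j. case i of
        Inl r \<Rightarrow> (case j of Inl c \<Rightarrow> S11 $ r $ c | Inr c \<Rightarrow> S12 $ r $ c)
      | Inr r \<Rightarrow> (case j of Inl c \<Rightarrow> S21 $ r $ c | Inr c \<Rightarrow> S22 $ r $ c))"

subsection \<open>Gauss--Markov sources\<close>

definition gaussian_density :: "real^'p^'p \<Rightarrow> real^'p \<Rightarrow> real" where
  "gaussian_density S v =
     exp (- (v \<bullet> (matrix_inv S *v v)) / 2) / sqrt ((2 * pi) ^ CARD('p) * det S)"

locale gauss_markov = prob_space M
  for M :: "'w measure" +
  fixes A Sw S0 :: "real^'p^'p"
    and x w :: "nat \<Rightarrow> 'w \<Rightarrow> real^'p"
  assumes Sw_pos_def: "pos_def Sw"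
    and S0_pos_def: "pos_def S0"
    and init_gaussian: "distributed M lborel (x 0) (\<lambda>v. ennreal (gaussian_density S0 v))"
    and noise_gaussian: "\<And>t. distributed M lborel (w t) (\<lambda>v. ennreal (gaussian_density Sw v))"
    \<comment> \<open>mutual independence of the whole family \<open>x\<^sub>0, w\<^sub>0, w\<^sub>1, \<dots>\<close>\<close>
    and indep: "indep_vars (\<lambda>_. borel) (\<lambda>k. case k of 0 \<Rightarrow> x 0 | Suc t \<Rightarrow> w t) UNIV"
    and step: "\<And>t \<omega>. \<omega> \<in> space M \<Longrightarrow> x (Suc t) \<omega> = A *v x t \<omega> + w t \<omega>"

subsection \<open>Causal reconstructions\<close>

text \<open>
  \<open>hist m\<close> is the space of \<open>m\<close>-tuples indexed by \<open>0, \<dots>, m - 1\<close>; so \<open>x\<^sup>t\<close> lives in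
  \<open>hist (Suc t)\<close> and \<open>y\<^sup>t\<^sup>-\<^sup>1\<close> in \<open>hist t\<close>, which for \<open>t = 0\<close> is a one-point space.
\<close>

abbreviation hist :: "nat \<Rightarrow> (nat \<Rightarrow> 'e::euclidean_space) measure" where
  "hist m \<equiv> PiM {0..<m} (\<lambda>_. borel)"

type_synonym 'e kernels = "nat \<Rightarrow> (nat \<Rightarrow> 'e) \<times> (nat \<Rightarrow> 'e) \<Rightarrow> 'e measure"

text \<open>\<open>K t (y\<^sup>t\<^sup>-\<^sup>1, x\<^sup>t)\<close> is the conditional distribution of \<open>y\<^sub>t\<close>.\<close>

definition causal_kernels :: "'e::euclidean_space kernels set" where
  "causal_kernels = {K. \<forall>t. K t \<in> hist t \<Otimes>\<^sub>M hist (Suc t) \<rightarrow>\<^sub>M prob_algebra borel}"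

text \<open>
  \<open>causal_law K n x\<close> is \<open>P(dy\<^sup>n \<parallel> x\<^sup>n) = \<Prod>\<^sub>t\<^sub>\<le>\<^sub>n P(dy\<^sub>t | y\<^sup>t\<^sup>-\<^sup>1, x\<^sup>t)\<close>, a measure on \<open>hist (Suc n)\<close>:
  \<open>Ionescu_Tulcea.C P M 0 m\<close> composes the first \<open>m\<close> kernels of the family \<open>P\<close>, starting from
  the empty tuple.
\<close>

definition causal_law ::
    "'e::euclidean_space kernels \<Rightarrow> nat \<Rightarrow> (nat \<Rightarrow> 'e) \<Rightarrow> (nat \<Rightarrow> 'e) measure" where
  "causal_law K n x =
     Ionescu_Tulcea.C (\<lambda>t y. K t (y, restrict x {0..<Suc t})) (\<lambda>_. borel) 0 (Suc n) (\<lambda>_. undefined)"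

lemma Ionescu_Tulcea_causal_kernels:
  fixes K :: "'e::euclidean_space kernels"
  assumes "K \<in> causal_kernels"
  shows "Ionescu_Tulcea (\<lambda>t y. K t (y, restrict x {0..<Suc t})) (\<lambda>_. borel)"
proof (rule Ionescu_Tulcea.intro)
  have x: "restrict x {0..<Suc t} \<in> space (hist (Suc t))" for t
    by (simp add: space_PiM)
  have K: "K t \<in> hist t \<Otimes>\<^sub>M hist (Suc t) \<rightarrow>\<^sub>M prob_algebra borel" for t
    using assms by (simp add: causal_kernels_def)
  have *: "(\<lambda>y. K t (y, restrict x {0..<Suc t})) \<in> hist t \<rightarrow>\<^sub>M prob_algebra borel" for t
    using measurable_compose[OF measurable_Pair2'[OF x] K] by simp
  fix t :: nat and y :: "nat \<Rightarrow> 'e"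
  show "(\<lambda>y. K t (y, restrict x {0..<Suc t})) \<in> hist t \<rightarrow>\<^sub>M subprob_algebra borel"
    using * by (rule measurable_prob_algebraD)
  assume "y \<in> space (hist t)"
  then show "prob_space (K t (y, restrict x {0..<Suc t}))"
    using measurable_space[OF *] by (simp add: space_prob_algebra)
qed

definition source_law :: "'w measure \<Rightarrow> (nat \<Rightarrow> 'w \<Rightarrow> 'e::euclidean_space) \<Rightarrow> nat \<Rightarrow> (nat \<Rightarrow> 'e) measure" where
  "source_law M x n = distr M (hist (Suc n)) (\<lambda>\<omega>. \<lambda>t\<in>{0..<Suc n}. x t \<omega>)"

definition joint_law ::
    "'w measure \<Rightarrow> (nat \<Rightarrow> 'w \<Rightarrow> 'e::euclidean_space) \<Rightarrow> 'e kernels \<Rightarrow> nat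
      \<Rightarrow> ((nat \<Rightarrow> 'e) \<times> (nat \<Rightarrow> 'e)) measure" where
  "joint_law M x K n =
     source_law M x n \<bind> (\<lambda>u. causal_law K n u \<bind>
       (\<lambda>y. return (hist (Suc n) \<Otimes>\<^sub>M hist (Suc n)) (u, y)))"

subsection \<open>Mutual information and the sequential rate-distortion function\<close>

text \<open>
  The library's real-valued \<open>mutual_information\<close> is meaningless when the joint law is not
  absolutely continuous with respect to the product of the marginals, and \<open>0\<close> when the
  information density is not integrable.  In both cases the mutual information is \<open>\<infinity>\<close> (the
  negative part of the information density is always integrable).
\<close>

definition ext_mutual_information ::
    "real \<Rightarrow> 'a measure \<Rightarrow> 'b measure \<Rightarrow> 'c measure \<Rightarrow> ('a \<Rightarrow> 'b) \<Rightarrow> ('a \<Rightarrow> 'c) \<Rightarrow> ereal" where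
  "ext_mutual_information b M S T X Y =
     (let prd = distr M S X \<Otimes>\<^sub>M distr M T Y;
          jnt = distr M (S \<Otimes>\<^sub>M T) (\<lambda>\<omega>. (X \<omega>, Y \<omega>))
      in if absolutely_continuous prd jnt \<and> integrable jnt (entropy_density b prd jnt)
         then ereal (prob_space.mutual_information M b S T X Y) else \<infinity>)"

definition srd_admissible ::
    "'w measure \<Rightarrow> (nat \<Rightarrow> 'w \<Rightarrow> 'e::euclidean_space) \<Rightarrow> nat \<Rightarrow> real \<Rightarrow> 'e kernels set" where
  "srd_admissible M x n D =
     {K \<in> causal_kernels. \<forall>t\<le>n.
        (\<integral>\<^sup>+(u, y). ennreal ((norm (u t - y t))\<^sup>2) \<partial>joint_law M x K n) \<le> ennreal D}"

definition srd_finite ::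
    "real \<Rightarrow> 'w measure \<Rightarrow> (nat \<Rightarrow> 'w \<Rightarrow> 'e::euclidean_space) \<Rightarrow> nat \<Rightarrow> real \<Rightarrow> ereal" where
  "srd_finite b M x n D =
     (INF K \<in> srd_admissible M x n D.
        ereal (1 / real (n + 1)) *
        ext_mutual_information b (joint_law M x K n) (hist (Suc n)) (hist (Suc n)) fst snd)"

definition srd ::
    "real \<Rightarrow> 'w measure \<Rightarrow> (nat \<Rightarrow> 'w \<Rightarrow> 'e::euclidean_space) \<Rightarrow> real \<Rightarrow> ereal" where
  "srd b M x D = lim (\<lambda>n. srd_finite b M x n D)"

subsection \<open>The semidefinite program\<close>

definition sdp_feasible ::
    "real^'p^'p \<Rightarrow> real^'p^'p \<Rightarrow> real \<Rightarrow> (real^'p^'p) \<times> (real^'p^'p) \<Rightarrow> bool" where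
  "sdp_feasible A Sw D = (\<lambda>(P, Q).
     pos_def P \<and> pos_def Q \<and>
     P \<preceq>\<^sub>L A ** P ** transpose A + Sw \<and>
     trace P \<le> D \<and>
     pos_semidef (block_matrix (P - Q) (P ** transpose A)
                               (A ** P) (A ** P ** transpose A + Sw)))"

definition sdp_objective ::
    "real \<Rightarrow> real^'p^'p \<Rightarrow> (real^'p^'p) \<times> (real^'p^'p) \<Rightarrow> real" where
  "sdp_objective b Sw = (\<lambda>(P, Q). - (1/2) * log b (det Q) + (1/2) * log b (det Sw))"

end

theory Submission
  imports Defs
begin

text \<open>
  Let \<open>(P, Q)\<close> be optimal for the semidefinite program, which exists by compactness (\<open>optimum_exists\<close>), and put
  \<open>\<kappa> = (ln det W - ln det Q) / 2\<close>, where \<open>W\<close> is the covariance \<open>Sw\<close> of the noise.  The least information over the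
  horizon \<open>0, \<dots>, n\<close>, in nats, differs from \<open>n \<kappa>\<close> by a quantity bounded in \<open>n\<close>.  Dividing by \<open>n + 1\<close> gives
  existence and value of the limit at once.

  Upper bound (\<open>information_upper_bound\<close>).  If a Gaussian test channel keeps the error covariance at \<open>P\<close>, then the
  prior covariance is \<open>T = A P A\<^sup>T + W\<close>, and one step costs \<open>(ln det T - ln det P) / 2\<close>
  (\<open>test_channel_information\<close>).  The Schur complement \<open>Z\<close> of the block matrix in the program satisfies
  \<open>det Z det T = det P det W\<close> and \<open>Q \<preceq> Z\<close>, so the cost of a step is at most \<open>\<kappa>\<close>.  Singularity of \<open>T - P\<close> and the
  different start at time \<open>0\<close> are handled by covariances \<open>c\<^sub>t P\<close> with \<open>c\<^sub>t\<close> increasing to \<open>1\<close> geometrically.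

  Lower bound (\<open>information_lower_bound\<close>).  The problem over the horizon is not reduced to Gaussian reconstructions;
  instead a dual certificate bounds all causal reconstructions directly.  Since \<open>ln det\<close> is differentiable,
  optimality of \<open>(P, Q)\<close> gives a linear inequality (\<open>first_order_optimality\<close>), and separating it from the
  constraints gives multipliers \<open>\<mu> \<ge> 0\<close> for the trace, \<open>\<Theta> \<succeq> 0\<close> for \<open>P \<preceq> A P A\<^sup>T + W\<close> and a block matrix whose
  Schur complement yields a smoothing gain \<open>L\<close> (\<open>optimality_certificate\<close>).  Interpreted probabilistically,
  \<open>Q\<close> and \<open>L\<close> define a backward Gaussian model for \<open>x\<^sub>t\<close> given \<open>x\<^sub>t\<^sub>+\<^sub>1\<close> and \<open>y\<^sup>t\<close>.  Any model for the source given the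
  outputs bounds the information from below (\<open>KL_divergence_ge\<close>), and for this one the certificate controls the
  expected log-likelihood: \<open>\<mu>\<close> prices the distortion, and \<open>\<Theta>\<close> is a storage function for the prediction error of an
  auxiliary filter, so that the stage costs telescope.  The reconstruction enters only through its distortion and
  through the independence of \<open>w\<^sub>t\<close> from \<open>(x\<^sup>t, y\<^sup>t)\<close> (\<open>distr_joint_law_noise\<close>).

  Determinants and moments come from the linear change of variables (\<open>nn_integral_lborel_linear\<close>), proved from
  simultaneous diagonalization of two quadratic forms, and from convolving Gaussians (\<open>gaussian_convolution\<close>).
\<close>

section \<open>Quadratic forms and simultaneous diagonalization\<close>

abbreviation quad :: "real^'n^'n \<Rightarrow> real^'n \<Rightarrow> real" where
  "quad S v \<equiv> v \<bullet> (S *v v)"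

lemma inner_matrix_transpose: "(x::real^'m) \<bullet> (A *v y) = (transpose A *v x) \<bullet> y"
  by (simp add: dot_lmul_matrix)

lemma inner_symmetric_matrix:
  fixes S :: "real^'n^'n"
  shows "transpose S = S \<Longrightarrow> x \<bullet> (S *v y) = y \<bullet> (S *v x)"
  by (metis inner_matrix_transpose inner_commute)

lemma pos_def_imp_pos_semidef: "pos_def S \<Longrightarrow> pos_semidef S"
  unfolding pos_def_def pos_semidef_def
proof (intro conjI allI; elim conjE)
  fix v assume "\<forall>v. v \<noteq> 0 \<longrightarrow> 0 < quad S v"
  then show "0 \<le> quad S v" by (cases "v = 0") (auto intro: less_imp_le)
qed

text \<open>
  By compactness the form attains a positive minimum on the unit sphere; homogeneity does the rest.
\<close>

lemma pos_def_coercive: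
  fixes Q :: "real^'n^'n"
  assumes "pos_def Q"
  obtains m where "0 < m" "\<And>v. m * (norm v)\<^sup>2 \<le> quad Q v"
proof -
  have "continuous_on (sphere 0 1) (\<lambda>v::real^'n. quad Q v)"
    by (intro continuous_intros)
  moreover have "sphere (0::real^'n) 1 \<noteq> {}" by simp
  ultimately obtain u where u: "u \<in> sphere 0 1" "\<And>v. v \<in> sphere 0 1 \<Longrightarrow> quad Q u \<le> quad Q v"
    using continuous_attains_inf[OF compact_sphere] by blast
  have "u \<noteq> 0" using u(1) by auto
  hence pos: "0 < quad Q u" using assms by (auto simp: pos_def_def)
  have "quad Q u * (norm v)\<^sup>2 \<le> quad Q v" for v
  proof (cases "v = 0")
    case False
    have "quad Q u \<le> quad Q (v /\<^sub>R norm v)"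
      using False by (intro u(2)) auto
    also have "\<dots> = quad Q v / (norm v)\<^sup>2"
      by (simp add: matrix_vector_mult_scaleR power2_eq_square divide_inverse)
    finally show ?thesis using False by (simp add: field_simps)
  qed auto
  with pos that show ?thesis by blast
qed

text \<open>
  The first-variation argument: a quadratic polynomial in \<open>t\<close> without constant term that is never
  positive has no linear part.
\<close>

lemma linear_coeff_zero:
  fixes a b :: real
  assumes "\<And>t. 2 * t * a + t\<^sup>2 * b \<le> 0"
  shows "a = 0"
proof (rule ccontr)
  assume a: "a \<noteq> 0"
  define t where "t = a / (\<bar>b\<bar> + 1)"
  have "t\<^sup>2 * b \<ge> - (t\<^sup>2 * (\<bar>b\<bar> + 1))"
    by (simp add: mult_left_mono minus_mult_right del: mult_minus_right)
  also have "t\<^sup>2 * (\<bar>b\<bar> + 1) = t * a"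
    by (simp add: t_def power2_eq_square divide_simps)
  finally have "t * a \<le> 0" using assms[of t] by linarith
  moreover have "t * a > 0"
    using a by (simp add: t_def power2_eq_square[symmetric])
  ultimately show False by simp
qed

text \<open>
  The spectral theorem for the pencil \<open>(Q, V)\<close>, one vector at a time.  On the \<open>Q\<close>-orthogonal complement of the
  vectors found so far, a maximiser \<open>a\<close> of the \<open>V\<close>-form over the \<open>Q\<close>-unit sphere is a new eigenvector.  The
  variation around \<open>a\<close> only controls directions inside that complement, which is why the induction also carries the
  third conjunct: whatever is \<open>Q\<close>-orthogonal to the chosen vectors is \<open>V\<close>-orthogonal to them.
\<close>

lemma partial_simultaneous_diagonalization:
  fixes Q V :: "real^'n^'n"
  assumes Q: "pos_def Q" and V: "transpose V = V"
  shows "k \<le> CARD('n) \<Longrightarrow> \<exists>c::nat \<Rightarrow> real^'n.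
     (\<forall>i<k. \<forall>j<k. c i \<bullet> (Q *v c j) = (if i = j then 1 else 0)) \<and>
     (\<forall>i<k. \<forall>j<k. i \<noteq> j \<longrightarrow> c i \<bullet> (V *v c j) = 0) \<and>
     (\<forall>v. (\<forall>i<k. v \<bullet> (Q *v c i) = 0) \<longrightarrow> (\<forall>i<k. v \<bullet> (V *v c i) = 0))"
proof (induction k)
  case (Suc k)
  from Suc.IH[OF Suc_leD[OF Suc.prems]] obtain c :: "nat \<Rightarrow> real^'n" where
    c: "\<forall>i<k. \<forall>j<k. c i \<bullet> (Q *v c j) = (if i = j then 1 else 0)"
      "\<forall>i<k. \<forall>j<k. i \<noteq> j \<longrightarrow> c i \<bullet> (V *v c j) = 0"
      "\<forall>v. (\<forall>i<k. v \<bullet> (Q *v c i) = 0) \<longrightarrow> (\<forall>i<k. v \<bullet> (V *v c i) = 0)"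
    by (elim exE conjE) (rule that)
  have c1: "c i \<bullet> (Q *v c j) = (if i = j then 1 else 0)" if "i < k" "j < k" for i j
    using c(1) that by blast
  have c2: "c i \<bullet> (V *v c j) = 0" if "i < k" "j < k" "i \<noteq> j" for i j
    using c(2) that by blast
  have c3: "v \<bullet> (V *v c i) = 0" if "\<And>i. i < k \<Longrightarrow> v \<bullet> (Q *v c i) = 0" "i < k" for v i
    using c(3) that by blast
  have Qs: "x \<bullet> (Q *v y) = y \<bullet> (Q *v x)" for x y
    using Q by (auto simp: pos_def_def intro: inner_symmetric_matrix)
  have Vs: "x \<bullet> (V *v y) = y \<bullet> (V *v x)" for x y
    using V by (rule inner_symmetric_matrix)
  define T where "T = {v. \<forall>i<k. v \<bullet> (Q *v c i) = 0}"
  have "dim ((\<lambda>i. Q *v c i) ` {..<k}) \<le> card ((\<lambda>i. Q *v c i) ` {..<k})"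
    by (rule dim_le_card') simp
  also have "\<dots> \<le> k" using card_image_le[of "{..<k}" "\<lambda>i. Q *v c i"] by simp
  also have "\<dots> < DIM(real^'n)" using Suc.prems by simp
  \<comment> \<open>fewer than \<open>CARD('n)\<close> linear conditions, so the complement is not trivial\<close>
  finally obtain v0 where v0: "v0 \<noteq> 0" "\<And>y. y \<in> span ((\<lambda>i. Q *v c i) ` {..<k}) \<Longrightarrow> orthogonal v0 y"
    using orthogonal_to_subspace_exists by blast
  have v0T: "v0 \<in> T" using v0(2) by (auto simp: T_def orthogonal_def intro: span_base)
  have T_lin: "v \<in> T \<Longrightarrow> u \<in> T \<Longrightarrow> v + t *\<^sub>R u \<in> T" "v \<in> T \<Longrightarrow> t *\<^sub>R v \<in> T" for u v t
    by (auto simp: T_def inner_left_distrib)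
  obtain m where m: "0 < m" "\<And>v. m * (norm v)\<^sup>2 \<le> quad Q v"
    using pos_def_coercive[OF Q] by blast
  define K where "K = T \<inter> {v. quad Q v = 1}"
  have scaleK: "(1 / sqrt (quad Q v)) *\<^sub>R v \<in> K" "0 < quad Q v" if "v \<in> T" "v \<noteq> 0" for v
  proof -
    show *: "0 < quad Q v" using that Q by (auto simp: pos_def_def)
    then show "(1 / sqrt (quad Q v)) *\<^sub>R v \<in> K"
      using T_lin(2)[OF that(1)] by (simp add: K_def matrix_vector_mult_scaleR)
  qed
  have "closed K"
  proof -
    have "closed {v. quad Q v = 1}" by (intro closed_Collect_eq continuous_intros)
    moreover have "T = (\<Inter>i\<in>{..<k}. {v. v \<bullet> (Q *v c i) = 0})" by (auto simp: T_def)
    moreover have "closed (\<Inter>i\<in>{..<k}. {v. v \<bullet> (Q *v c i) = 0})"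
      by (intro closed_INT ballI closed_Collect_eq continuous_intros)
    ultimately show ?thesis by (auto simp: K_def)
  qed
  moreover have "bounded K"
  proof (rule boundedI)
    fix v assume "v \<in> K"
    then have "m * (norm v)\<^sup>2 \<le> 1" using m(2)[of v] by (auto simp: K_def)
    then have "(norm v)\<^sup>2 \<le> 1 / m" using m(1) by (simp add: field_simps)
    then show "norm v \<le> sqrt (1 / m)" by (rule real_le_rsqrt)
  qed
  ultimately have "compact K" by (simp add: compact_eq_bounded_closed)
  moreover have "K \<noteq> {}" using scaleK(1)[OF v0T v0(1)] by auto
  moreover have "continuous_on K (\<lambda>v. quad V v)" by (intro continuous_intros)
  ultimately obtain a where a: "a \<in> K" "\<And>v. v \<in> K \<Longrightarrow> quad V v \<le> quad V a"
    using continuous_attains_sup by metis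
  define l where "l = quad V a"
  have aT: "a \<in> T" and aQ: "quad Q a = 1" using a(1) by (auto simp: K_def)
  have le: "quad V v \<le> l * quad Q v" if "v \<in> T" for v
  proof (cases "v = 0")
    case False
    from a(2)[OF scaleK(1)[OF that False]] scaleK(2)[OF that False] show ?thesis
      by (simp add: matrix_vector_mult_scaleR l_def field_simps)
  qed simp
  \<comment> \<open>stationarity of the maximiser along directions in the complement\<close>
  have stat: "v \<bullet> (V *v a) = l * (v \<bullet> (Q *v a))" if "v \<in> T" for v
  proof -
    have "v \<bullet> (V *v a) - l * (v \<bullet> (Q *v a)) = 0"
    proof (rule linear_coeff_zero[where b="quad V v - l * quad Q v"])
      fix t
      have "quad V (a + t *\<^sub>R v) \<le> l * quad Q (a + t *\<^sub>R v)"
        by (intro le T_lin aT that)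
      then show "2 * t * (v \<bullet> (V *v a) - l * (v \<bullet> (Q *v a))) + t\<^sup>2 * (quad V v - l * quad Q v) \<le> 0"
        using Qs[of a v] Vs[of a v] aQ
        by (simp add: matrix_vector_right_distrib matrix_vector_mult_scaleR inner_left_distrib
            inner_right_distrib l_def[symmetric] algebra_simps power2_eq_square)
    qed
    then show ?thesis by simp
  qed
  define c' where "c' = c(k := a)"
  show ?case
  proof (intro exI[of _ c'] conjI allI impI)
    fix i j assume ij: "i < Suc k" "j < Suc k"
    have 1: "a \<bullet> (Q *v c i) = 0" if "i < k" for i using aT that by (auto simp: T_def)
    then have 2: "c i \<bullet> (Q *v a) = 0" if "i < k" for i using that Qs by metis
    show "c' i \<bullet> (Q *v c' j) = (if i = j then 1 else 0)"
      using ij c1 aQ 1 2 by (auto simp: c'_def less_Suc_eq)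
  next
    fix i j assume ij: "i < Suc k" "j < Suc k" "i \<noteq> j"
    have 1: "a \<bullet> (V *v c i) = 0" if "i < k" for i using aT that by (intro c3) (auto simp: T_def)
    then have 2: "c i \<bullet> (V *v a) = 0" if "i < k" for i using that Vs by metis
    show "c' i \<bullet> (V *v c' j) = 0"
      using ij c2 1 2 by (auto simp: c'_def less_Suc_eq)
  next
    fix v i assume v: "\<forall>i<Suc k. v \<bullet> (Q *v c' i) = 0" and i: "i < Suc k"
    have vT: "v \<in> T" using v by (auto simp: T_def c'_def less_Suc_eq split: if_splits)
    have "v \<bullet> (Q *v a) = 0" using v by (auto simp: c'_def less_Suc_eq)
    with stat[OF vT] have "v \<bullet> (V *v a) = 0" by simp
    then show "v \<bullet> (V *v c' i) = 0"
      using i vT c3[of v i] by (auto simp: c'_def T_def less_Suc_eq)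
  qed
qed simp

definition diag :: "('n \<Rightarrow> real) \<Rightarrow> real^'n^'n" where
  "diag d = (\<chi> i j. if i = j then d i else 0)"

lemma diag_mult_vector: "(diag d *v z) $ i = d i * z $ i"
  by (simp add: diag_def matrix_vector_mult_def if_distrib[where f="\<lambda>x. x * _"] cong: if_cong)

lemma diag_quadratic: "quad (diag d) z = (\<Sum>i\<in>UNIV. d i * (z $ i)\<^sup>2)"
  by (simp add: inner_vec_def diag_mult_vector power2_eq_square algebra_simps)

lemma transpose_diag [simp]: "transpose (diag d) = diag d"
  by (auto simp: diag_def transpose_def vec_eq_iff)

lemma det_diag: "det (diag d) = (\<Prod>i\<in>UNIV. d i)"
  by (subst det_diagonal) (auto simp: diag_def)

lemma trace_diag: "trace (diag d) = (\<Sum>i\<in>UNIV. d i)"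
  by (simp add: trace_def diag_def)

lemma mat_1_eq_diag: "mat 1 = diag (\<lambda>_. 1)"
  by (simp add: mat_def diag_def vec_eq_iff)

lemma diag_mult: "diag a ** diag b = diag (\<lambda>i. a i * b i)"
  by (auto simp: diag_def matrix_matrix_mult_def vec_eq_iff if_distrib[where f="\<lambda>x. x * _"] cong: if_cong)

theorem simultaneous_diagonalization:
  fixes Q V :: "real^'n^'n"
  assumes Q: "pos_def Q" and V: "transpose V = V"
  obtains C :: "real^'n^'n" and d where "transpose C ** Q ** C = mat 1" "transpose C ** V ** C = diag d"
proof -
  from partial_simultaneous_diagonalization[OF Q V order.refl] obtain c :: "nat \<Rightarrow> real^'n" where
    c: "\<forall>i<CARD('n). \<forall>j<CARD('n). c i \<bullet> (Q *v c j) = (if i = j then 1 else 0)"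
      "\<forall>i<CARD('n). \<forall>j<CARD('n). i \<noteq> j \<longrightarrow> c i \<bullet> (V *v c j) = 0"
    by (elim exE conjE) (rule that)
  have c1: "c i \<bullet> (Q *v c j) = (if i = j then 1 else 0)" if "i < CARD('n)" "j < CARD('n)" for i j
    using c(1) that by blast
  have c2: "c i \<bullet> (V *v c j) = 0" if "i < CARD('n)" "j < CARD('n)" "i \<noteq> j" for i j
    using c(2) that by blast
  obtain h where h: "bij_betw h (UNIV::'n set) {0..<CARD('n)}"
    using ex_bij_betw_finite_nat[of "UNIV::'n set"] by auto
  then have hl: "h i < CARD('n)" for i by (auto simp: bij_betw_def)
  have hi: "h i = h j \<longleftrightarrow> i = j" for i j using h by (auto simp: bij_betw_def inj_on_def)
  define C :: "real^'n^'n" where "C = (\<chi> i j. c (h j) $ i)"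
  have "(transpose C ** W ** C) $ i $ j = c (h i) \<bullet> (W *v c (h j))" for W i j
    by (simp add: matrix_mul_assoc[symmetric])
       (simp add: C_def matrix_matrix_mult_def transpose_def inner_vec_def matrix_vector_mult_def)
  then have "transpose C ** Q ** C = mat 1"
    "transpose C ** V ** C = diag (\<lambda>i. c (h i) \<bullet> (V *v c (h i)))"
    using c1[OF hl hl] c2[OF hl hl] by (auto simp: vec_eq_iff mat_def diag_def hi)
  then show ?thesis using that by blast
qed

corollary simultaneous_factorization:
  fixes Q V :: "real^'n^'n"
  assumes "pos_def Q" "transpose V = V"
  obtains B :: "real^'n^'n" and d where "invertible B" "Q = B ** transpose B" "V = B ** diag d ** transpose B"
proof -
  obtain C :: "real^'n^'n" and d where C: "transpose C ** Q ** C = mat 1" "transpose C ** V ** C = diag d"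
    by (rule simultaneous_diagonalization[OF assms])
  have Qs: "transpose Q = Q" using assms by (simp add: pos_def_def)
  define B where "B = Q ** C"
  have tB: "transpose B = transpose C ** Q" by (simp add: B_def matrix_transpose_mul Qs)
  have BC: "transpose B ** C = mat 1" using C(1) by (simp add: tB)
  then have CB: "C ** transpose B = mat 1" using matrix_left_right_inverse by blast
  have CB': "B ** transpose C = mat 1"
    using arg_cong[OF CB, of transpose] by (simp add: matrix_transpose_mul)
  have Q: "Q = B ** transpose B" 
  proof -
    have "B ** transpose B = Q ** (C ** transpose B)" by (simp add: B_def matrix_mul_assoc)
    then show ?thesis by (simp add: CB)
  qed
  have "B ** diag d ** transpose B = (B ** transpose C) ** V ** (C ** transpose B)"
    by (simp add: C(2)[symmetric] matrix_mul_assoc)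
  then have "V = B ** diag d ** transpose B" by (simp add: CB CB')
  moreover have "invertible B" using CB' invertible_right_inverse by blast
  ultimately show ?thesis using that Q by blast
qed

lemma pos_def_det_pos:
  fixes S :: "real^'n^'n"
  assumes S: "pos_def S"
  shows "0 < det S"
proof -
  obtain B :: "real^'n^'n" and d where "invertible B" "S = B ** transpose B"
    using simultaneous_factorization[OF S, of S] S by (auto simp: pos_def_def)
  then have "det S = (det B)\<^sup>2" "det B \<noteq> 0"
    by (auto simp: det_mul det_transpose power2_eq_square invertible_det_nz)
  then show ?thesis by simp
qed

lemma pos_def_matrix_inv:
  assumes S: "pos_def (S::real^'n^'n)"
  shows "S ** matrix_inv S = mat 1" "matrix_inv S ** S = mat 1" "pos_def (matrix_inv S)"
    "transpose (matrix_inv S) = matrix_inv S"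
proof -
  have "invertible S" using pos_def_det_pos[OF S] by (simp add: invertible_det_nz)
  then have "\<exists>B. S ** B = mat 1 \<and> B ** S = mat 1" unfolding invertible_def .
  then have "S ** matrix_inv S = mat 1 \<and> matrix_inv S ** S = mat 1"
    unfolding matrix_inv_def by (rule someI_ex)
  then show 1: "S ** matrix_inv S = mat 1" and 2: "matrix_inv S ** S = mat 1" by auto
  have St: "transpose S = S" using S by (simp add: pos_def_def)
  have "transpose (matrix_inv S) ** S = mat 1"
    using arg_cong[OF 1, of transpose] by (simp add: matrix_transpose_mul St)
  then have "transpose (matrix_inv S) ** S ** matrix_inv S = matrix_inv S" by simp
  then show 3: "transpose (matrix_inv S) = matrix_inv S"
    by (simp add: matrix_mul_assoc[symmetric] 1)
  have "0 < quad (matrix_inv S) v" if "v \<noteq> 0" for v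
  proof -
    have v: "v = S *v (matrix_inv S *v v)" by (simp add: matrix_vector_mul_assoc 1)
    then have "matrix_inv S *v v \<noteq> 0" using that by auto
    then show ?thesis using S v by (metis pos_def_def inner_commute)
  qed
  then show "pos_def (matrix_inv S)" by (simp add: pos_def_def 3)
qed

lemma matrix_inv_eqI:
  fixes S :: "real^'n^'n"
  assumes "S ** T = mat 1"
  shows "matrix_inv S = T"
proof -
  have TS: "T ** S = mat 1" using assms matrix_left_right_inverse by blast
  then have "\<exists>B. S ** B = mat 1 \<and> B ** S = mat 1" using assms by blast
  then have "S ** matrix_inv S = mat 1 \<and> matrix_inv S ** S = mat 1"
    unfolding matrix_inv_def by (rule someI_ex)
  then have "T ** (S ** matrix_inv S) = T" by simp
  then show ?thesis by (simp add: matrix_mul_assoc TS)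
qed

lemma pos_def_matrix_inv_inv: "pos_def S \<Longrightarrow> matrix_inv (matrix_inv S) = S"
  by (intro matrix_inv_eqI pos_def_matrix_inv)

text \<open>
  In coordinates in which \<open>S\<close> is the identity and \<open>T\<close> is diagonal, every diagonal entry of \<open>T\<close> is at least \<open>1\<close>.
\<close>

lemma det_mono:
  fixes S T :: "real^'n^'n"
  assumes S: "pos_def S" and T: "transpose T = T" and le: "\<And>v. quad S v \<le> quad T v"
  shows "det S \<le> det T"
proof -
  obtain C :: "real^'n^'n" and d where C: "transpose C ** S ** C = mat 1" "transpose C ** T ** C = diag d"
    by (rule simultaneous_diagonalization[OF S T])
  have q: "quad (transpose C ** M ** C) v = quad M (C *v v)" for M v
    by (simp only: matrix_vector_mul_assoc[symmetric] inner_matrix_transpose[of v "transpose C"] transpose_transpose)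
  have "1 \<le> d i" for i
  proof -
    have "quad (transpose C ** S ** C) (axis i 1)
        \<le> quad (transpose C ** T ** C) (axis i 1)"
      unfolding q by (rule le)
    then show ?thesis
      by (simp add: C inner_axis' diag_mult_vector)
  qed
  then have "1 \<le> (\<Prod>i\<in>UNIV. d i)" by (intro prod_ge_1)
  then have le1: "det C * det C * det S \<le> det C * det C * det T"
    using arg_cong[OF C(1), of det] arg_cong[OF C(2), of det] by (simp add: det_mul det_diag algebra_simps)
  have "det C \<noteq> 0" using arg_cong[OF C(1), of det] by (auto simp: det_mul)
  then have "det C * det C > 0" by (simp add: power2_eq_square[symmetric])
  with le1 show ?thesis by (rule mult_left_le_imp_le)
qed

section \<open>Linear change of variables\<close>

lemma borel_measurable_matrix_vector [measurable (raw)]: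
  fixes A :: "real^'n^'m"
  assumes [measurable]: "f \<in> borel_measurable M"
  shows "(\<lambda>x. A *v f x) \<in> borel_measurable M"
proof -
  have "(\<lambda>v. A *v v) \<in> borel_measurable borel"
    by (intro borel_measurable_continuous_onI linear_continuous_on)
       (simp add: linear_conv_bounded_linear[symmetric])
  from measurable_compose[OF assms this] show ?thesis .
qed

lemma nn_integral_lborel_translate:
  fixes f :: "'a::euclidean_space \<Rightarrow> ennreal"
  assumes [measurable]: "f \<in> borel_measurable borel"
  shows "(\<integral>\<^sup>+x. f (a + x) \<partial>lborel) = (\<integral>\<^sup>+x. f x \<partial>lborel)"
  by (subst (2) lborel_distr_plus[of a, symmetric]) (simp add: nn_integral_distr)

lemma lborel_distr_neg: "distr lborel borel uminus = (lborel :: 'a::euclidean_space measure)"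
  using lborel_affine[of "-1" "0::'a"] by (simp add: density_1 fun_Compl_def)

lemma nn_integral_lborel_reflect:
  fixes f :: "'a::euclidean_space \<Rightarrow> ennreal"
  assumes [measurable]: "f \<in> borel_measurable borel"
  shows "(\<integral>\<^sup>+x. f (a - x) \<partial>lborel) = (\<integral>\<^sup>+x. f x \<partial>lborel)"
proof -
  have "(\<integral>\<^sup>+x. f (a - x) \<partial>lborel) = (\<integral>\<^sup>+x. f (a + x) \<partial>distr lborel borel uminus)"
    by (simp add: nn_integral_distr)
  then show ?thesis by (simp add: lborel_distr_neg nn_integral_lborel_translate)
qed

text \<open>
  Both sides are the double integral of \<open>f (B x) g (y)\<close>: translate \<open>y\<close> by \<open>B x\<close>, exchange the integrals,
  and translate \<open>x\<close> by \<open>- B\<^sup>-\<^sup>1 y\<close>.  Hence composition with \<open>B\<close> multiplies every integral by one and the same constant,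
  which a single convenient test function determines.
\<close>

lemma lborel_linear_proportional:
  fixes B :: "real^'n^'n" and f g :: "real^'n \<Rightarrow> ennreal"
  assumes B: "invertible B" and [measurable]: "f \<in> borel_measurable borel" "g \<in> borel_measurable borel"
  shows "(\<integral>\<^sup>+x. f (B *v x) \<partial>lborel) * (\<integral>\<^sup>+x. g x \<partial>lborel)
       = (\<integral>\<^sup>+x. g (B *v x) \<partial>lborel) * (\<integral>\<^sup>+x. f x \<partial>lborel)"
proof -
  obtain C where C: "B ** C = mat 1" using B by (auto simp: invertible_def)
  have BC: "B *v (C *v y) = y" for y by (simp add: matrix_vector_mul_assoc C)
  have "(\<integral>\<^sup>+x. f (B *v x) \<partial>lborel) * (\<integral>\<^sup>+x. g x \<partial>lborel)
      = (\<integral>\<^sup>+x. \<integral>\<^sup>+y. f (B *v x) * g y \<partial>lborel \<partial>lborel)"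
    by (simp add: nn_integral_cmult nn_integral_multc)
  also have "\<dots> = (\<integral>\<^sup>+x. \<integral>\<^sup>+y. f (B *v x) * g (B *v x + y) \<partial>lborel \<partial>lborel)"
    by (simp add: nn_integral_cmult nn_integral_lborel_translate)
  also have "\<dots> = (\<integral>\<^sup>+y. \<integral>\<^sup>+x. f (B *v x) * g (B *v x + y) \<partial>lborel \<partial>lborel)"
    by (rule lborel_pair.Fubini') simp
  also have "\<dots> = (\<integral>\<^sup>+y. \<integral>\<^sup>+x. f (B *v x - y) * g (B *v x) \<partial>lborel \<partial>lborel)"
  proof (rule nn_integral_cong)
    fix y :: "real^'n"
    have "(\<integral>\<^sup>+x. f (B *v x) * g (B *v x + y) \<partial>lborel)
      = (\<integral>\<^sup>+x. f (B *v (- (C *v y) + x)) * g (B *v (- (C *v y) + x) + y) \<partial>lborel)"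
      by (rule nn_integral_lborel_translate[symmetric]) simp
    then show "(\<integral>\<^sup>+x. f (B *v x) * g (B *v x + y) \<partial>lborel) = (\<integral>\<^sup>+x. f (B *v x - y) * g (B *v x) \<partial>lborel)"
      by (simp add: matrix_vector_mult_diff_distrib BC)
  qed
  also have "\<dots> = (\<integral>\<^sup>+x. \<integral>\<^sup>+y. f (B *v x - y) * g (B *v x) \<partial>lborel \<partial>lborel)"
    by (rule lborel_pair.Fubini') simp
  also have "\<dots> = (\<integral>\<^sup>+x. g (B *v x) \<partial>lborel) * (\<integral>\<^sup>+x. f x \<partial>lborel)"
    by (simp add: nn_integral_cmult nn_integral_multc nn_integral_lborel_reflect mult.commute)
  finally show ?thesis .
qed

text \<open>
  The test function for the constant is the indicator of the unit ball, which \<open>U\<close> preserves.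
\<close>

lemma nn_integral_lborel_orthogonal:
  fixes U :: "real^'n^'n" and f :: "real^'n \<Rightarrow> ennreal"
  assumes U: "transpose U ** U = mat 1" and [measurable]: "f \<in> borel_measurable borel"
  shows "(\<integral>\<^sup>+x. f (U *v x) \<partial>lborel) = (\<integral>\<^sup>+x. f x \<partial>lborel)"
proof -
  have inv: "invertible U" using U invertible_left_inverse by blast
  have "(U *v x) \<bullet> (U *v x) = x \<bullet> x" for x
    by (subst inner_matrix_transpose) (simp only: matrix_vector_mul_assoc U matrix_vector_mul_lid)
  then have n: "norm (U *v x) = norm x" for x by (simp add: norm_eq_sqrt_inner)
  let ?g = "indicator (ball 0 1) :: real^'n \<Rightarrow> ennreal"
  define c where "c = unit_ball_vol (real DIM(real^'n))"
  have c: "0 < c" unfolding c_def by (rule unit_ball_vol_pos) simp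
  have g: "(\<integral>\<^sup>+x. ?g x \<partial>lborel) = ennreal c"
    by (simp add: emeasure_ball c_def)
  have gU: "(\<integral>\<^sup>+x. ?g (U *v x) \<partial>lborel) = ennreal c"
    unfolding g[symmetric] by (intro nn_integral_cong) (simp add: indicator_def n)
  have "?g \<in> borel_measurable borel" by (intro borel_measurable_indicator) simp
  from lborel_linear_proportional[OF inv assms(2) this, unfolded g gU]
  have "ennreal c * (\<integral>\<^sup>+x. f (U *v x) \<partial>lborel) = ennreal c * (\<integral>\<^sup>+x. f x \<partial>lborel)"
    by (simp add: mult.commute)
  moreover have "ennreal c \<noteq> 0" "ennreal c \<noteq> top" using c by (auto simp: ennreal_eq_0_iff)
  ultimately show ?thesis by (simp add: ennreal_mult_cancel_left)
qed

lemma Basis_cart_eq: "(Basis :: (real^'n) set) = range (\<lambda>i. axis i 1)"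
  by (auto simp: Basis_vec_def)

lemma nn_integral_lborel_diag:
  fixes f :: "real^'n \<Rightarrow> ennreal"
  assumes d: "\<And>i. d i \<noteq> 0" and [measurable]: "f \<in> borel_measurable borel"
  shows "(\<integral>\<^sup>+x. f x \<partial>lborel) = ennreal \<bar>\<Prod>i\<in>UNIV. d i\<bar> * (\<integral>\<^sup>+x. f (diag d *v x) \<partial>lborel)"
proof -
  define c where "c = (\<lambda>j::real^'n. quad (diag d) j)"
  have c: "c (axis i 1) = d i" for i by (simp add: c_def inner_axis' diag_mult_vector)
  have inj: "inj (\<lambda>i::'n. axis i (1::real))" by (auto simp: inj_on_def axis_eq_axis)
  have T: "0 + (\<Sum>j\<in>Basis. (c j * (x \<bullet> j)) *\<^sub>R j) = diag d *v x" for x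
    by (simp add: Basis_cart_eq sum.reindex[OF inj] c vec_eq_iff diag_mult_vector inner_axis)
       (simp add: axis_def if_distrib[where f="\<lambda>x. _ * x"] cong: if_cong)
  have P: "(\<Prod>j\<in>Basis. \<bar>c j\<bar>) = \<bar>\<Prod>i\<in>UNIV. d i\<bar>"
    by (simp add: Basis_cart_eq prod.reindex[OF inj] c abs_prod)
  have "\<And>j. j \<in> Basis \<Longrightarrow> c j \<noteq> 0" using d by (auto simp: Basis_cart_eq c)
  from lborel_affine_euclidean[of c 0, OF this, unfolded T P]
  have "integral\<^sup>N lborel f = integral\<^sup>N (density (distr lborel borel (\<lambda>x. diag d *v x)) (\<lambda>_. ennreal \<bar>\<Prod>i\<in>UNIV. d i\<bar>)) f"
    by (rule arg_cong)
  then show ?thesis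
    by (simp add: nn_integral_density nn_integral_distr nn_integral_cmult)
qed

text \<open>
  Diagonalising \<open>B B\<^sup>T\<close> gives \<open>B = U R W\<close> with \<open>U\<close>, \<open>W\<close> orthogonal and \<open>R\<close> diagonal, which reduces the claim
  to the two preceding cases.
\<close>

theorem nn_integral_lborel_linear:
  fixes B :: "real^'n^'n" and f :: "real^'n \<Rightarrow> ennreal"
  assumes B: "invertible B" and [measurable]: "f \<in> borel_measurable borel"
  shows "(\<integral>\<^sup>+x. f x \<partial>lborel) = ennreal \<bar>det B\<bar> * (\<integral>\<^sup>+x. f (B *v x) \<partial>lborel)"
proof -
  have "pos_def (mat 1 :: real^'n^'n)" by (simp add: pos_def_def)
  moreover have sym: "transpose (B ** transpose B) = B ** transpose B"
    by (simp add: matrix_transpose_mul)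
  ultimately obtain U :: "real^'n^'n" and d where
    "transpose U ** mat 1 ** U = mat 1" and D: "transpose U ** (B ** transpose B) ** U = diag d"
    by (rule simultaneous_diagonalization)
  then have U: "transpose U ** U = mat 1" by simp
  then have U': "U ** transpose U = mat 1" using matrix_left_right_inverse by blast
  define V where "V = transpose U ** B"
  have VV: "V ** transpose V = diag d"
    using D by (simp add: V_def matrix_transpose_mul matrix_mul_assoc)
  have "invertible (transpose U)" using U invertible_right_inverse by blast
  then have "invertible V" unfolding V_def using B by (rule invertible_mult)
  then have "det V \<noteq> 0" by (simp add: invertible_det_nz)
  have d: "0 < d i" for i
  proof -
    have "transpose V *v axis i 1 \<noteq> 0"
      using \<open>invertible V\<close> by (metis axis_eq_0_iff invertible_left_inverse matrix_left_invertible_ker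
          transpose_invertible zero_neq_one)
    then have "0 < (transpose V *v axis i 1) \<bullet> (transpose V *v axis i 1)" by simp
    also have "\<dots> = quad (V ** transpose V) (axis i 1)"
      by (simp only: inner_matrix_transpose[of _ V] matrix_vector_mul_assoc[symmetric])
    finally show ?thesis by (simp add: VV inner_axis' diag_mult_vector)
  qed
  let ?r = "diag (\<lambda>i. sqrt (d i))" and ?s = "diag (\<lambda>i. 1 / sqrt (d i))"
  have d': "d i \<noteq> 0" for i using d[of i] by simp
  have rs: "?r ** ?s = mat 1" by (simp add: diag_mult mat_1_eq_diag d')
  define W where "W = ?s ** V"
  have V: "V = ?r ** W" by (simp add: W_def matrix_mul_assoc rs)
  have "W ** transpose W = ?s ** (V ** transpose V) ** ?s"
    by (simp add: W_def matrix_transpose_mul matrix_mul_assoc)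
  also have "\<dots> = mat 1"
    using d by (simp add: VV diag_mult mat_1_eq_diag less_imp_le d')
  finally have WW: "W ** transpose W = mat 1" .
  then have W: "transpose W ** W = mat 1" using matrix_left_right_inverse by blast
  have BU: "B = U ** (?r ** W)" by (simp add: V[symmetric] V_def matrix_mul_assoc U')
  have one: "\<bar>det U\<bar> = 1" "\<bar>det W\<bar> = 1"
    using arg_cong[OF U, of det] arg_cong[OF W, of det]
    by (auto simp: det_mul det_transpose power2_eq_square[symmetric] power2_eq_1_iff)
  have detB: "\<bar>det B\<bar> = \<bar>\<Prod>i\<in>UNIV. sqrt (d i)\<bar>"
    by (simp add: BU det_mul abs_mult one det_diag)
  have "(\<integral>\<^sup>+x. f x \<partial>lborel) = (\<integral>\<^sup>+x. f (U *v x) \<partial>lborel)"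
    by (rule nn_integral_lborel_orthogonal[OF U, symmetric]) simp
  also have "\<dots> = ennreal \<bar>det B\<bar> * (\<integral>\<^sup>+x. f (U *v (?r *v x)) \<partial>lborel)"
    unfolding detB by (rule nn_integral_lborel_diag) (use d' in auto)
  also have "(\<integral>\<^sup>+x. f (U *v (?r *v x)) \<partial>lborel) = (\<integral>\<^sup>+x. f (U *v (?r *v (W *v x))) \<partial>lborel)"
    by (rule nn_integral_lborel_orthogonal[OF W, symmetric]) simp
  finally show ?thesis by (simp add: BU matrix_vector_mul_assoc matrix_mul_assoc)
qed

section \<open>Gaussian densities and moments\<close>

abbreviation gauss :: "real^'n^'n \<Rightarrow> real^'n \<Rightarrow> ennreal" where
  "gauss S v \<equiv> ennreal (gaussian_density S v)"

definition std_gaussian :: "real^'n \<Rightarrow> real" where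
  "std_gaussian z = exp (- (z \<bullet> z) / 2) / sqrt ((2 * pi) ^ CARD('n))"

lemma std_gaussian_eq_prod: "std_gaussian z = (\<Prod>i\<in>UNIV. std_normal_density (z $ i))"
proof -
  have "(\<Prod>i\<in>UNIV. std_normal_density (z $ i)) = (\<Prod>i\<in>(UNIV::'a set). 1 / sqrt (2 * pi)) * exp (\<Sum>i\<in>UNIV. - (z $ i)\<^sup>2 / 2)"
    by (simp add: std_normal_density_def prod.distrib exp_sum prod_dividef power_one_over)
  also have "(\<Sum>i\<in>UNIV. - (z $ i)\<^sup>2 / 2) = - (z \<bullet> z) / 2"
    by (simp add: inner_vec_def power2_eq_square sum_negf sum_divide_distrib[symmetric])
  finally show ?thesis
    unfolding std_gaussian_def real_sqrt_power by (simp add: power_one_over)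
qed

lemma nn_integral_lborel_cart_prod:
  fixes f :: "'n::finite \<Rightarrow> real \<Rightarrow> ennreal"
  assumes [measurable]: "\<And>i. f i \<in> borel_measurable borel"
  shows "(\<integral>\<^sup>+z. (\<Prod>i\<in>UNIV. f i (z $ i)) \<partial>(lborel :: (real^'n) measure)) = (\<Prod>i\<in>UNIV. \<integral>\<^sup>+t. f i t \<partial>lborel)"
proof -
  have inj: "inj (\<lambda>i::'n. axis i (1::real))" by (auto simp: inj_on_def axis_eq_axis)
  let ?k = "the_inv (\<lambda>i::'n. axis i (1::real))"
  have k: "?k (axis i 1) = i" for i by (rule the_inv_f_f[OF inj])
  have "(\<integral>\<^sup>+z. (\<Prod>b\<in>Basis. f (?k b) (z \<bullet> b)) \<partial>(lborel :: (real^'n) measure)) = (\<Prod>b\<in>(Basis::(real^'n) set). \<integral>\<^sup>+t. f (?k b) t \<partial>lborel)"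
    by (intro nn_integral_lborel_prod) auto
  then show ?thesis
    by (simp add: Basis_cart_eq prod.reindex[OF inj] k inner_axis)
qed

lemma nn_integral_std_gaussian: "(\<integral>\<^sup>+z. ennreal (std_gaussian z) \<partial>lborel) = 1"
proof -
  have "(\<integral>\<^sup>+t. ennreal (std_normal_density t) \<partial>lborel) = 1"
    by (subst nn_integral_eq_integral) auto
  then show ?thesis
    using nn_integral_lborel_cart_prod[of "\<lambda>_ t. ennreal (std_normal_density t)"]
    by (simp add: std_gaussian_eq_prod prod_ennreal[symmetric])
qed

lemma nn_integral_std_gaussian_square:
  "(\<integral>\<^sup>+z. ennreal (std_gaussian z) * ennreal ((z $ k)\<^sup>2) \<partial>lborel) = 1"
proof -
  let ?f = "\<lambda>i t. ennreal (std_normal_density t) * (if i = k then ennreal (t\<^sup>2) else 1)"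
  have 1: "(\<integral>\<^sup>+t. ennreal (std_normal_density t) \<partial>lborel) = 1"
    by (subst nn_integral_eq_integral) auto
  have "has_bochner_integral lborel (\<lambda>x. std_normal_density x * x ^ (2 * 1)) 1"
    using std_normal_moment_even[of 1] by simp
  then have 2: "(\<integral>\<^sup>+t. ennreal (std_normal_density t) * ennreal (t\<^sup>2) \<partial>lborel) = 1"
    by (subst ennreal_mult[symmetric], simp, simp, subst nn_integral_eq_integral) (auto simp: has_bochner_integral_iff)
  have "ennreal (std_gaussian z) * ennreal ((z $ k)\<^sup>2) = (\<Prod>i\<in>UNIV. ?f i (z $ i))" for z :: "real^'a"
    by (simp add: std_gaussian_eq_prod prod_ennreal[symmetric] prod.distrib)
  then have "(\<integral>\<^sup>+z. ennreal (std_gaussian z) * ennreal ((z $ k)\<^sup>2) \<partial>lborel) = (\<Prod>i\<in>UNIV. \<integral>\<^sup>+t. ?f i t \<partial>lborel)"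
    by (simp only:) (rule nn_integral_lborel_cart_prod, measurable)
  also have "\<dots> = 1" by (intro prod.neutral ballI, case_tac "x = k") (simp_all add: 1 2)
  finally show ?thesis .
qed

lemma gaussian_density_measurable [measurable]: "gaussian_density S \<in> borel_measurable borel"
  unfolding gaussian_density_def by measurable

lemma gaussian_density_pos: "pos_def S \<Longrightarrow> 0 < gaussian_density S v"
  by (simp add: gaussian_density_def pos_def_det_pos)

text \<open>
  Substituting \<open>v = B z\<close> with \<open>S = B B\<^sup>T\<close> turns the density with covariance \<open>S\<close> into the standard one; this carries
  every Gaussian integral below back to a product of one-dimensional integrals.
\<close>

lemma gaussian_density_whiten:
  fixes B S :: "real^'n^'n"
  assumes S: "pos_def S" and B: "S = B ** transpose B"
  shows "\<bar>det B\<bar> * gaussian_density S (B *v z) = std_gaussian z" "invertible B"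
proof -
  have dS: "det S = (det B)\<^sup>2" by (simp add: B det_mul det_transpose power2_eq_square)
  have nz: "det B \<noteq> 0" using pos_def_det_pos[OF S] dS by auto
  then show "invertible B" by (simp add: invertible_det_nz)
  let ?y = "matrix_inv S *v (B *v z)"
  have "B *v (transpose B *v ?y) = B *v z"
    by (simp only: matrix_vector_mul_assoc B[symmetric] matrix_mul_assoc pos_def_matrix_inv[OF S] matrix_mul_lid)
  then have "transpose B *v ?y = z"
    by (rule injD[OF inj_matrix_vector_mult[OF \<open>invertible B\<close>]])
  then have "(B *v z) \<bullet> ?y = z \<bullet> z"
    by (subst inner_commute, subst inner_matrix_transpose) simp
  then show "\<bar>det B\<bar> * gaussian_density S (B *v z) = std_gaussian z"
    using nz by (simp add: gaussian_density_def std_gaussian_def dS real_sqrt_mult)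
qed

lemma nn_integral_gaussian:
  fixes B S :: "real^'n^'n"
  assumes S: "pos_def S" and B: "S = B ** transpose B" and [measurable]: "f \<in> borel_measurable borel"
  shows "(\<integral>\<^sup>+v. gauss S v * f v \<partial>lborel)
       = (\<integral>\<^sup>+z. ennreal (std_gaussian z) * f (B *v z) \<partial>lborel)"
proof -
  note w = gaussian_density_whiten[OF S B]
  have "(\<integral>\<^sup>+v. gauss S v * f v \<partial>lborel)
     = ennreal \<bar>det B\<bar> * (\<integral>\<^sup>+z. gauss S (B *v z) * f (B *v z) \<partial>lborel)"
    by (rule nn_integral_lborel_linear[OF w(2)]) simp
  also have "\<dots> = (\<integral>\<^sup>+z. ennreal (std_gaussian z) * f (B *v z) \<partial>lborel)"
    by (simp add: w(1)[symmetric] nn_integral_cmult[symmetric] ennreal_mult' mult.assoc)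
  finally show ?thesis .
qed

lemma pos_def_factor:
  fixes S :: "real^'n^'n"
  assumes "pos_def S"
  obtains B :: "real^'n^'n" where "S = B ** transpose B"
proof -
  have "transpose S = S" using assms by (simp add: pos_def_def)
  obtain B :: "real^'n^'n" and d where "S = B ** transpose B"
    by (rule simultaneous_factorization[OF assms \<open>transpose S = S\<close>])
  then show ?thesis by (rule that)
qed

lemma nn_integral_gaussian_density:
  fixes S :: "real^'n^'n"
  assumes S: "pos_def S"
  shows "(\<integral>\<^sup>+v. gauss S v \<partial>lborel) = 1"
proof -
  obtain B :: "real^'n^'n" where "S = B ** transpose B" by (rule pos_def_factor[OF S])
  from nn_integral_gaussian[OF S this, of "\<lambda>_. 1"] show ?thesis
    by (simp add: nn_integral_std_gaussian)
qed

lemma nn_integral_gaussian_density_shift: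
  assumes "pos_def S"
  shows "(\<integral>\<^sup>+v. gauss S (v - a) \<partial>lborel) = 1"
  using nn_integral_lborel_translate[of "\<lambda>v. gauss S v" "- a"]
  by (simp add: nn_integral_gaussian_density[OF assms])

text \<open>
  The factor \<open>B\<close> of \<open>S\<close> is chosen so that it diagonalises \<open>V\<close> as well; then only second moments of single
  standard coordinates occur.
\<close>

lemma nn_integral_gaussian_quadratic:
  fixes S V :: "real^'n^'n"
  assumes S: "pos_def S" and V: "pos_semidef V"
  shows "(\<integral>\<^sup>+v. gauss S v * ennreal (quad V v) \<partial>lborel) = ennreal (trace (V ** S))"
proof -
  have Vt: "transpose V = V" using V by (simp add: pos_semidef_def)
  obtain C :: "real^'n^'n" and d where
    C: "transpose C ** matrix_inv S ** C = mat 1" and D: "transpose C ** V ** C = diag d"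
    by (rule simultaneous_diagonalization[OF pos_def_matrix_inv(3)[OF S] Vt])
  have "C ** (transpose C ** matrix_inv S) = mat 1" using C matrix_left_right_inverse by blast
  then have "C ** (transpose C ** matrix_inv S) ** S = S" by simp
  then have SC: "S = C ** transpose C"
    by (simp add: matrix_mul_assoc[symmetric] pos_def_matrix_inv(2)[OF S])
  have q: "quad V (C *v z) = (\<Sum>i\<in>UNIV. d i * (z $ i)\<^sup>2)" for z
    by (simp only: diag_quadratic[symmetric] D[symmetric] matrix_vector_mul_assoc[symmetric]
        inner_matrix_transpose[of z "transpose C"] transpose_transpose)
  have d: "0 \<le> d i" for i
  proof -
    have "0 \<le> quad V (C *v axis i 1)" using V by (simp add: pos_semidef_def)
    also have "\<dots> = (\<Sum>j\<in>UNIV. if j = i then d i else 0)"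
      unfolding q by (intro sum.cong) (auto simp: axis_def)
    finally show ?thesis by simp
  qed
  have "(\<integral>\<^sup>+v. gauss S v * ennreal (quad V v) \<partial>lborel)
     = (\<integral>\<^sup>+z. ennreal (std_gaussian z) * (\<Sum>i\<in>UNIV. ennreal (d i) * ennreal ((z $ i)\<^sup>2)) \<partial>lborel)"
    by (subst nn_integral_gaussian[OF S SC]) (simp_all add: q sum_ennreal[symmetric] d ennreal_mult')
  also have "\<dots> = (\<Sum>i\<in>UNIV. ennreal (d i) * (\<integral>\<^sup>+z. ennreal (std_gaussian z) * ennreal ((z $ i)\<^sup>2) \<partial>lborel))"
    by (simp add: sum_distrib_left nn_integral_sum nn_integral_cmult[symmetric] mult.left_commute std_gaussian_def)
  also have "\<dots> = ennreal (\<Sum>i\<in>UNIV. d i)"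
    by (simp add: nn_integral_std_gaussian_square sum_ennreal d)
  also have "(\<Sum>i\<in>UNIV. d i) = trace (V ** S)"
  proof -
    have "trace (V ** S) = trace ((V ** C) ** transpose C)" by (simp add: SC matrix_mul_assoc)
    also have "\<dots> = trace (transpose C ** (V ** C))" by (rule trace_mul_sym)
    also have "\<dots> = trace (diag d)" by (simp add: D matrix_mul_assoc)
    finally show ?thesis by (simp add: trace_diag)
  qed
  finally show ?thesis .
qed

definition normal_law :: "real^'n^'n \<Rightarrow> (real^'n) measure" where
  "normal_law S = density lborel (\<lambda>v. gauss S v)"

lemma sets_normal_law [simp, measurable_cong]: "sets (normal_law S) = sets borel"
  by (simp add: normal_law_def)

lemma space_normal_law [simp]: "space (normal_law S) = UNIV"
  by (simp add: normal_law_def)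

lemma prob_space_normal_law: "pos_def S \<Longrightarrow> prob_space (normal_law S)"
  by (rule prob_spaceI) (simp add: normal_law_def emeasure_density nn_integral_gaussian_density)

lemma nn_integral_normal_law:
  "f \<in> borel_measurable borel \<Longrightarrow>
    (\<integral>\<^sup>+v. f v \<partial>normal_law S) = (\<integral>\<^sup>+v. gauss S v * f v \<partial>lborel)"
  by (simp add: normal_law_def nn_integral_density)

lemma nn_integral_normal_law_quadratic:
  "pos_def S \<Longrightarrow> pos_semidef V \<Longrightarrow> (\<integral>\<^sup>+v. ennreal (quad V v) \<partial>normal_law S) = ennreal (trace (V ** S))"
  by (subst nn_integral_normal_law) (simp_all add: nn_integral_gaussian_quadratic)

lemma has_bochner_integral_normal_law_quadratic:
  assumes S: "pos_def S" and V: "pos_semidef V"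
  shows "has_bochner_integral (normal_law S) (\<lambda>v. quad V v) (trace (V ** S))"
proof (rule has_bochner_integral_nn_integral)
  show "(\<lambda>v. quad V v) \<in> borel_measurable (normal_law S)" by measurable
  show "AE v in normal_law S. 0 \<le> quad V v" using V by (simp add: pos_semidef_def)
  show "0 \<le> trace (V ** S)"
  proof (rule ccontr)
    assume neg: "\<not> 0 \<le> trace (V ** S)"
    obtain B :: "real^'a^'a" where B: "S = B ** transpose B" by (rule pos_def_factor[OF S])
    have "trace (V ** S) = trace ((V ** B) ** transpose B)" by (simp add: B matrix_mul_assoc)
    also have "\<dots> = trace (transpose B ** (V ** B))" by (rule trace_mul_sym)
    also have "\<dots> = (\<Sum>i\<in>UNIV. quad (transpose B ** (V ** B)) (axis i 1))"
      by (simp add: trace_def inner_axis' matrix_vector_mult_basis column_def)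
    also have "\<dots> = (\<Sum>i\<in>UNIV. quad V (B *v axis i 1))"
      by (simp only: matrix_vector_mul_assoc[symmetric] inner_matrix_transpose[of _ "transpose B"] transpose_transpose)
    also have "\<dots> \<ge> 0" using V by (intro sum_nonneg) (simp add: pos_semidef_def)
    finally show False using neg by simp
  qed
qed (rule nn_integral_normal_law_quadratic[OF S V])

lemma normal_law_integrable_norm_square: 
  assumes S: "pos_def S"
  shows "integrable (normal_law S) (\<lambda>v. (norm v)\<^sup>2)"
proof -
  have "pos_semidef (mat 1 :: real^'a^'a)" by (simp add: pos_semidef_def)
  from has_bochner_integral_normal_law_quadratic[OF S this] show ?thesis
    by (simp add: has_bochner_integral_iff power2_norm_eq_inner)
qed

lemma gaussian_density_uminus: "gaussian_density S (- v) = gaussian_density S v"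
  by (simp add: gaussian_density_def matrix_vector_mult_diff_distrib[of _ 0, simplified])

text \<open>
  The law is invariant under \<open>v \<mapsto> - v\<close>.
\<close>

lemma normal_law_integral_linear: "(\<integral>v. a \<bullet> v \<partial>normal_law S) = 0"
proof -
  have "distr (normal_law S) borel uminus = normal_law S"
  proof (rule measure_eqI)
    fix X assume "X \<in> sets (distr (normal_law S) borel uminus)"
    then have [measurable]: "X \<in> sets borel" by simp
    have "emeasure (distr (normal_law S) borel uminus) X
        = (\<integral>\<^sup>+v. gauss S v * indicator X (- v) \<partial>lborel)"
      by (subst nn_integral_indicator[symmetric], simp, subst nn_integral_distr) (simp_all add: nn_integral_normal_law)
    also have "\<dots> = (\<integral>\<^sup>+v. gauss S (0 - v) * indicator X (0 - v) \<partial>lborel)"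
      by (simp add: gaussian_density_uminus)
    also have "\<dots> = (\<integral>\<^sup>+v. gauss S v * indicator X v \<partial>lborel)"
      by (rule nn_integral_lborel_reflect) simp
    also have "\<dots> = emeasure (normal_law S) X"
      by (simp add: normal_law_def emeasure_density)
    finally show "emeasure (distr (normal_law S) borel uminus) X = emeasure (normal_law S) X" .
  qed simp
  then have "(\<integral>v. a \<bullet> v \<partial>normal_law S) = (\<integral>v. a \<bullet> v \<partial>distr (normal_law S) borel uminus)" by simp
  also have "\<dots> = - (\<integral>v. a \<bullet> v \<partial>normal_law S)"
    by (subst integral_distr) simp_all
  finally show ?thesis by simp
qed

section \<open>Convolution of Gaussians\<close>

lemma matrix_add_rdistrib': "((A::real^'n^'m) + B) ** C = A ** C + B ** C"
  by (simp add: matrix_matrix_mult_def vec_eq_iff sum.distrib algebra_simps)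

lemma matrix_diff_rdistrib: "((A::real^'n^'m) - B) ** C = A ** C - B ** C"
  by (simp add: matrix_matrix_mult_def vec_eq_iff sum_subtractf algebra_simps)

lemma transpose_add: "transpose (A + B) = transpose A + transpose (B::real^'n^'m)"
  by (simp add: transpose_def vec_eq_iff)

lemma transpose_diff: "transpose (A - B) = transpose A - transpose (B::real^'n^'m)"
  by (simp add: transpose_def vec_eq_iff)

lemma congruence_quadratic:
  fixes A :: "real^'n^'m"
  shows "quad (A ** P ** transpose A) v = quad P (transpose A *v v)"
  by (simp only: matrix_vector_mul_assoc[symmetric] inner_matrix_transpose[of v A])

lemma pos_def_predict:
  assumes P: "pos_semidef P" and W: "pos_def W"
  shows "pos_def (A ** P ** transpose A + W)"
proof -
  have "0 < quad (A ** P ** transpose A + W) v" if "v \<noteq> 0" for v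
  proof -
    have "0 \<le> quad (A ** P ** transpose A) v"
      using P by (simp only: congruence_quadratic pos_semidef_def)
    moreover have "0 < quad W v" using W that by (simp add: pos_def_def)
    ultimately show ?thesis by (simp add: matrix_vector_mult_add_rdistrib inner_right_distrib)
  qed
  moreover have "transpose (A ** P ** transpose A + W) = A ** P ** transpose A + W"
    using P W by (simp add: pos_def_def pos_semidef_def transpose_add matrix_transpose_mul matrix_mul_assoc)
  ultimately show ?thesis by (simp add: pos_def_def)
qed

text \<open>
  The covariance of \<open>x\<close> given \<open>u = A x + w\<close> when \<open>x\<close> has covariance \<open>P\<close> and the independent noise \<open>w\<close> has
  covariance \<open>W\<close>.  It is also the Schur complement \<open>P - P A\<^sup>T (A P A\<^sup>T + W)\<^sup>-\<^sup>1 A P\<close> of the block matrix in the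
  semidefinite program.
\<close>

definition smooth_cov :: "real^'n^'n \<Rightarrow> real^'n^'n \<Rightarrow> real^'n^'n \<Rightarrow> real^'n^'n" where
  "smooth_cov A W P = matrix_inv (matrix_inv P + transpose A ** matrix_inv W ** A)"

context
  fixes A W P :: "real^'n^'n"
  assumes W: "pos_def W" and P: "pos_def P"
begin

abbreviation (input) "Zi \<equiv> matrix_inv P + transpose A ** matrix_inv W ** A"
abbreviation (input) "Z \<equiv> smooth_cov A W P"
abbreviation (input) "T \<equiv> A ** P ** transpose A + W"

lemma smooth_cov_inv: "pos_def Zi" "pos_def Z" "matrix_inv Z = Zi" "Z ** Zi = mat 1" "Zi ** Z = mat 1"
  "pos_def T"
proof -
  show Zi: "pos_def Zi"
    using pos_def_predict[OF pos_def_imp_pos_semidef[OF pos_def_matrix_inv(3)[OF W]] pos_def_matrix_inv(3)[OF P], of "transpose A"]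
    by (simp add: add.commute)
  show "pos_def Z" "matrix_inv Z = Zi" "Z ** Zi = mat 1" "Zi ** Z = mat 1"
    using pos_def_matrix_inv[OF Zi] pos_def_matrix_inv_inv[OF Zi] by (auto simp: smooth_cov_def)
  show "pos_def T" by (rule pos_def_predict[OF pos_def_imp_pos_semidef[OF P] W])
qed

lemma woodbury: "matrix_inv T = matrix_inv W - matrix_inv W ** A ** Z ** transpose A ** matrix_inv W"
proof -
  let ?Wi = "matrix_inv W"
  have "transpose A ** ?Wi ** T = (transpose A ** ?Wi ** A + matrix_inv P) ** P ** transpose A"
    by (simp add: matrix_add_ldistrib matrix_add_rdistrib' matrix_mul_assoc[symmetric] pos_def_matrix_inv[OF W] pos_def_matrix_inv[OF P])
  also have "\<dots> = Zi ** P ** transpose A" by (simp add: add.commute)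
  finally have *: "transpose A ** ?Wi ** T = Zi ** P ** transpose A" .
  have "(?Wi ** A ** Z ** transpose A ** ?Wi) ** T = ?Wi ** A ** Z ** (transpose A ** ?Wi ** T)"
    by (simp add: matrix_mul_assoc)
  also have "\<dots> = ?Wi ** A ** (Z ** Zi) ** P ** transpose A" by (simp add: * matrix_mul_assoc)
  also have "\<dots> = ?Wi ** A ** P ** transpose A" by (simp add: smooth_cov_inv)
  also have "\<dots> = ?Wi ** T - mat 1"
    by (simp add: matrix_add_ldistrib matrix_mul_assoc pos_def_matrix_inv[OF W])
  finally have "(?Wi - ?Wi ** A ** Z ** transpose A ** ?Wi) ** T = mat 1"
    by (simp only: matrix_diff_rdistrib) simp
  then have "T ** (?Wi - ?Wi ** A ** Z ** transpose A ** ?Wi) = mat 1"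
    using matrix_left_right_inverse by blast
  then show ?thesis by (rule matrix_inv_eqI)
qed

text \<open>
  The joint exponent of \<open>(x, A x + w)\<close>, rewritten from prior times likelihood to posterior times evidence;
  \<open>L u\<close> is the conditional mean of \<open>x\<close>.
\<close>

lemma complete_square:
  fixes x u :: "real^'n"
  defines "L \<equiv> Z ** transpose A ** matrix_inv W"
  shows "quad (matrix_inv P) x + quad (matrix_inv W) (u - A *v x)
     = quad Zi (x - L *v u) + quad (matrix_inv T) u"
proof -
  let ?Wi = "matrix_inv W" and ?c = "transpose A *v (matrix_inv W *v u)"
  have Lu: "L *v u = Z *v ?c" by (simp only: L_def matrix_vector_mul_assoc matrix_mul_assoc)
  have Zt: "transpose Zi = Zi" using smooth_cov_inv(1) by (simp add: pos_def_def)
  have ZL: "Zi *v (L *v u) = ?c"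
    by (simp only: Lu matrix_vector_mul_assoc[of Zi] smooth_cov_inv matrix_vector_mul_lid)
  have Wt: "transpose ?Wi = ?Wi" by (rule pos_def_matrix_inv(4)[OF W])
  have cross: "a \<bullet> (transpose A *v b) = (A *v a) \<bullet> b" for a b
    by (simp only: inner_matrix_transpose[of a "transpose A"] transpose_transpose)
  have "quad Zi (x - L *v u) = quad Zi x - 2 * (x \<bullet> ?c) + (L *v u) \<bullet> ?c"
    using inner_symmetric_matrix[OF Zt, of "L *v u" x]
    by (simp only: matrix_vector_mult_diff_distrib inner_diff_left inner_diff_right ZL)
  also have "quad Zi x = quad (matrix_inv P) x + quad ?Wi (A *v x)"
    using congruence_quadratic[of x "transpose A" ?Wi]
    by (simp only: matrix_vector_mult_add_rdistrib inner_right_distrib transpose_transpose)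
  also have "x \<bullet> ?c = (A *v x) \<bullet> (?Wi *v u)" by (rule cross)
  also have "(L *v u) \<bullet> ?c = quad (?Wi ** A ** Z ** transpose A ** ?Wi) u"
  proof -
    have "(L *v u) \<bullet> ?c = (?Wi *v u) \<bullet> (A *v (L *v u))" by (simp only: cross inner_commute)
    also have "\<dots> = u \<bullet> (?Wi *v (A *v (L *v u)))" by (simp only: inner_matrix_transpose[of u ?Wi] Wt)
    finally show ?thesis by (simp only: L_def matrix_vector_mul_assoc matrix_mul_assoc)
  qed
  finally show ?thesis
    using inner_symmetric_matrix[OF Wt, of "A *v x" u]
    by (simp add: woodbury matrix_vector_mult_diff_distrib matrix_vector_mult_diff_rdistrib inner_diff_left inner_diff_right)
qed

text \<open>
  By completion of the square, the integrand is a density in \<open>x\<close> with covariance \<open>Z\<close> times a constant multiple of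
  the density in \<open>u\<close> with covariance \<open>T\<close>.  Integrating over \<open>x\<close> and \<open>u\<close> in both orders shows that the constant is \<open>1\<close>.
  The constant is a ratio of square roots of determinants, so the determinant identity comes out of the same
  computation.
\<close>

lemma gaussian_convolution_aux:
  shows gaussian_convolution0: "(\<integral>\<^sup>+x. gauss P x * gauss W (u - A *v x) \<partial>lborel)
      = gauss T u"
    and det_smooth_cov: "det Z * det T = det P * det W"
proof -
  define k where "k = sqrt ((2 * pi) ^ CARD('n) * det Z) / (sqrt ((2 * pi) ^ CARD('n) * det P) * sqrt ((2 * pi) ^ CARD('n) * det W))"
  define s where "s = sqrt ((2 * pi) ^ CARD('n) * det T)"
  define L where "L = Z ** transpose A ** matrix_inv W"
  note pd = pos_def_det_pos[OF W] pos_def_det_pos[OF P] pos_def_det_pos[OF smooth_cov_inv(2)] pos_def_det_pos[OF smooth_cov_inv(6)]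
  have k: "0 < k" and s: "0 < s" using pd by (simp_all add: k_def s_def)
  have split: "gaussian_density P x * gaussian_density W (u - A *v x) = gaussian_density Z (x - L *v u) * (k * s * gaussian_density T u)" for x u
  proof -
    have "gaussian_density P x * gaussian_density W (u - A *v x)
      = exp (- (quad (matrix_inv P) x + quad (matrix_inv W) (u - A *v x)) / 2)
        / (sqrt ((2 * pi) ^ CARD('n) * det P) * sqrt ((2 * pi) ^ CARD('n) * det W))"
      by (simp add: gaussian_density_def exp_add[symmetric] add_divide_distrib diff_divide_distrib)
    also have "\<dots> = exp (- quad Zi (x - L *v u) / 2) * exp (- quad (matrix_inv T) u / 2)
        / (sqrt ((2 * pi) ^ CARD('n) * det P) * sqrt ((2 * pi) ^ CARD('n) * det W))"
      unfolding complete_square L_def[symmetric] by (simp add: exp_add[symmetric] add_divide_distrib diff_divide_distrib)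
    also have "\<dots> = gaussian_density Z (x - L *v u) * (k * s * gaussian_density T u)"
    proof -
      have "sqrt ((2 * pi) ^ CARD('n) * det Z) \<noteq> 0" using pd by simp
      then have "gaussian_density Z (x - L *v u) * k = exp (- quad Zi (x - L *v u) / 2)
        / (sqrt ((2 * pi) ^ CARD('n) * det P) * sqrt ((2 * pi) ^ CARD('n) * det W))"
        unfolding gaussian_density_def[of Z] k_def smooth_cov_inv(3) by (simp del: real_sqrt_eq_zero_cancel_iff)
      moreover have "s * gaussian_density T u = exp (- quad (matrix_inv T) u / 2)"
      proof -
        have "sqrt ((2 * pi) ^ CARD('n) * det T) \<noteq> 0" using pd by simp
        then show ?thesis
          unfolding gaussian_density_def[of T] s_def by (simp del: real_sqrt_eq_zero_cancel_iff)
      qed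
      moreover have "gaussian_density Z (x - L *v u) * (k * s * gaussian_density T u)
          = (gaussian_density Z (x - L *v u) * k) * (s * gaussian_density T u)" by (simp only: mult_ac)
      ultimately show ?thesis by (simp only: times_divide_eq_left)
    qed
    finally show ?thesis .
  qed
  have conv: "(\<integral>\<^sup>+x. gauss P x * gauss W (u - A *v x) \<partial>lborel)
      = ennreal (k * s) * gauss T u" for u
  proof -
    have "(\<integral>\<^sup>+x. gauss P x * gauss W (u - A *v x) \<partial>lborel)
      = (\<integral>\<^sup>+x. gauss Z (- (L *v u) + x) * ennreal (k * s * gaussian_density T u) \<partial>lborel)"
    proof (rule nn_integral_cong)
      fix x :: "real^'n"
      have "gauss P x * gauss W (u - A *v x)
         = ennreal (gaussian_density P x * gaussian_density W (u - A *v x))"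
        by (rule ennreal_mult[symmetric]) (intro less_imp_le gaussian_density_pos P W)+
      also have "\<dots> = ennreal (gaussian_density Z (- (L *v u) + x) * (k * s * gaussian_density T u))"
        by (simp only: split uminus_add_conv_diff)
      also have "\<dots> = gauss Z (- (L *v u) + x) * ennreal (k * s * gaussian_density T u)"
        by (rule ennreal_mult) (intro less_imp_le gaussian_density_pos mult_pos_pos k s smooth_cov_inv)+
      finally show "gauss P x * gauss W (u - A *v x)
         = gauss Z (- (L *v u) + x) * ennreal (k * s * gaussian_density T u)" .
    qed
    also have "\<dots> = ennreal (k * s * gaussian_density T u)"
      by (simp add: nn_integral_multc nn_integral_gaussian_density_shift[OF smooth_cov_inv(2)])
    finally show ?thesis
      using k s by (simp only: ennreal_mult' mult_nonneg_nonneg less_imp_le)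
  qed
  have "1 = (\<integral>\<^sup>+x. gauss P x * (\<integral>\<^sup>+u. gauss W (u - A *v x) \<partial>lborel) \<partial>lborel)"
    by (simp add: nn_integral_gaussian_density_shift[OF W] nn_integral_gaussian_density[OF P])
  also have "\<dots> = (\<integral>\<^sup>+x. \<integral>\<^sup>+u. gauss P x * gauss W (u - A *v x) \<partial>lborel \<partial>lborel)"
    by (simp add: nn_integral_cmult[symmetric])
  also have "\<dots> = (\<integral>\<^sup>+u. \<integral>\<^sup>+x. gauss P x * gauss W (u - A *v x) \<partial>lborel \<partial>lborel)"
    by (rule lborel_pair.Fubini') simp
  also have "\<dots> = ennreal (k * s)"
    by (simp only: conv) (simp add: nn_integral_cmult nn_integral_gaussian_density[OF smooth_cov_inv(6)])
  finally have ks: "k * s = 1" using k s by (simp add: ennreal_eq_1)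
  then show "(\<integral>\<^sup>+x. gauss P x * gauss W (u - A *v x) \<partial>lborel)
      = gauss T u" for u by (simp add: conv)
  have "k\<^sup>2 * s\<^sup>2 = det Z * det T / (det P * det W)"
    using pd by (simp add: k_def s_def power_divide power_mult_distrib field_simps)
  moreover have "k\<^sup>2 * s\<^sup>2 = 1" using ks by (simp add: power_mult_distrib[symmetric])
  ultimately show "det Z * det T = det P * det W" using pd by (simp add: field_simps)
qed

theorem gaussian_convolution:
  "(\<integral>\<^sup>+x. gauss P (x - y) * gauss W (u - A *v x) \<partial>lborel)
      = gauss T (u - A *v y)"
proof -
  have "(\<integral>\<^sup>+x. gauss P (x - y) * gauss W (u - A *v x) \<partial>lborel)
    = (\<integral>\<^sup>+x. gauss P ((y + x) - y) * gauss W (u - A *v (y + x)) \<partial>lborel)"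
    by (rule nn_integral_lborel_translate[symmetric]) simp
  also have "\<dots> = (\<integral>\<^sup>+x. gauss P x * gauss W ((u - A *v y) - A *v x) \<partial>lborel)"
    by (simp add: matrix_vector_right_distrib diff_diff_eq)
  finally show ?thesis by (simp add: gaussian_convolution0)
qed

text \<open>
  The hypothesis is the block inequality of the semidefinite program, written as a form in \<open>(e, v)\<close>.  Evaluated at
  the \<open>v\<close> that minimises it for given \<open>e\<close>, it says that \<open>Q\<close> lies below the Schur complement \<open>Z\<close>.
\<close>

lemma smooth_cov_upper:
  assumes feas: "\<And>e v. 0 \<le> quad P (e + transpose A *v v) + quad W v - quad Q e"
  shows "quad Q e \<le> quad Z e"
proof -
  define f where "f = Z *v e"
  define v where "v = - (matrix_inv W *v (A *v f))"
  have e: "e = Zi *v f" by (simp only: f_def matrix_vector_mul_assoc smooth_cov_inv matrix_vector_mul_lid)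
  have "e + transpose A *v v = matrix_inv P *v f"
    by (simp add: e v_def matrix_vector_mult_add_rdistrib matrix_vector_mul_assoc matrix_mul_assoc
        matrix_vector_mult_diff_distrib[of _ 0, simplified] del: transpose_matrix_vector)
  then have 1: "quad P (e + transpose A *v v) = quad (matrix_inv P) f"
    by (simp add: matrix_vector_mul_assoc pos_def_matrix_inv[OF P] inner_commute)
  have 2: "quad W v = quad (matrix_inv W) (A *v f)"
    by (simp add: v_def matrix_vector_mult_diff_distrib[of _ 0, simplified])
       (simp add: matrix_vector_mul_assoc matrix_mul_assoc pos_def_matrix_inv[OF W] inner_commute)
  have 3: "quad Z e = quad (matrix_inv P) f + quad (matrix_inv W) (A *v f)"
    using congruence_quadratic[of f "transpose A" "matrix_inv W"]
    by (simp only: f_def[symmetric] inner_commute[of e f])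
       (simp only: e matrix_vector_mult_add_rdistrib inner_right_distrib transpose_transpose)
  show ?thesis using feas[of e v] unfolding 1 2 3 by simp
qed

end

section \<open>Causal kernels and joint laws\<close>

abbreviation hist_pair :: "nat \<Rightarrow> ((nat \<Rightarrow> 'e::euclidean_space) \<times> (nat \<Rightarrow> 'e)) measure" where
  "hist_pair m \<equiv> hist m \<Otimes>\<^sub>M hist m"

text \<open>
  The law of the first \<open>m\<close> outputs, with \<open>m = 0\<close> allowed so that inductions can start at the empty output.  The
  input is the whole path \<open>u\<close>, so that prefixes of different lengths share one argument; each kernel sees its past only.
\<close>

definition causal_prefix ::
    "'e::euclidean_space kernels \<Rightarrow> nat \<Rightarrow> (nat \<Rightarrow> 'e) \<Rightarrow> (nat \<Rightarrow> 'e) measure" where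
  "causal_prefix K m u =
     Ionescu_Tulcea.C (\<lambda>t y. K t (y, restrict u {0..<Suc t})) (\<lambda>_. borel) 0 m (\<lambda>_. undefined)"

lemma causal_law_eq_prefix: "causal_law K n u = causal_prefix K (Suc n) u"
  by (simp add: causal_law_def causal_prefix_def)

lemma restrict_measurable_hist: "m \<le> n \<Longrightarrow> (\<lambda>u. restrict u {0..<m}) \<in> hist n \<rightarrow>\<^sub>M hist m"
  by (rule measurable_restrict_subset) auto

lemma fun_upd_measurable_hist:
  fixes g :: "'w \<Rightarrow> 'e::euclidean_space"
  assumes "f \<in> M \<rightarrow>\<^sub>M hist m" "g \<in> M \<rightarrow>\<^sub>M borel"
  shows "(\<lambda>x. (f x)(m := g x)) \<in> M \<rightarrow>\<^sub>M hist (Suc m)"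
  by (rule measurable_fun_upd[where J="{0..<m}"]) (use assms in auto)

context
  fixes K :: "'e::euclidean_space kernels"
  assumes K: "K \<in> causal_kernels"
begin

lemma kernel_measurable: "K t \<in> hist t \<Otimes>\<^sub>M hist (Suc t) \<rightarrow>\<^sub>M prob_algebra borel"
  using K by (simp add: causal_kernels_def)

lemma causal_prefix_0: "causal_prefix K 0 u = return (hist 0) (\<lambda>_. undefined)"
proof -
  interpret I: Ionescu_Tulcea "\<lambda>t y. K t (y, restrict u {0..<Suc t})" "\<lambda>_. borel"
    by (rule Ionescu_Tulcea_causal_kernels[OF K])
  show ?thesis by (simp add: causal_prefix_def)
qed

lemma causal_prefix_Suc:
  "causal_prefix K (Suc m) u = causal_prefix K m u \<bind>
     (\<lambda>y. distr (K m (y, restrict u {0..<Suc m})) (hist (Suc m)) (fun_upd y m))"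
proof -
  interpret I: Ionescu_Tulcea "\<lambda>t y. K t (y, restrict u {0..<Suc t})" "\<lambda>_. borel"
    by (rule Ionescu_Tulcea_causal_kernels[OF K])
  show ?thesis by (simp add: causal_prefix_def I.eP_def[abs_def])
qed

lemma causal_prefix_prob: "causal_prefix K m u \<in> space (prob_algebra (hist m))"
proof -
  interpret I: Ionescu_Tulcea "\<lambda>t y. K t (y, restrict u {0..<Suc t})" "\<lambda>_. borel"
    by (rule Ionescu_Tulcea_causal_kernels[OF K])
  show ?thesis
    using I.sets_C[of "\<lambda>_. undefined" 0 m] I.prob_space_C[of "\<lambda>_. undefined" 0 m]
    by (simp add: causal_prefix_def space_prob_algebra)
qed

lemma sets_causal_prefix [measurable_cong]: "sets (causal_prefix K m u) = sets (hist m)"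
  using causal_prefix_prob[of m u] by (simp add: space_prob_algebra)

lemma space_causal_prefix: "space (causal_prefix K m u) = space (hist m)"
  by (rule sets_eq_imp_space_eq[OF sets_causal_prefix])

lemma causal_prefix_cong:
  "(\<And>i. i < m \<Longrightarrow> u i = u' i) \<Longrightarrow> causal_prefix K m u = causal_prefix K m u'"
proof (induction m)
  case 0 then show ?case by (simp add: causal_prefix_0)
next
  case (Suc m)
  have "restrict u {0..<Suc m} = restrict u' {0..<Suc m}" using Suc.prems by (auto simp: restrict_def)
  with Suc show ?case by (simp add: causal_prefix_Suc)
qed

lemma causal_prefix_measurable: "m \<le> n \<Longrightarrow> causal_prefix K m \<in> hist n \<rightarrow>\<^sub>M prob_algebra (hist m)"
proof (induction m)
  case 0 then show ?case by (simp add: causal_prefix_0[abs_def] prob_space_return space_prob_algebra cong: measurable_cong)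
next
  case (Suc m)
  have [measurable]: "causal_prefix K m \<in> hist n \<rightarrow>\<^sub>M prob_algebra (hist m)" using Suc by simp
  have [measurable]: "(\<lambda>u. restrict u {0..<Suc m}) \<in> hist n \<rightarrow>\<^sub>M hist (Suc m)"
    by (rule restrict_measurable_hist) (use Suc in simp)
  note kernel_measurable[measurable]
  have [measurable]: "(\<lambda>x. (snd (fst x))(m := snd x)) \<in> ((hist n \<Otimes>\<^sub>M hist m) \<Otimes>\<^sub>M borel) \<rightarrow>\<^sub>M hist (Suc m)"
    by (rule fun_upd_measurable_hist) measurable
  have "(\<lambda>u. causal_prefix K m u \<bind> (\<lambda>y. distr (K m (y, restrict u {0..<Suc m})) (hist (Suc m)) (fun_upd y m)))
      \<in> hist n \<rightarrow>\<^sub>M prob_algebra (hist (Suc m))"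
  proof (rule measurable_bind_prob_space2)
    show "(\<lambda>(u, y). distr (K m (y, restrict u {0..<Suc m})) (hist (Suc m)) (fun_upd y m))
      \<in> hist n \<Otimes>\<^sub>M hist m \<rightarrow>\<^sub>M prob_algebra (hist (Suc m))"
      unfolding case_prod_beta
      by (rule measurable_distr_prob_space2[where M=borel]) (simp_all add: case_prod_beta)
  qed measurable
  then show ?case by (simp add: causal_prefix_Suc[abs_def])
qed

lemma nn_integral_causal_prefix_Suc:
  assumes [measurable]: "f \<in> borel_measurable (hist (Suc m))"
  shows "(\<integral>\<^sup>+y. f y \<partial>causal_prefix K (Suc m) u)
    = (\<integral>\<^sup>+y. \<integral>\<^sup>+z. f (y(m := z)) \<partial>K m (y, restrict u {0..<Suc m}) \<partial>causal_prefix K m u)"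
proof -
  interpret I: Ionescu_Tulcea "\<lambda>t y. K t (y, restrict u {0..<Suc t})" "\<lambda>_. borel"
    by (rule Ionescu_Tulcea_causal_kernels[OF K])
  have "(\<integral>\<^sup>+y. f y \<partial>causal_prefix K (Suc m) u)
      = (\<integral>\<^sup>+y. \<integral>\<^sup>+z. f z \<partial>I.eP m y \<partial>causal_prefix K m u)"
    unfolding causal_prefix_def I.C.simps
    by (subst nn_integral_bind[where B="hist (Suc m)"]) (simp_all add: I.sets_C cong: measurable_cong_sets)
  also have "\<dots> = (\<integral>\<^sup>+y. \<integral>\<^sup>+z. f (y(m := z)) \<partial>K m (y, restrict u {0..<Suc m}) \<partial>causal_prefix K m u)"
    by (intro nn_integral_cong I.nn_integral_eP) (simp_all add: space_causal_prefix)
  finally show ?thesis .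
qed

text \<open>
  Later outputs integrate out to \<open>1\<close>.
\<close>

lemma nn_integral_causal_prefix_restrict:
  assumes "m \<le> n" and f: "f \<in> borel_measurable (hist m)"
  shows "(\<integral>\<^sup>+y. f (restrict y {0..<m}) \<partial>causal_prefix K n u) = (\<integral>\<^sup>+y. f y \<partial>causal_prefix K m u)"
proof -
  interpret I: Ionescu_Tulcea "\<lambda>t y. K t (y, restrict u {0..<Suc t})" "\<lambda>_. borel"
    by (rule Ionescu_Tulcea_causal_kernels[OF K])
  show ?thesis
    using I.nn_integral_C[of m n f 0 "\<lambda>_. undefined"] assms by (simp add: causal_prefix_def)
qed

end

lemma measurable_hist_component:
  "i < m \<Longrightarrow> (\<lambda>u. u i) \<in> hist m \<rightarrow>\<^sub>M (borel :: 'e::euclidean_space measure)"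
  by (rule measurable_component_singleton) simp

definition truncate_pair :: "nat \<Rightarrow> (nat \<Rightarrow> 'e::euclidean_space) \<times> (nat \<Rightarrow> 'e) \<Rightarrow> (nat \<Rightarrow> 'e) \<times> (nat \<Rightarrow> 'e)" where
  "truncate_pair m p = (restrict (fst p) {0..<m}, restrict (snd p) {0..<m})"

lemma truncate_pair_measurable: "m \<le> n \<Longrightarrow> truncate_pair m \<in> hist_pair n \<rightarrow>\<^sub>M hist_pair m"
proof -
  assume mn: "m \<le> n"
  note restrict_measurable_hist[OF mn, measurable]
  show ?thesis unfolding truncate_pair_def by measurable
qed

locale random_source = prob_space M for M :: "'w measure" +
  fixes x :: "nat \<Rightarrow> 'w \<Rightarrow> 'e::euclidean_space"
  assumes x_measurable [measurable]: "\<And>t. x t \<in> borel_measurable M"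
begin

definition source_path :: "nat \<Rightarrow> 'w \<Rightarrow> nat \<Rightarrow> 'e" where
  "source_path m \<omega> = (\<lambda>t\<in>{0..<m}. x t \<omega>)"

lemma source_path_measurable [measurable]: "source_path m \<in> M \<rightarrow>\<^sub>M hist m"
  unfolding source_path_def by measurable

lemma source_path_nth: "i < m \<Longrightarrow> source_path m \<omega> i = x i \<omega>"
  by (simp add: source_path_def)

lemma restrict_source_path: "m \<le> n \<Longrightarrow> restrict (source_path n \<omega>) {0..<m} = source_path m \<omega>"
  by (auto simp: source_path_def restrict_def)

lemma source_law_eq: "source_law M x n = distr M (hist (Suc n)) (source_path (Suc n))"
  by (simp add: source_law_def source_path_def[abs_def])

lemma prob_space_source_law: "prob_space (source_law M x n)"
  unfolding source_law_eq by (rule prob_space_distr) measurable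

lemma sets_source_law [measurable_cong, simp]: "sets (source_law M x n) = sets (hist (Suc n))"
  by (simp add: source_law_def)

lemma space_source_law: "space (source_law M x n) = space (hist (Suc n))"
  by (simp add: source_law_def)

lemma source_law_in_prob_algebra: "source_law M x n \<in> space (prob_algebra (hist (Suc n)))"
  by (simp add: space_prob_algebra prob_space_source_law)

abbreviation causal_information :: "real \<Rightarrow> 'e kernels \<Rightarrow> nat \<Rightarrow> ereal" where
  "causal_information b K n \<equiv> ext_mutual_information b (joint_law M x K n) (hist (Suc n)) (hist (Suc n)) fst snd"

lemma nn_integral_source_law:
  "f \<in> borel_measurable (hist (Suc n)) \<Longrightarrow> (\<integral>\<^sup>+u. f u \<partial>source_law M x n) = (\<integral>\<^sup>+\<omega>. f (source_path (Suc n) \<omega>) \<partial>M)"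
  unfolding source_law_eq by (rule nn_integral_distr) measurable

context
  fixes K :: "'e kernels"
  assumes K: "K \<in> causal_kernels"
begin

lemma joint_kernel_measurable:
  "(\<lambda>u. causal_law K n u \<bind> (\<lambda>y. return (hist_pair (Suc n)) (u, y)))
     \<in> hist (Suc n) \<rightarrow>\<^sub>M prob_algebra (hist_pair (Suc n))"
proof -
  note causal_prefix_measurable[OF K order.refl, measurable]
  show ?thesis unfolding causal_law_eq_prefix by measurable
qed

lemma joint_law_in_prob_algebra: "joint_law M x K n \<in> space (prob_algebra (hist_pair (Suc n)))"
  unfolding joint_law_def
  using measurable_space[OF measurable_bind_prob_space[OF measurable_ident_sets[OF refl, where M="prob_algebra (hist (Suc n))"] joint_kernel_measurable] source_law_in_prob_algebra]
  by simp

lemma prob_space_joint_law: "prob_space (joint_law M x K n)"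
  using joint_law_in_prob_algebra by (simp add: space_prob_algebra)

lemma sets_joint_law [measurable_cong]: "sets (joint_law M x K n) = sets (hist_pair (Suc n))"
  using joint_law_in_prob_algebra by (simp add: space_prob_algebra)

lemma nn_integral_joint_law:
  assumes [measurable]: "f \<in> borel_measurable (hist_pair (Suc n))"
  shows "(\<integral>\<^sup>+p. f p \<partial>joint_law M x K n)
     = (\<integral>\<^sup>+\<omega>. \<integral>\<^sup>+y. f (source_path (Suc n) \<omega>, y) \<partial>causal_prefix K (Suc n) (source_path (Suc n) \<omega>) \<partial>M)"
proof -
  note causal_prefix_measurable[OF K order.refl, measurable]
  have [measurable]: "causal_prefix K (Suc n) \<in> hist (Suc n) \<rightarrow>\<^sub>M subprob_algebra (hist (Suc n))"
    by (rule measurable_prob_algebraD) measurable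
  have [measurable_cong]: "sets (causal_prefix K (Suc n) u) = sets (hist (Suc n))" for u
    by (rule sets_causal_prefix[OF K])
  have "(\<integral>\<^sup>+p. f p \<partial>joint_law M x K n)
     = (\<integral>\<^sup>+u. \<integral>\<^sup>+p. f p \<partial>(causal_prefix K (Suc n) u \<bind> (\<lambda>y. return (hist_pair (Suc n)) (u, y))) \<partial>source_law M x n)"
    unfolding joint_law_def causal_law_eq_prefix[symmetric]
    by (rule nn_integral_bind[OF assms])
       (use measurable_prob_algebraD[OF joint_kernel_measurable] in \<open>simp cong: measurable_cong_sets\<close>)
  also have "\<dots> = (\<integral>\<^sup>+u. \<integral>\<^sup>+y. f (u, y) \<partial>causal_prefix K (Suc n) u \<partial>source_law M x n)"
  proof (rule nn_integral_cong)
    fix u assume "u \<in> space (source_law M x n)"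
    then have u: "u \<in> space (hist (Suc n))" by (simp add: space_source_law)
    have "(\<integral>\<^sup>+p. f p \<partial>(causal_prefix K (Suc n) u \<bind> (\<lambda>y. return (hist_pair (Suc n)) (u, y))))
      = (\<integral>\<^sup>+y. \<integral>\<^sup>+p. f p \<partial>return (hist_pair (Suc n)) (u, y) \<partial>causal_prefix K (Suc n) u)"
      by (rule nn_integral_bind[OF assms]) (use u in measurable)
    also have "\<dots> = (\<integral>\<^sup>+y. f (u, y) \<partial>causal_prefix K (Suc n) u)"
      by (intro nn_integral_cong nn_integral_return) (use u in \<open>auto simp: space_causal_prefix[OF K] space_pair_measure\<close>)
    finally show "(\<integral>\<^sup>+p. f p \<partial>(causal_prefix K (Suc n) u \<bind> (\<lambda>y. return (hist_pair (Suc n)) (u, y))))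
      = (\<integral>\<^sup>+y. f (u, y) \<partial>causal_prefix K (Suc n) u)" .
  qed
  also have "\<dots> = (\<integral>\<^sup>+\<omega>. \<integral>\<^sup>+y. f (source_path (Suc n) \<omega>, y) \<partial>causal_prefix K (Suc n) (source_path (Suc n) \<omega>) \<partial>M)"
    by (rule nn_integral_source_law) (rule nn_integral_measurable_subprob_algebra2, measurable)
  finally show ?thesis .
qed

text \<open>
  Causality in integrated form: the outputs after time \<open>t\<close> integrate out, and the first \<open>t + 1\<close> outputs are drawn
  from \<open>x\<^sup>t\<close> alone even though the integrand may look at the entire input path through \<open>g\<close>.
\<close>

lemma nn_integral_joint_law_causal:
  assumes tn: "t \<le> n" and f: "f \<in> borel_measurable ((hist_pair (Suc t)) \<Otimes>\<^sub>M N)"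
    and g: "g \<in> hist (Suc n) \<rightarrow>\<^sub>M N"
  shows "(\<integral>\<^sup>+p. f (truncate_pair (Suc t) p, g (fst p)) \<partial>joint_law M x K n)
    = (\<integral>\<^sup>+\<omega>. \<integral>\<^sup>+y. f ((source_path (Suc t) \<omega>, y), g (source_path (Suc n) \<omega>)) \<partial>causal_prefix K (Suc t) (source_path (Suc t) \<omega>) \<partial>M)"
proof -
  have le: "Suc t \<le> Suc n" using tn by simp
  note restrict_measurable_hist[OF le, measurable] f[measurable] g[measurable]
  have "(\<integral>\<^sup>+p. f (truncate_pair (Suc t) p, g (fst p)) \<partial>joint_law M x K n)
    = (\<integral>\<^sup>+\<omega>. \<integral>\<^sup>+y. f ((source_path (Suc t) \<omega>, restrict y {0..<Suc t}), g (source_path (Suc n) \<omega>)) \<partial>causal_prefix K (Suc n) (source_path (Suc n) \<omega>) \<partial>M)"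
    by (subst nn_integral_joint_law) (simp_all add: truncate_pair_def restrict_source_path[OF le])
  also have "\<dots> = (\<integral>\<^sup>+\<omega>. \<integral>\<^sup>+y. f ((source_path (Suc t) \<omega>, y), g (source_path (Suc n) \<omega>)) \<partial>causal_prefix K (Suc t) (source_path (Suc t) \<omega>) \<partial>M)"
  proof (rule nn_integral_cong)
    fix \<omega> assume \<omega>: "\<omega> \<in> space M"
    have "source_path (Suc t) \<omega> \<in> space (hist (Suc t))" "source_path (Suc n) \<omega> \<in> space (hist (Suc n))"
      by (rule measurable_space[OF source_path_measurable \<omega>])+
    then have [measurable]: "(\<lambda>y. f ((source_path (Suc t) \<omega>, y), g (source_path (Suc n) \<omega>))) \<in> borel_measurable (hist (Suc t))"
      using measurable_space[OF g] by measurable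
    have "causal_prefix K (Suc t) (source_path (Suc n) \<omega>) = causal_prefix K (Suc t) (source_path (Suc t) \<omega>)"
      using tn by (intro causal_prefix_cong[OF K]) (simp add: source_path_nth)
    then show "(\<integral>\<^sup>+y. f ((source_path (Suc t) \<omega>, restrict y {0..<Suc t}), g (source_path (Suc n) \<omega>)) \<partial>causal_prefix K (Suc n) (source_path (Suc n) \<omega>))
       = (\<integral>\<^sup>+y. f ((source_path (Suc t) \<omega>, y), g (source_path (Suc n) \<omega>)) \<partial>causal_prefix K (Suc t) (source_path (Suc t) \<omega>))"
      using nn_integral_causal_prefix_restrict[OF K le, of "\<lambda>y. f ((source_path (Suc t) \<omega>, y), g (source_path (Suc n) \<omega>))" "source_path (Suc n) \<omega>"]
      by simp
  qed
  finally show ?thesis .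
qed

lemma distr_joint_law_truncate:
  assumes tn: "t \<le> n"
  shows "distr (joint_law M x K n) (hist_pair (Suc t)) (truncate_pair (Suc t)) = joint_law M x K t"
proof (rule measure_eqI)
  have le: "Suc t \<le> Suc n" using tn by simp
  note truncate_pair_measurable[OF le, measurable]
  note sets_joint_law[measurable_cong]
  show "sets (distr (joint_law M x K n) (hist_pair (Suc t)) (truncate_pair (Suc t))) = sets (joint_law M x K t)"
    by (simp add: sets_joint_law)
  fix X assume "X \<in> sets (distr (joint_law M x K n) (hist_pair (Suc t)) (truncate_pair (Suc t)))"
  then have X[measurable]: "X \<in> sets (hist_pair (Suc t))" by simp
  have tr: "truncate_pair (Suc t) \<in> joint_law M x K n \<rightarrow>\<^sub>M hist_pair (Suc t)" by measurable
  have "emeasure (distr (joint_law M x K n) (hist_pair (Suc t)) (truncate_pair (Suc t))) X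
     = (\<integral>\<^sup>+p. indicator X (truncate_pair (Suc t) p) \<partial>joint_law M x K n)"
    by (subst nn_integral_indicator[symmetric], simp, rule nn_integral_distr[OF tr]) simp
  also have "\<dots> = (\<integral>\<^sup>+\<omega>. \<integral>\<^sup>+y. indicator X (source_path (Suc t) \<omega>, y) \<partial>causal_prefix K (Suc t) (source_path (Suc t) \<omega>) \<partial>M)"
    using nn_integral_joint_law_causal[OF tn, of "\<lambda>q. indicator X (fst q)" "count_space UNIV" "\<lambda>_. undefined"] by simp
  also have "\<dots> = emeasure (joint_law M x K t) X"
    by (subst nn_integral_indicator[symmetric], simp add: sets_joint_law, rule nn_integral_joint_law[symmetric]) simp
  finally show "emeasure (distr (joint_law M x K n) (hist_pair (Suc t)) (truncate_pair (Suc t))) X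
     = emeasure (joint_law M x K t) X" .
qed

lemma distr_joint_law_fst: "distr (joint_law M x K n) (hist (Suc n)) fst = source_law M x n"
proof (rule measure_eqI)
  note sets_joint_law[measurable_cong]
  fix X assume "X \<in> sets (distr (joint_law M x K n) (hist (Suc n)) fst)"
  then have X[measurable]: "X \<in> sets (hist (Suc n))" by simp
  have "emeasure (distr (joint_law M x K n) (hist (Suc n)) fst) X = (\<integral>\<^sup>+p. indicator X (fst p) \<partial>joint_law M x K n)"
    by (subst nn_integral_indicator[symmetric], simp, rule nn_integral_distr) simp_all
  also have "\<dots> = (\<integral>\<^sup>+\<omega>. \<integral>\<^sup>+y. indicator X (source_path (Suc n) \<omega>) \<partial>causal_prefix K (Suc n) (source_path (Suc n) \<omega>) \<partial>M)"
    by (subst nn_integral_joint_law) simp_all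
  also have "\<dots> = (\<integral>\<^sup>+\<omega>. indicator X (source_path (Suc n) \<omega>) \<partial>M)"
    using causal_prefix_prob[OF K, of "Suc n"] by (simp add: space_prob_algebra prob_space.emeasure_space_1)
  also have "\<dots> = emeasure (source_law M x n) X"
    by (subst nn_integral_indicator[symmetric], simp, rule nn_integral_source_law[symmetric]) simp
  finally show "emeasure (distr (joint_law M x K n) (hist (Suc n)) fst) X = emeasure (source_law M x n) X" .
qed simp

end

end

section \<open>The Gauss--Markov source\<close>

context gauss_markov
begin

lemma w_measurable [measurable]: "w t \<in> borel_measurable M"
  using distributed_measurable[OF noise_gaussian[of t]] by simp

lemma state_measurable [measurable]: "x t \<in> borel_measurable M"
proof (induction t)
  case 0
  show ?case using distributed_measurable[OF init_gaussian] by simp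
next
  case (Suc t)
  have "(\<lambda>\<omega>. A *v x t \<omega> + w t \<omega>) \<in> borel_measurable M" using Suc by measurable
  then show ?case by (subst measurable_cong[OF step]) simp_all
qed

sublocale random_source M x
  by standard measurable

lemma distr_noise: "distr M borel (w t) = normal_law Sw"
  using distributed_distr_eq_density[OF noise_gaussian[of t]]
  by (simp add: normal_law_def cong: distr_cong)

lemma distr_init: "distr M borel (x 0) = normal_law S0"
  using distributed_distr_eq_density[OF init_gaussian]
  by (simp add: normal_law_def cong: distr_cong)

text \<open>
  The path \<open>x\<^sup>t\<close> is a function (\<open>r\<close> in the proof) of \<open>x\<^sub>0, w\<^sub>0, \<dots>, w\<^sub>t\<^sub>-\<^sub>1\<close>.  In the independent family these carry the
  indices \<open>0, \<dots>, t\<close>, and \<open>w\<^sub>t\<close> carries the index \<open>t + 1\<close>.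
\<close>

lemma indep_path_noise:
  "indep_var (hist (Suc t)) (source_path (Suc t)) (PiM {Suc t} (\<lambda>_. borel)) (\<lambda>\<omega>. \<lambda>k\<in>{Suc t}. w t \<omega>)"
proof -
  let ?X = "\<lambda>k. case k of 0 \<Rightarrow> x 0 | Suc t \<Rightarrow> w t"
  define r where "r = (\<lambda>z::nat \<Rightarrow> real^'p. rec_nat (z 0) (\<lambda>s v. A *v v + z (Suc s)))"
  have r: "r z 0 = z 0" "r z (Suc s) = A *v r z s + z (Suc s)" for z s
    by (simp_all add: r_def)
  have r_meas: "s \<le> t \<Longrightarrow> (\<lambda>z. r z s) \<in> borel_measurable (hist (Suc t))" for s
  proof (induction s)
    case (Suc s)
    then have [measurable]: "(\<lambda>z. r z s) \<in> borel_measurable (hist (Suc t))" by simp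
    have [measurable]: "(\<lambda>z. z (Suc s)) \<in> hist (Suc t) \<rightarrow>\<^sub>M (borel :: (real^'p) measure)"
      using Suc by (intro measurable_hist_component) simp
    show ?case by (simp add: r(2))
  qed (simp add: r(1) measurable_hist_component)
  have r_x: "s \<le> t \<Longrightarrow> \<omega> \<in> space M \<Longrightarrow> r (\<lambda>k\<in>{0..<Suc t}. ?X k \<omega>) s = x s \<omega>" for s \<omega>
    by (induction s) (simp_all add: r step)
  have "indep_var (PiM {0..<Suc t} (\<lambda>_. borel)) (\<lambda>\<omega>. \<lambda>k\<in>{0..<Suc t}. ?X k \<omega>)
      (PiM {Suc t} (\<lambda>_. borel)) (\<lambda>\<omega>. \<lambda>k\<in>{Suc t}. ?X k \<omega>)"
    by (rule indep_var_restrict[OF indep]) auto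
  then have "indep_var (hist (Suc t)) ((\<lambda>z. \<lambda>s\<in>{0..<Suc t}. r z s) \<circ> (\<lambda>\<omega>. \<lambda>k\<in>{0..<Suc t}. ?X k \<omega>))
      (PiM {Suc t} (\<lambda>_. borel)) ((\<lambda>z. z) \<circ> (\<lambda>\<omega>. \<lambda>k\<in>{Suc t}. ?X k \<omega>))"
    by (rule indep_var_compose) (auto intro!: measurable_restrict r_meas)
  also have "((\<lambda>z. z) \<circ> (\<lambda>\<omega>. \<lambda>k\<in>{Suc t}. ?X k \<omega>)) = (\<lambda>\<omega>. \<lambda>k\<in>{Suc t}. w t \<omega>)" by (auto simp: fun_eq_iff restrict_def)
  finally have ind: "indep_var (hist (Suc t)) ((\<lambda>z. \<lambda>s\<in>{0..<Suc t}. r z s) \<circ> (\<lambda>\<omega>. \<lambda>k\<in>{0..<Suc t}. ?X k \<omega>))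
      (PiM {Suc t} (\<lambda>_. borel)) (\<lambda>\<omega>. \<lambda>k\<in>{Suc t}. w t \<omega>)" .
  have eq: "\<omega> \<in> space M \<Longrightarrow> ((\<lambda>z. \<lambda>s\<in>{0..<Suc t}. r z s) \<circ> (\<lambda>\<omega>. \<lambda>k\<in>{0..<Suc t}. ?X k \<omega>)) \<omega> = source_path (Suc t) \<omega>" for \<omega>
    using r_x by (auto simp: source_path_def restrict_def fun_eq_iff less_Suc_eq_le)
  show ?thesis
  proof -
    let ?Z = "(\<lambda>z. \<lambda>s\<in>{0..<Suc t}. r z s) \<circ> (\<lambda>\<omega>. \<lambda>k\<in>{0..<Suc t}. ?X k \<omega>)" and ?Y = "\<lambda>\<omega>. \<lambda>k\<in>{Suc t}. w t \<omega>"
    have "distr M (hist (Suc t)) ?Z = distr M (hist (Suc t)) (source_path (Suc t))"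
      by (rule distr_cong[OF refl refl eq])
    moreover have "distr M (hist (Suc t) \<Otimes>\<^sub>M PiM {Suc t} (\<lambda>_. borel)) (\<lambda>\<omega>. (?Z \<omega>, ?Y \<omega>))
      = distr M (hist (Suc t) \<Otimes>\<^sub>M PiM {Suc t} (\<lambda>_. borel)) (\<lambda>\<omega>. (source_path (Suc t) \<omega>, ?Y \<omega>))"
      by (rule distr_cong[OF refl refl]) (simp only: eq)
    ultimately show ?thesis using ind unfolding indep_var_distribution_eq by (simp only: source_path_measurable simp_thms)
  qed
qed

lemma nn_integral_path_noise:
  assumes [measurable]: "f \<in> borel_measurable (hist (Suc t) \<Otimes>\<^sub>M borel)"
  shows "(\<integral>\<^sup>+\<omega>. f (source_path (Suc t) \<omega>, w t \<omega>) \<partial>M)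
     = (\<integral>\<^sup>+\<omega>. \<integral>\<^sup>+v. f (source_path (Suc t) \<omega>, v) \<partial>normal_law Sw \<partial>M)"
proof -
  interpret N: prob_space "normal_law Sw" by (rule prob_space_normal_law[OF Sw_pos_def])
  let ?P = "PiM {Suc t} (\<lambda>_. borel :: (real^'p) measure)" and ?Y = "\<lambda>\<omega>. \<lambda>k\<in>{Suc t}. w t \<omega>"
  have Y[measurable]: "?Y \<in> M \<rightarrow>\<^sub>M ?P" by (rule measurable_restrict) simp
  have c[measurable]: "(\<lambda>z. z (Suc t)) \<in> ?P \<rightarrow>\<^sub>M borel" by (rule measurable_component_singleton) simp
  interpret D: prob_space "distr M ?P ?Y" by (rule prob_space_distr) simp
  have "(\<integral>\<^sup>+\<omega>. f (source_path (Suc t) \<omega>, w t \<omega>) \<partial>M)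
      = (\<integral>\<^sup>+p. f (fst p, snd p (Suc t)) \<partial>distr M (hist (Suc t) \<Otimes>\<^sub>M ?P) (\<lambda>\<omega>. (source_path (Suc t) \<omega>, ?Y \<omega>)))"
    by (subst nn_integral_distr) simp_all
  also have "\<dots> = (\<integral>\<^sup>+p. f (fst p, snd p (Suc t)) \<partial>(source_law M x t \<Otimes>\<^sub>M distr M ?P ?Y))"
    using indep_path_noise[of t] unfolding indep_var_distribution_eq
    by (simp add: source_law_eq)
  also have "\<dots> = (\<integral>\<^sup>+u. \<integral>\<^sup>+z. f (u, z (Suc t)) \<partial>distr M ?P ?Y \<partial>source_law M x t)"
    by (subst D.nn_integral_fst[symmetric]) simp_all
  also have "\<dots> = (\<integral>\<^sup>+u. \<integral>\<^sup>+v. f (u, v) \<partial>normal_law Sw \<partial>source_law M x t)"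
  proof (rule nn_integral_cong)
    fix u assume "u \<in> space (source_law M x t)"
    then have [measurable]: "u \<in> space (hist (Suc t))" by (simp add: space_source_law)
    show "(\<integral>\<^sup>+z. f (u, z (Suc t)) \<partial>distr M ?P ?Y) = (\<integral>\<^sup>+v. f (u, v) \<partial>normal_law Sw)"
      unfolding distr_noise[of t, symmetric] by (simp add: nn_integral_distr)
  qed
  also have "\<dots> = (\<integral>\<^sup>+\<omega>. \<integral>\<^sup>+v. f (source_path (Suc t) \<omega>, v) \<partial>normal_law Sw \<partial>M)"
    by (rule nn_integral_source_law) measurable
  finally show ?thesis .
qed

lemma noise_integrable: "integrable M (\<lambda>\<omega>. (norm (w t \<omega>))\<^sup>2)"
  using normal_law_integrable_norm_square[OF Sw_pos_def]
  by (simp add: distr_noise[of t, symmetric] integrable_distr_eq)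

lemma integrable_norm_square_add:
  fixes f g :: "'z \<Rightarrow> 'b::euclidean_space"
  assumes [measurable]: "f \<in> borel_measurable N" "g \<in> borel_measurable N"
    and "integrable N (\<lambda>z. (norm (f z))\<^sup>2)" "integrable N (\<lambda>z. (norm (g z))\<^sup>2)"
  shows "integrable N (\<lambda>z. (norm (f z + g z))\<^sup>2)"
proof (rule Bochner_Integration.integrable_bound)
  show "integrable N (\<lambda>z. 2 * (norm (f z))\<^sup>2 + 2 * (norm (g z))\<^sup>2)" using assms by auto
  have "(norm (f z + g z))\<^sup>2 \<le> 2 * (norm (f z))\<^sup>2 + 2 * (norm (g z))\<^sup>2" for z
  proof -
    have "(norm (f z + g z))\<^sup>2 \<le> (norm (f z) + norm (g z))\<^sup>2"
      by (intro power_mono norm_triangle_ineq) simp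
    also have "\<dots> \<le> 2 * (norm (f z))\<^sup>2 + 2 * (norm (g z))\<^sup>2"
      using sum_squares_bound[of "norm (f z)" "norm (g z)"] by (simp add: power2_sum)
    finally show ?thesis .
  qed
  then show "AE z in N. norm ((norm (f z + g z))\<^sup>2) \<le> norm (2 * (norm (f z))\<^sup>2 + 2 * (norm (g z))\<^sup>2)"
    by simp
qed simp

lemma integrable_norm_square_matrix:
  fixes f :: "'z \<Rightarrow> real^'n" and B :: "real^'n^'m"
  assumes [measurable]: "f \<in> borel_measurable N" and "integrable N (\<lambda>z. (norm (f z))\<^sup>2)"
  shows "integrable N (\<lambda>z. (norm (B *v f z))\<^sup>2)"
proof (rule Bochner_Integration.integrable_bound)
  show "integrable N (\<lambda>z. (onorm ((*v) B))\<^sup>2 * (norm (f z))\<^sup>2)" using assms by auto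
  have "(norm (B *v f z))\<^sup>2 \<le> (onorm ((*v) B))\<^sup>2 * (norm (f z))\<^sup>2" for z
    unfolding power_mult_distrib[symmetric]
    by (intro power_mono onorm) (simp_all add: linear_conv_bounded_linear[symmetric])
  then show "AE z in N. norm ((norm (B *v f z))\<^sup>2) \<le> norm ((onorm ((*v) B))\<^sup>2 * (norm (f z))\<^sup>2)"
    by simp
qed simp

lemma state_integrable: "integrable M (\<lambda>\<omega>. (norm (x t \<omega>))\<^sup>2)"
proof (induction t)
  case 0
  show ?case
    using normal_law_integrable_norm_square[OF S0_pos_def]
    by (simp add: distr_init[symmetric] integrable_distr_eq)
next
  case (Suc t)
  have "integrable M (\<lambda>\<omega>. (norm (A *v x t \<omega> + w t \<omega>))\<^sup>2)"
    by (intro integrable_norm_square_add integrable_norm_square_matrix Suc noise_integrable) measurable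
  then show ?case by (simp add: step cong: Bochner_Integration.integrable_cong)
qed

text \<open>
  The one consequence of causality on which the lower bound rests: \<open>w\<^sub>t\<close> is independent of \<open>(x\<^sup>t, y\<^sup>t)\<close>, because
  \<open>y\<^sup>t\<close> is generated from \<open>x\<^sup>t\<close> by randomness that does not depend on the source.
\<close>

theorem distr_joint_law_noise:
  assumes K: "K \<in> causal_kernels" and tn: "t < n"
  shows "distr (joint_law M x K n) ((hist_pair (Suc t)) \<Otimes>\<^sub>M borel)
      (\<lambda>p. (truncate_pair (Suc t) p, fst p (Suc t) - A *v fst p t))
    = joint_law M x K t \<Otimes>\<^sub>M normal_law Sw" (is "distr ?J ?S ?T = ?R")
proof (rule measure_eqI)
  interpret N: prob_space "normal_law Sw" by (rule prob_space_normal_law[OF Sw_pos_def])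
  have le: "Suc t \<le> Suc n" and le': "t \<le> n" using tn by simp_all
  note truncate_pair_measurable[OF le, measurable]
  note sets_joint_law[OF K, measurable_cong]
  have [measurable]: "(\<lambda>u. u (Suc t)) \<in> hist (Suc n) \<rightarrow>\<^sub>M (borel :: (real^'p) measure)"
      "(\<lambda>u. u t) \<in> hist (Suc n) \<rightarrow>\<^sub>M (borel :: (real^'p) measure)"
    using tn by (auto intro!: measurable_hist_component)
  have g: "(\<lambda>u. u (Suc t) - A *v u t) \<in> borel_measurable (hist (Suc n))" by measurable
  have T: "?T \<in> ?J \<rightarrow>\<^sub>M ?S" by measurable
  have cp: "causal_prefix K (Suc t) \<in> hist (Suc t) \<rightarrow>\<^sub>M subprob_algebra (hist (Suc t))"
    by (rule measurable_prob_algebraD[OF causal_prefix_measurable[OF K order.refl]])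
  note cp[measurable] and sets_causal_prefix[OF K, measurable_cong]
  show sets: "sets (distr ?J ?S ?T) = sets ?R"
    by (simp add: sets_joint_law[OF K] cong: sets_pair_measure_cong)
  fix X assume "X \<in> sets (distr ?J ?S ?T)"
  then have X[measurable]: "X \<in> sets ?S" by simp
  have "emeasure (distr ?J ?S ?T) X = (\<integral>\<^sup>+p. indicator X (?T p) \<partial>?J)"
    by (subst nn_integral_indicator[symmetric], simp, rule nn_integral_distr[OF T]) simp
  also have "\<dots> = (\<integral>\<^sup>+\<omega>. \<integral>\<^sup>+y. indicator X ((source_path (Suc t) \<omega>, y),
      source_path (Suc n) \<omega> (Suc t) - A *v source_path (Suc n) \<omega> t) \<partial>causal_prefix K (Suc t) (source_path (Suc t) \<omega>) \<partial>M)"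
    by (rule nn_integral_joint_law_causal[OF K le' _ g, of "indicator X"]) simp
  also have "\<dots> = (\<integral>\<^sup>+\<omega>. \<integral>\<^sup>+y. indicator X ((source_path (Suc t) \<omega>, y), w t \<omega>) \<partial>causal_prefix K (Suc t) (source_path (Suc t) \<omega>) \<partial>M)"
    using tn by (intro nn_integral_cong) (simp add: source_path_nth step)
  also have "\<dots> = (\<integral>\<^sup>+\<omega>. \<integral>\<^sup>+v. \<integral>\<^sup>+y. indicator X ((source_path (Suc t) \<omega>, y), v) \<partial>causal_prefix K (Suc t) (source_path (Suc t) \<omega>) \<partial>normal_law Sw \<partial>M)"
  proof -
    have "(\<lambda>p. \<integral>\<^sup>+y. indicator X ((fst p, y), snd p) \<partial>causal_prefix K (Suc t) (fst p))
       \<in> borel_measurable (hist (Suc t) \<Otimes>\<^sub>M borel)"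
      by (rule nn_integral_measurable_subprob_algebra2[where N="hist (Suc t)"]) measurable
    from nn_integral_path_noise[OF this] show ?thesis by simp
  qed
  also have "\<dots> = (\<integral>\<^sup>+\<omega>. \<integral>\<^sup>+y. \<integral>\<^sup>+v. indicator X ((source_path (Suc t) \<omega>, y), v) \<partial>normal_law Sw \<partial>causal_prefix K (Suc t) (source_path (Suc t) \<omega>) \<partial>M)"
  proof (rule nn_integral_cong)
    fix \<omega> assume "\<omega> \<in> space M"
    then have [measurable]: "source_path (Suc t) \<omega> \<in> space (hist (Suc t))"
      using measurable_space[OF source_path_measurable] by blast
    interpret C: prob_space "causal_prefix K (Suc t) (source_path (Suc t) \<omega>)"
      using causal_prefix_prob[OF K] by (simp add: space_prob_algebra)
    interpret pair_sigma_finite "causal_prefix K (Suc t) (source_path (Suc t) \<omega>)" "normal_law Sw" ..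
    show "(\<integral>\<^sup>+v. \<integral>\<^sup>+y. indicator X ((source_path (Suc t) \<omega>, y), v) \<partial>causal_prefix K (Suc t) (source_path (Suc t) \<omega>) \<partial>normal_law Sw)
        = (\<integral>\<^sup>+y. \<integral>\<^sup>+v. indicator X ((source_path (Suc t) \<omega>, y), v) \<partial>normal_law Sw \<partial>causal_prefix K (Suc t) (source_path (Suc t) \<omega>))"
      by (rule Fubini') measurable
  qed
  also have "\<dots> = (\<integral>\<^sup>+q. \<integral>\<^sup>+v. indicator X (q, v) \<partial>normal_law Sw \<partial>joint_law M x K t)"
    by (rule nn_integral_joint_law[OF K, symmetric]) measurable
  also have "\<dots> = emeasure ?R X"
    by (rule N.emeasure_pair_measure[symmetric]) (use X sets in simp)
  finally show "emeasure (distr ?J ?S ?T) X = emeasure ?R X" .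
qed

end

section \<open>The semidefinite program and its optimality certificate\<close>

text \<open>
  Rank-one matrices are the test points that read off a matrix from a linear functional, by \<open>inner_outer\<close>.
\<close>

definition outer :: "real^'n \<Rightarrow> real^'n^'n" where
  "outer v = (\<chi> i j. v $ i * v $ j)"

lemma inner_outer: "M \<bullet> outer v = quad M v"
  by (simp add: outer_def inner_vec_def matrix_vector_mult_def sum_distrib_left algebra_simps)

lemma outer_quadratic: "quad (outer v) u = (v \<bullet> u)\<^sup>2"
  by (simp add: outer_def inner_vec_def matrix_vector_mult_def sum_distrib_left sum_product power2_eq_square algebra_simps)

lemma transpose_outer [simp]: "transpose (outer v) = outer v"
  by (simp add: outer_def transpose_def vec_eq_iff mult.commute)

lemma trace_outer: "trace (outer v) = (norm v)\<^sup>2"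
  by (simp only: power2_norm_eq_inner) (simp add: outer_def trace_def inner_vec_def)

lemma trace_scaleR: "trace (c *\<^sub>R (M::real^'n^'n)) = c * trace M"
  by (simp add: trace_def sum_distrib_left)

lemma trace_mult_symmetric: "transpose S = S \<Longrightarrow> trace (V ** S) = V \<bullet> (S::real^'n^'n)"
  by (simp add: trace_def matrix_matrix_mult_def inner_vec_def transpose_def vec_eq_iff)

lemma scaleR_quadratic: "v \<bullet> ((c *\<^sub>R M) *v u) = c * (v \<bullet> (M *v (u::real^'n)))"
  by (simp add: scaleR_matrix_vector_assoc[symmetric])

lemma quadratic_le_norm: "quad M v \<le> onorm ((*v) M) * (norm (v::real^'n))\<^sup>2"
proof -
  have "quad M v \<le> norm v * norm (M *v v)" by (rule norm_cauchy_schwarz)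
  also have "\<dots> \<le> norm v * (onorm ((*v) M) * norm v)"
    by (intro mult_left_mono onorm) (simp_all add: linear_conv_bounded_linear[symmetric])
  finally show ?thesis by (simp add: power2_eq_square algebra_simps)
qed

lemma outer_columns:
  fixes C :: "real^'n^'n"
  shows "C ** transpose C = (\<Sum>k\<in>UNIV. outer (column k C))"
  by (simp add: vec_eq_iff outer_def matrix_matrix_mult_def transpose_def column_def)

definition join :: "real^'n \<Rightarrow> real^'m \<Rightarrow> real^('n + 'm)" where
  "join e v = (\<chi> i. case i of Inl r \<Rightarrow> e $ r | Inr r \<Rightarrow> v $ r)"

lemma sum_UNIV_Plus: "(\<Sum>i\<in>UNIV. f i) = (\<Sum>i\<in>(UNIV::'a::finite set). f (Inl i)) + (\<Sum>i\<in>(UNIV::'b::finite set). f (Inr i))"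
  unfolding UNIV_Plus_UNIV[symmetric] by (subst sum.Plus) simp_all

lemma inner_join: "join e v \<bullet> join e' v' = e \<bullet> e' + v \<bullet> v'"
  by (simp add: inner_vec_def sum_UNIV_Plus join_def)

lemma join_surj: "\<exists>e v. z = join e v"
  by (rule exI[of _ "\<chi> i. z $ Inl i"], rule exI[of _ "\<chi> i. z $ Inr i"])
     (simp add: vec_eq_iff join_def split: sum.split)

lemma block_matrix_mult_join:
  "block_matrix S11 S12 S21 S22 *v join e v = join (S11 *v e + S12 *v v) (S21 *v e + S22 *v v)"
  by (simp add: vec_eq_iff join_def block_matrix_def matrix_vector_mult_def sum_UNIV_Plus split: sum.split)

lemma transpose_block_matrix:
  "transpose (block_matrix S11 S12 S21 S22) = block_matrix (transpose S11) (transpose S21) (transpose S12) (transpose S22)"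
  by (simp add: vec_eq_iff block_matrix_def transpose_def split: sum.split)

text \<open>
  The vector \<open>e\<close> is the \<open>(\<mu>, \<Theta>)\<close>-weighted average of \<open>u\<close> and \<open>v\<close>, that is
  \<open>(\<mu> + \<Theta>) e = \<mu> u + \<Theta> v\<close>, and the inequality is convexity of the two forms.  It will be applied to the
  reconstruction error \<open>u = x\<^sub>t - y\<^sub>t\<close> and the prediction error \<open>v\<close> of a filter.  It holds pointwise, whatever
  the joint law of the two errors, and therefore for every reconstruction.
\<close>

lemma fusion_gain_exists:
  fixes \<Theta> :: "real^'n^'n"
  assumes "0 \<le> \<mu>" and \<Theta>: "pos_semidef \<Theta>"
  obtains G :: "real^'n^'n" where "\<And>u v. let e = v + G *v (u - v) in
     \<mu> * (norm e)\<^sup>2 + quad \<Theta> e \<le> \<mu> * (norm u)\<^sup>2 + quad \<Theta> v"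
proof (cases "\<mu> = 0")
  case True
  then show ?thesis using that[of 0] by simp
next
  case False
  then have \<mu>: "0 < \<mu>" using assms by simp
  have \<Theta>s: "transpose \<Theta> = \<Theta>" and \<Theta>0: "\<And>v. 0 \<le> quad \<Theta> v" using \<Theta> by (simp_all add: pos_semidef_def)
  define H where "H = \<mu> *\<^sub>R mat 1 + \<Theta>"
  have Hv: "H *v v = \<mu> *\<^sub>R v + \<Theta> *v v" for v
    by (simp add: H_def matrix_vector_mult_add_rdistrib scaleR_matrix_vector_assoc[symmetric])
  have "transpose H = H" by (simp add: H_def transpose_add \<Theta>s transpose_scalar)
  then have "pos_def H"
    using \<mu> \<Theta>0 by (auto simp: pos_def_def Hv inner_right_distrib add_pos_nonneg)
  note Hi = pos_def_matrix_inv(1)[OF this]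
  have "let e = v + (\<mu> *\<^sub>R matrix_inv H) *v (u - v) in
     \<mu> * (norm e)\<^sup>2 + quad \<Theta> e \<le> \<mu> * (norm u)\<^sup>2 + quad \<Theta> v" for u v
  proof -
    define e where "e = v + (\<mu> *\<^sub>R matrix_inv H) *v (u - v)"
    have "H *v e = H *v v + \<mu> *\<^sub>R (u - v)"
      by (simp add: e_def matrix_vector_right_distrib scaleR_matrix_vector_assoc[symmetric]
          matrix_vector_mult_scaleR matrix_vector_mul_assoc Hi)
    then have "\<mu> *\<^sub>R e + \<Theta> *v e = \<mu> *\<^sub>R u + \<Theta> *v v" by (simp add: Hv algebra_simps)
    then have "e \<bullet> (\<mu> *\<^sub>R e + \<Theta> *v e) = e \<bullet> (\<mu> *\<^sub>R u + \<Theta> *v v)" by simp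
    then have 1: "\<mu> * (norm e)\<^sup>2 + quad \<Theta> e = \<mu> * (e \<bullet> u) + e \<bullet> (\<Theta> *v v)"
      by (simp add: inner_right_distrib power2_norm_eq_inner)
    have "0 \<le> (norm (e - u))\<^sup>2" by simp
    then have "2 * (e \<bullet> u) \<le> (norm e)\<^sup>2 + (norm u)\<^sup>2"
      by (simp add: power2_norm_eq_inner inner_diff_left inner_diff_right inner_commute)
    then have 2: "\<mu> * (2 * (e \<bullet> u)) \<le> \<mu> * ((norm e)\<^sup>2 + (norm u)\<^sup>2)"
      using \<mu> by (intro mult_left_mono) auto
    have 3: "2 * (e \<bullet> (\<Theta> *v v)) \<le> quad \<Theta> e + quad \<Theta> v"
      using \<Theta>0[of "e - v"] inner_symmetric_matrix[OF \<Theta>s, of v e]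
      by (simp add: matrix_vector_mult_diff_distrib inner_diff_left inner_diff_right)
    show ?thesis unfolding Let_def e_def[symmetric] using 1 2 3 by (simp add: algebra_simps)
  qed
  then show ?thesis by (rule that)
qed

text \<open>
  Test the form on \<open>e\<^sub>i + e\<^sub>j\<close> and \<open>e\<^sub>i - e\<^sub>j\<close>.
\<close>

lemma pos_semidef_entry_bound:
  fixes P :: "real^'n^'n"
  assumes P: "pos_semidef P"
  shows "\<bar>P $ i $ j\<bar> \<le> trace P"
proof -
  have entry: "axis k 1 \<bullet> (P *v axis l 1) = P $ k $ l" for k l
    by (simp add: inner_axis' matrix_vector_mult_basis column_def)
  have sym: "P $ j $ i = P $ i $ j" using P by (simp add: pos_semidef_def transpose_def vec_eq_iff)
  have d: "0 \<le> P $ k $ k" for k using P entry[of k k] by (metis pos_semidef_def)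
  have "0 \<le> quad P (axis i 1 + axis j 1)"
    "0 \<le> quad P (axis i 1 - axis j 1)"
    using P by (simp_all add: pos_semidef_def)
  then have b: "2 * \<bar>P $ i $ j\<bar> \<le> P $ i $ i + P $ j $ j"
    by (simp add: matrix_vector_right_distrib matrix_vector_mult_diff_distrib inner_left_distrib inner_right_distrib
        inner_diff_left inner_diff_right entry sym)
  have t: "P $ k $ k \<le> trace P" for k
    unfolding trace_def by (rule member_le_sum) (use d in auto)
  show ?thesis using b t[of i] t[of j] by linarith
qed

lemma pos_semidef_norm_bound:
  fixes P :: "real^'n^'n"
  assumes P: "pos_semidef P"
  shows "norm P \<le> real CARD('n) * (real CARD('n) * trace P)"
proof -
  have "norm P \<le> (\<Sum>i\<in>UNIV. norm (P $ i))" by (simp add: norm_vec_def L2_set_le_sum)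
  also have "\<dots> \<le> (\<Sum>i\<in>(UNIV::'n set). \<Sum>j\<in>(UNIV::'n set). trace P)"
    by (intro sum_mono order_trans[OF norm_le_l1_cart] sum_mono pos_semidef_entry_bound[OF P])
  finally show ?thesis by simp
qed

lemma continuous_on_quadratic:
  fixes f :: "'a::topological_space \<Rightarrow> real^'n^'n"
  shows "continuous_on S f \<Longrightarrow> continuous_on S (\<lambda>p. v \<bullet> (f p *v u))"
  unfolding inner_vec_def matrix_vector_mult_def by (simp, intro continuous_intros) auto

lemma continuous_on_det:
  fixes f :: "'a::topological_space \<Rightarrow> real^'n^'n"
  shows "continuous_on S f \<Longrightarrow> continuous_on S (\<lambda>p. det (f p))"
  unfolding det_def by (intro continuous_intros) auto

lemma continuous_on_trace:
  fixes f :: "'a::topological_space \<Rightarrow> real^'n^'n"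
  shows "continuous_on S f \<Longrightarrow> continuous_on S (\<lambda>p. trace (f p))"
  unfolding trace_def by (intro continuous_intros) auto

text \<open>
  A vector on which a semidefinite form vanishes lies in the kernel, by the first variation.
\<close>

lemma pos_semidef_det_pos_imp_pos_def:
  fixes S :: "real^'n^'n"
  assumes S: "pos_semidef S" and det: "det S \<noteq> 0"
  shows "pos_def S"
proof -
  have St: "transpose S = S" and S0: "\<And>v. 0 \<le> quad S v" using S by (auto simp: pos_semidef_def)
  have "0 < quad S v" if v: "v \<noteq> 0" for v
  proof (rule ccontr)
    assume "\<not> 0 < quad S v"
    with S0[of v] have z: "quad S v = 0" by simp
    have "u \<bullet> (S *v v) = 0" for u
    proof -
      have "- (u \<bullet> (S *v v)) = 0"
      proof (rule linear_coeff_zero[where b="- quad S u"])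
        fix t
        have "0 \<le> quad S (v + t *\<^sub>R u)" by (rule S0)
        then show "2 * t * - (u \<bullet> (S *v v)) + t\<^sup>2 * - quad S u \<le> 0"
          using z inner_symmetric_matrix[OF St, of v u]
          by (simp add: matrix_vector_right_distrib matrix_vector_mult_scaleR inner_left_distrib inner_right_distrib
              power2_eq_square algebra_simps)
      qed
      then show ?thesis by simp
    qed
    then have "S *v v = 0" by (metis inner_eq_zero_iff)
    moreover have "invertible S" using det by (simp add: invertible_det_nz)
    ultimately have "v = 0" using injD[OF inj_matrix_vector_mult[of S], of v 0] by simp
    then show False using v by simp
  qed
  then show ?thesis using St by (simp add: pos_def_def)
qed

text \<open>
  With \<open>B = A\<^sup>T\<close>, this is the quadratic form of the block matrix of the semidefinite program at the vector \<open>(e, v)\<close>,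
  and \<open>gap_form\<close> below is the form of \<open>A P A\<^sup>T + W - P\<close>.  In this shape both constraints are visibly affine in \<open>(P, Q)\<close>.
\<close>

definition schur_form :: "real^'n^'n \<Rightarrow> real^'n^'n \<Rightarrow> real^'n^'n \<Rightarrow> real^'n^'n \<Rightarrow> real^'n \<Rightarrow> real^'n \<Rightarrow> real" where
  "schur_form B W P Q e v = quad P (e + B *v v) + quad W v - quad Q e"

definition gap_form :: "real^'n^'n \<Rightarrow> real^'n^'n \<Rightarrow> real^'n^'n \<Rightarrow> real^'n \<Rightarrow> real" where
  "gap_form B W P v = quad P (B *v v) + quad W v - quad P v"

text \<open>
  Definiteness of \<open>P\<close> and \<open>Q\<close> is left out: the set is then closed and described by affine inequalities only, as
  compactness and separation require.  Definiteness of an optimal pair is recovered from \<open>det Q > 0\<close>.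
\<close>

definition relaxed_feasible :: "real^'n^'n \<Rightarrow> real^'n^'n \<Rightarrow> real \<Rightarrow> real^'n^'n \<Rightarrow> real^'n^'n \<Rightarrow> bool" where
  "relaxed_feasible B W D P Q \<longleftrightarrow> transpose P = P \<and> transpose Q = Q \<and>
     (\<forall>e v. 0 \<le> schur_form B W P Q e v) \<and> (\<forall>v. 0 \<le> gap_form B W P v) \<and> trace P \<le> D"

lemma pos_semidef_block_iff:
  fixes A W P Q :: "real^'n^'n"
  assumes W: "transpose W = W" and P: "transpose P = P" and Q: "transpose Q = Q"
  shows "pos_semidef (block_matrix (P - Q) (P ** transpose A) (A ** P) (A ** P ** transpose A + W))
     \<longleftrightarrow> (\<forall>e v. 0 \<le> schur_form (transpose A) W P Q e v)"
proof -
  let ?S = "block_matrix (P - Q) (P ** transpose A) (A ** P) (A ** P ** transpose A + W)"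
  have t: "transpose ?S = ?S"
    by (simp add: transpose_block_matrix transpose_diff transpose_add matrix_transpose_mul W P Q matrix_mul_assoc)
  have c: "v \<bullet> (A *v u) = (transpose A *v v) \<bullet> u" for u v by (rule inner_matrix_transpose)
  have "quad ?S (join e v) = schur_form (transpose A) W P Q e v" for e v
  proof -
    have s: "e \<bullet> (P *v (transpose A *v v)) = (transpose A *v v) \<bullet> (P *v e)"
      by (rule inner_symmetric_matrix[OF P])
    show ?thesis
      by (simp only: block_matrix_mult_join inner_join matrix_vector_mult_add_rdistrib matrix_vector_mult_diff_rdistrib
          inner_right_distrib inner_diff_right matrix_vector_mul_assoc[symmetric] c schur_form_def
          matrix_vector_right_distrib inner_left_distrib s)
  qed
  then have "(\<forall>z. 0 \<le> quad ?S z) \<longleftrightarrow> (\<forall>e v. 0 \<le> schur_form (transpose A) W P Q e v)"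
    by (metis join_surj[of "z::real^('n+'n)" for z])
  then show ?thesis using t by (simp add: pos_semidef_def)
qed

lemma sdp_feasible_iff:
  assumes W: "pos_def W"
  shows "sdp_feasible A W D (P, Q) \<longleftrightarrow> pos_def P \<and> pos_def Q \<and> relaxed_feasible (transpose A) W D P Q"
proof -
  have Wt: "transpose W = W" using W by (simp add: pos_def_def)
  show ?thesis
  proof (cases "transpose P = P \<and> transpose Q = Q")
    case True
    have "P \<preceq>\<^sub>L A ** P ** transpose A + W \<longleftrightarrow> (\<forall>v. 0 \<le> gap_form (transpose A) W P v)"
      using True Wt unfolding loewner_le_def pos_semidef_def gap_form_def
      by (simp add: matrix_vector_mult_diff_rdistrib matrix_vector_mult_add_rdistrib inner_diff_right inner_right_distrib
          congruence_quadratic transpose_diff transpose_add matrix_transpose_mul matrix_mul_assoc del: transpose_matrix_vector)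
    then show ?thesis
      using True pos_semidef_block_iff[OF Wt, of P Q A] by (auto simp: sdp_feasible_def relaxed_feasible_def)
  next
    case False
    then show ?thesis by (auto simp: sdp_feasible_def relaxed_feasible_def pos_def_def)
  qed
qed

context
  fixes B W :: "real^'n^'n" and D :: real
  assumes W: "pos_def W" and D: "0 < D"
begin

text \<open>
  Slater's condition.  Small multiples of the identity work, \<open>Q\<close> being small against \<open>P\<close>, and \<open>P\<close> against \<open>W\<close>
  and \<open>D\<close>.
\<close>

lemma strictly_feasible_point:
  obtains P Q :: "real^'n^'n" and \<sigma> where "0 < \<sigma>" "pos_def P" "pos_def Q"
    "\<And>e v. \<sigma> * ((norm e)\<^sup>2 + (norm v)\<^sup>2) \<le> schur_form B W P Q e v"
    "\<And>v. \<sigma> * (norm v)\<^sup>2 \<le> gap_form B W P v" "trace P + \<sigma> \<le> D"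
proof -
  obtain \<omega> where \<omega>: "0 < \<omega>" "\<And>v. \<omega> * (norm v)\<^sup>2 \<le> quad W v"
    using pos_def_coercive[OF W] by blast
  define a where "a = (onorm ((*v) B))\<^sup>2"
  have a0: "0 \<le> a" by (simp add: a_def)
  have Ba: "(norm (B *v v))\<^sup>2 \<le> a * (norm v)\<^sup>2" for v
    unfolding a_def power_mult_distrib[symmetric]
    by (intro power_mono onorm) (simp_all add: linear_conv_bounded_linear[symmetric])
  define p where "p = real CARD('n)"
  have p: "0 < p" by (simp add: p_def)
  define \<epsilon> where "\<epsilon> = min (\<omega> / 2) (D / (2 * p))"
  have \<epsilon>: "0 < \<epsilon>" "\<epsilon> \<le> \<omega> / 2" "\<epsilon> * p \<le> D / 2"
    using \<omega> D p by (auto simp: \<epsilon>_def min_def field_simps)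
  define \<theta> where "\<theta> = min (\<epsilon> / 2) (\<omega> / (4 * (a + 1)))"
  have \<theta>: "0 < \<theta>" "2 * \<theta> \<le> \<epsilon>" "2 * \<theta> * a \<le> \<omega> / 2"
  proof -
    show "0 < \<theta>" using \<epsilon> \<omega> a0 by (simp add: \<theta>_def)
    show "2 * \<theta> \<le> \<epsilon>" by (simp add: \<theta>_def)
    have "\<theta> * a \<le> (\<omega> / (4 * (a + 1))) * (a + 1)"
      using a0 \<omega> \<epsilon> by (intro mult_mono) (auto simp: \<theta>_def)
    also have "\<dots> = \<omega> / 4" using a0 by (simp add: field_simps)
    finally show "2 * \<theta> * a \<le> \<omega> / 2" by simp
  qed
  define \<sigma> where "\<sigma> = min (min (\<theta> / 2) (\<omega> / 2)) (D / 2)"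
  have \<sigma>: "0 < \<sigma>" "\<sigma> \<le> \<theta> / 2" "\<sigma> \<le> \<omega> / 2" "\<sigma> \<le> D / 2" using \<theta> \<omega> D by (auto simp: \<sigma>_def)
  have I: "pos_def (c *\<^sub>R (mat 1 :: real^'n^'n))" if "0 < c" for c
    using that by (auto simp: pos_def_def transpose_scalar scaleR_quadratic)
  have q: "quad (c *\<^sub>R mat 1) v = c * (norm v)\<^sup>2" for c and v :: "real^'n"
    by (simp add: scaleR_quadratic power2_norm_eq_inner)
  show ?thesis
  proof (rule that[OF \<sigma>(1) I[OF \<epsilon>(1)] I[of "\<theta> / 2"]])
    show "0 < \<theta> / 2" using \<theta> by simp
    show "trace (\<epsilon> *\<^sub>R (mat 1 :: real^'n^'n)) + \<sigma> \<le> D"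
      using \<epsilon>(3) \<sigma>(4) by (simp add: trace_scaleR trace_I p_def)
    fix v :: "real^'n"
    have W': "\<omega> * (norm v)\<^sup>2 \<le> quad W v" by (rule \<omega>)
    have "\<sigma> * (norm v)\<^sup>2 + \<epsilon> * (norm v)\<^sup>2 \<le> \<omega> * (norm v)\<^sup>2"
      using \<sigma>(3) \<epsilon>(2) by (simp add: distrib_right[symmetric] mult_right_mono)
    moreover have "0 \<le> \<epsilon> * (norm (B *v v))\<^sup>2" using \<epsilon> by simp
    ultimately show "\<sigma> * (norm v)\<^sup>2 \<le> gap_form B W (\<epsilon> *\<^sub>R mat 1) v"
      unfolding gap_form_def q using W' by linarith
    fix e :: "real^'n"
    have "norm e \<le> norm (e + B *v v) + norm (B *v v)"
      using norm_triangle_ineq4[of "e + B *v v" "B *v v"] by simp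
    then have "(norm e)\<^sup>2 \<le> (norm (e + B *v v) + norm (B *v v))\<^sup>2" by (intro power_mono) simp_all
    also have "\<dots> \<le> 2 * (norm (e + B *v v))\<^sup>2 + 2 * (norm (B *v v))\<^sup>2"
      using sum_squares_bound[of "norm (e + B *v v)" "norm (B *v v)"] by (simp add: power2_sum)
    also have "\<dots> \<le> 2 * (norm (e + B *v v))\<^sup>2 + 2 * (a * (norm v)\<^sup>2)" using Ba[of v] by simp
    finally have "\<theta> * (norm e)\<^sup>2 \<le> \<theta> * (2 * (norm (e + B *v v))\<^sup>2 + 2 * (a * (norm v)\<^sup>2))"
      using \<theta>(1) by (intro mult_left_mono) auto
    also have "\<dots> = (2 * \<theta>) * (norm (e + B *v v))\<^sup>2 + (2 * \<theta> * a) * (norm v)\<^sup>2" by (simp add: algebra_simps)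
    also have "\<dots> \<le> \<epsilon> * (norm (e + B *v v))\<^sup>2 + \<omega> / 2 * (norm v)\<^sup>2"
      using \<theta>(2,3) by (intro add_mono mult_right_mono) auto
    finally have 1: "\<theta> * (norm e)\<^sup>2 \<le> \<epsilon> * (norm (e + B *v v))\<^sup>2 + \<omega> / 2 * (norm v)\<^sup>2" .
    have "\<sigma> * (norm e)\<^sup>2 \<le> \<theta> / 2 * (norm e)\<^sup>2" "\<sigma> * (norm v)\<^sup>2 \<le> \<omega> / 2 * (norm v)\<^sup>2"
      using \<sigma>(2,3) by (intro mult_right_mono; simp)+
    then show "\<sigma> * ((norm e)\<^sup>2 + (norm v)\<^sup>2) \<le> schur_form B W (\<epsilon> *\<^sub>R mat 1) ((\<theta> / 2) *\<^sub>R mat 1) e v"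
      unfolding schur_form_def q using 1 W' by (simp add: distrib_left)
  qed
qed

lemma relaxed_feasible_le:
  assumes "relaxed_feasible B W D P Q" shows "quad Q e \<le> quad P e"
proof -
  have "0 \<le> schur_form B W P Q e 0" using assms by (simp add: relaxed_feasible_def)
  then show ?thesis by (simp add: schur_form_def)
qed

text \<open>
  The trace bounds \<open>P\<close>, and \<open>Q \<preceq> P\<close> then bounds \<open>Q\<close>.  Asking \<open>det Q\<close> to be at least its value at a strictly feasible
  point makes the search set compact and keeps the maximiser definite.
\<close>

lemma optimum_exists:
  obtains P Q :: "real^'n^'n" where "pos_def P" "pos_def Q" "relaxed_feasible B W D P Q"
    "\<And>P' Q'. pos_def P' \<Longrightarrow> pos_def Q' \<Longrightarrow> relaxed_feasible B W D P' Q' \<Longrightarrow> det Q' \<le> det Q"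
proof -
  obtain P0 Q0 :: "real^'n^'n" and \<sigma> where s: "0 < \<sigma>" and P0: "pos_def P0" and Q0: "pos_def Q0" and
    s1: "\<And>e v. \<sigma> * ((norm e)\<^sup>2 + (norm v)\<^sup>2) \<le> schur_form B W P0 Q0 e v" and
    s2: "\<And>v. \<sigma> * (norm v)\<^sup>2 \<le> gap_form B W P0 v" and s3: "trace P0 + \<sigma> \<le> D"
    by (rule strictly_feasible_point) blast
  have F0: "relaxed_feasible B W D P0 Q0"
    unfolding relaxed_feasible_def
  proof (intro conjI allI)
    show "0 \<le> schur_form B W P0 Q0 e v" for e v
      using s s1[of e v] by (smt (verit) mult_nonneg_nonneg zero_le_power2)
    show "0 \<le> gap_form B W P0 v" for v
      using s s2[of v] by (smt (verit) mult_nonneg_nonneg zero_le_power2)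
  qed (use P0 Q0 s s3 in \<open>auto simp: pos_def_def\<close>)
  define \<delta> where "\<delta> = det Q0"
  have \<delta>: "0 < \<delta>" unfolding \<delta>_def by (rule pos_def_det_pos[OF Q0])
  define K where "K = {p :: (real^'n^'n) \<times> (real^'n^'n). pos_semidef (fst p) \<and> pos_semidef (snd p) \<and>
      relaxed_feasible B W D (fst p) (snd p) \<and> \<delta> \<le> det (snd p)}"
  have "K = {p. \<forall>i j. fst p $ i $ j = fst p $ j $ i} \<inter> {p. \<forall>i j. snd p $ i $ j = snd p $ j $ i} \<inter>
     {p. \<forall>v. 0 \<le> quad (fst p) v} \<inter> {p. \<forall>v. 0 \<le> quad (snd p) v} \<inter>
     {p. \<forall>e v. 0 \<le> schur_form B W (fst p) (snd p) e v} \<inter> {p. \<forall>v. 0 \<le> gap_form B W (fst p) v} \<inter>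
     {p. trace (fst p) \<le> D} \<inter> {p. \<delta> \<le> det (snd p)}"
    unfolding K_def relaxed_feasible_def pos_semidef_def by (auto simp: transpose_def vec_eq_iff)
  moreover have "closed \<dots>"
    unfolding schur_form_def gap_form_def
    by (intro closed_Int closed_Collect_all closed_Collect_eq closed_Collect_le continuous_on_diff continuous_on_add
        continuous_on_quadratic continuous_on_trace continuous_on_det continuous_on_const continuous_on_component
        continuous_on_fst continuous_on_snd continuous_on_id)
  ultimately have "closed K" by (simp only:)
  moreover have "bounded K"
  proof (rule boundedI)
    fix p assume p: "p \<in> K"
    obtain P Q where pq: "p = (P, Q)" by (cases p)
    have ps: "pos_semidef P" "pos_semidef Q" and F: "relaxed_feasible B W D P Q" using p by (auto simp: K_def pq)
    have tP: "trace P \<le> D" using F by (simp add: relaxed_feasible_def)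
    have "trace Q \<le> trace P" unfolding trace_def
    proof (rule sum_mono)
      fix i show "Q $ i $ i \<le> P $ i $ i"
        using relaxed_feasible_le[OF F, of "axis i 1"]
        by (simp add: inner_axis' matrix_vector_mult_basis column_def)
    qed
    then have tQ: "trace Q \<le> D" using tP by simp
    let ?c = "real CARD('n)"
    have "norm P \<le> ?c * (?c * D)" "norm Q \<le> ?c * (?c * D)"
      using pos_semidef_norm_bound[OF ps(1)] pos_semidef_norm_bound[OF ps(2)] tP tQ
      by (meson order_trans mult_left_mono of_nat_0_le_iff)+
    then show "norm p \<le> ?c * (?c * D) + ?c * (?c * D)"
      using norm_Pair_le[of P Q] unfolding pq by linarith
  qed
  ultimately have "compact K" by (simp add: compact_eq_bounded_closed)
  moreover have in_K: "(P, Q) \<in> K" if "pos_def P" "pos_def Q" "relaxed_feasible B W D P Q" "\<delta> \<le> det Q" for P Q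
    using that by (auto simp: K_def pos_def_imp_pos_semidef)
  then have "K \<noteq> {}" using P0 Q0 F0 by (auto simp: \<delta>_def)
  moreover have "continuous_on K (\<lambda>p. det (snd p))" by (intro continuous_on_det continuous_on_snd continuous_on_id)
  ultimately obtain p where p: "p \<in> K" "\<And>q. q \<in> K \<Longrightarrow> det (snd q) \<le> det (snd p)"
    using continuous_attains_sup by metis
  obtain P Q where pq: "p = (P, Q)" by (cases p)
  have F: "relaxed_feasible B W D P Q" and "pos_semidef Q" "pos_semidef P" "\<delta> \<le> det Q" using p(1) by (auto simp: K_def pq)
  then have Q: "pos_def Q" using \<delta> by (intro pos_semidef_det_pos_imp_pos_def) auto
  moreover have P: "pos_def P"
    unfolding pos_def_def
  proof (intro conjI allI impI)
    show "transpose P = P" using F by (simp add: relaxed_feasible_def)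
    fix v :: "real^'n" assume "v \<noteq> 0"
    then have "0 < quad Q v" using Q by (simp add: pos_def_def)
    also have "\<dots> \<le> quad P v" by (rule relaxed_feasible_le[OF F])
    finally show "0 < quad P v" .
  qed
  moreover have "det Q' \<le> det Q" if "pos_def P'" "pos_def Q'" "relaxed_feasible B W D P' Q'" for P' Q'
  proof (cases "\<delta> \<le> det Q'")
    case True
    with in_K[OF that] p(2)[of "(P', Q')"] show ?thesis by (simp add: pq)
  next
    case False then show ?thesis using \<open>\<delta> \<le> det Q\<close> by simp
  qed
  ultimately show ?thesis using that F by blast
qed

text \<open>
  The derivative of \<open>ln det\<close> at \<open>Q\<close> in the direction \<open>Q' - Q\<close> is \<open>\<langle>Q\<^sup>-\<^sup>1, Q' - Q\<rangle>\<close>.  The segment towards a relaxed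
  feasible pair stays definite near its start, so it cannot increase \<open>det\<close> there.
\<close>

lemma first_order_optimality:
  assumes P: "pos_def P" and Q: "pos_def Q" and F: "relaxed_feasible B W D P Q"
    and opt: "\<And>P' Q'. pos_def P' \<Longrightarrow> pos_def Q' \<Longrightarrow> relaxed_feasible B W D P' Q' \<Longrightarrow> det Q' \<le> det Q"
    and F': "relaxed_feasible B W D P' Q'"
  shows "matrix_inv Q \<bullet> (Q' - Q) \<le> 0"
proof -
  define V where "V = Q' - Q"
  have sym: "transpose P = P" "transpose Q = Q" "transpose P' = P'" "transpose Q' = Q'"
    using F F' by (auto simp: relaxed_feasible_def)
  have Vt: "transpose V = V" by (simp add: V_def transpose_diff sym)
  obtain C :: "real^'n^'n" and d where C: "invertible C" "Q = C ** transpose C" "V = C ** diag d ** transpose C"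
    by (rule simultaneous_factorization[OF Q Vt])
  have detQt: "det (Q + t *\<^sub>R V) = det Q * (\<Prod>i\<in>UNIV. 1 + t * d i)" for t
  proof -
    have "mat 1 + t *\<^sub>R diag d = diag (\<lambda>i. 1 + t * d i)"
      by (auto simp: vec_eq_iff mat_def diag_def)
    then have "Q + t *\<^sub>R V = C ** diag (\<lambda>i. 1 + t * d i) ** transpose C"
      by (simp only: C(2,3) \<open>_ = diag (\<lambda>i. 1 + t * d i)\<close>[symmetric] matrix_add_rdistrib' matrix_add_ldistrib
          matrix_mul_rid matrix_scalar_ac scalar_matrix_assoc)
    then show ?thesis by (simp add: det_mul det_diag C(2))
  qed
  have trV: "matrix_inv Q \<bullet> V = (\<Sum>i\<in>UNIV. d i)"
  proof -
    obtain Ci where Ci: "C ** Ci = mat 1" "Ci ** C = mat 1" using C(1) by (auto simp: invertible_def)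
    have tCi: "transpose C ** transpose Ci = mat 1" using arg_cong[OF Ci(2), of transpose] by (simp add: matrix_transpose_mul)
    have "Q ** (transpose Ci ** Ci) = C ** (transpose C ** transpose Ci) ** Ci" by (simp add: C(2) matrix_mul_assoc)
    then have inv: "matrix_inv Q = transpose Ci ** Ci" by (intro matrix_inv_eqI) (simp add: tCi Ci)
    have "matrix_inv Q \<bullet> V = trace (matrix_inv Q ** V)" by (simp add: trace_mult_symmetric Vt)
    also have "\<dots> = trace ((transpose Ci ** (Ci ** C) ** diag d) ** transpose C)"
      by (simp add: inv C(3) matrix_mul_assoc)
    also have "\<dots> = trace (transpose C ** (transpose Ci ** (Ci ** C) ** diag d))" by (rule trace_mul_sym)
    also have "\<dots> = trace ((transpose C ** transpose Ci) ** (Ci ** C) ** diag d)" by (simp add: matrix_mul_assoc)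
    finally show ?thesis by (simp add: tCi Ci trace_diag)
  qed
  have pd_small: "\<exists>r>0. \<forall>t. 0 < t \<and> t < r \<longrightarrow> pos_def (S + t *\<^sub>R (S' - S))"
    if S: "pos_def S" and S': "transpose S' = S'" for S S' :: "real^'n^'n"
  proof -
    obtain m where m: "0 < m" "\<And>v. m * (norm v)\<^sup>2 \<le> quad S v" using pos_def_coercive[OF S] by blast
    define k where "k = onorm ((*v) (S - S'))"
    have k: "quad (S - S') v \<le> k * (norm v)\<^sup>2" for v unfolding k_def by (rule quadratic_le_norm)
    have St: "transpose S = S" using S by (simp add: pos_def_def)
    have "0 \<le> k" unfolding k_def by (intro onorm_pos_le) (simp add: linear_conv_bounded_linear[symmetric])
    have "pos_def (S + t *\<^sub>R (S' - S))" if t: "0 < t" "t < m / (k + 1)" for t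
    proof -
      have "t * k < m"
      proof -
        have "t * (k + 1) < m" using t \<open>0 \<le> k\<close> by (simp add: field_simps)
        then show ?thesis using t by (simp add: distrib_left)
      qed
      have "0 < quad (S + t *\<^sub>R (S' - S)) v" if "v \<noteq> 0" for v
      proof -
        have "quad (S + t *\<^sub>R (S' - S)) v = quad S v - t * quad (S - S') v"
          by (simp add: matrix_vector_mult_add_rdistrib matrix_vector_mult_diff_rdistrib inner_right_distrib
              inner_diff_right scaleR_quadratic algebra_simps)
        also have "\<dots> \<ge> m * (norm v)\<^sup>2 - t * (k * (norm v)\<^sup>2)"
          using m(2)[of v] k[of v] t by (intro diff_mono mult_left_mono) auto
        moreover have "m * (norm v)\<^sup>2 - t * (k * (norm v)\<^sup>2) = (m - t * k) * (norm v)\<^sup>2" by (simp add: algebra_simps)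
        moreover have "0 < (m - t * k) * (norm v)\<^sup>2" using \<open>t * k < m\<close> that by simp
        ultimately show ?thesis by linarith
      qed
      then show ?thesis by (simp add: pos_def_def transpose_add transpose_scalar transpose_diff St S')
    qed
    moreover have "0 < m / (k + 1)" using m \<open>0 \<le> k\<close> by simp
    ultimately show ?thesis by blast
  qed
  obtain r1 where r1: "0 < r1" "\<And>t. 0 < t \<Longrightarrow> t < r1 \<Longrightarrow> pos_def (P + t *\<^sub>R (P' - P))"
    using pd_small[OF P sym(3)] by blast
  obtain r2 where r2: "0 < r2" "\<And>t. 0 < t \<Longrightarrow> t < r2 \<Longrightarrow> pos_def (Q + t *\<^sub>R V)"
    using pd_small[OF Q sym(4)] unfolding V_def by blast
  have conv: "relaxed_feasible B W D (P + t *\<^sub>R (P' - P)) (Q + t *\<^sub>R V)" if t: "0 < t" "t < 1" for t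
    unfolding relaxed_feasible_def
  proof (intro conjI allI)
    have "schur_form B W (P + t *\<^sub>R (P' - P)) (Q + t *\<^sub>R V) e v = (1 - t) * schur_form B W P Q e v + t * schur_form B W P' Q' e v" for e v
      unfolding schur_form_def V_def
      by (simp only: matrix_vector_mult_add_rdistrib matrix_vector_mult_diff_rdistrib inner_right_distrib[of _ "_ *v _" "(_ *\<^sub>R _) *v _"]
          inner_diff_right[of _ "_ *v _" "_ *v _"] scaleR_quadratic) (simp add: algebra_simps)
    then show "0 \<le> schur_form B W (P + t *\<^sub>R (P' - P)) (Q + t *\<^sub>R V) e v" for e v
      using F F' t by (simp add: relaxed_feasible_def)
    have "gap_form B W (P + t *\<^sub>R (P' - P)) v = (1 - t) * gap_form B W P v + t * gap_form B W P' v" for v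
      unfolding gap_form_def
      by (simp only: matrix_vector_mult_add_rdistrib matrix_vector_mult_diff_rdistrib inner_right_distrib[of _ "_ *v _" "(_ *\<^sub>R _) *v _"]
          inner_diff_right[of _ "_ *v _" "_ *v _"] scaleR_quadratic) (simp add: algebra_simps)
    then show "0 \<le> gap_form B W (P + t *\<^sub>R (P' - P)) v" for v
      using F F' t by (simp add: relaxed_feasible_def)
    have "trace (P + t *\<^sub>R (P' - P)) = (1 - t) * trace P + t * trace P'"
      by (simp add: trace_add trace_scaleR trace_sub algebra_simps)
    also have "\<dots> \<le> (1 - t) * D + t * D" using F F' t by (intro add_mono mult_left_mono) (auto simp: relaxed_feasible_def)
    finally show "trace (P + t *\<^sub>R (P' - P)) \<le> D" by (simp add: algebra_simps)
  qed (simp_all add: transpose_add transpose_scalar transpose_diff sym Vt)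
  have le1: "(\<Prod>i\<in>UNIV. 1 + t * d i) \<le> 1" if t: "0 < t" "t < min 1 (min r1 r2)" for t
  proof -
    have "det (Q + t *\<^sub>R V) \<le> det Q" using t by (intro opt[OF r1(2) r2(2) conv]) auto
    then have "det Q * (\<Prod>i\<in>UNIV. 1 + t * d i) \<le> det Q * 1" by (simp add: detQt)
    then show ?thesis using pos_def_det_pos[OF Q] by (simp only: mult_le_cancel_left_pos)
  qed
  have "((\<lambda>t. \<Prod>i\<in>UNIV. 1 + t * d i) has_field_derivative (\<Sum>i\<in>UNIV. d i * (\<Prod>j\<in>UNIV - {i}. 1 + 0 * d j))) (at 0)"
    by (rule has_field_derivative_prod) (auto intro!: derivative_eq_intros)
  then have der: "DERIV (\<lambda>t. \<Prod>i\<in>UNIV. 1 + t * d i) 0 :> (\<Sum>i\<in>UNIV. d i)" by simp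
  have "(\<Sum>i\<in>UNIV. d i) \<le> 0"
  proof (rule ccontr)
    assume "\<not> (\<Sum>i\<in>UNIV. d i) \<le> 0"
    then obtain r where r: "0 < r" "\<And>h. 0 < h \<Longrightarrow> h < r \<Longrightarrow> 1 < (\<Prod>i\<in>UNIV. 1 + h * d i)"
      using DERIV_pos_inc_right[OF der] by auto
    define h where "h = min r (min 1 (min r1 r2)) / 2"
    have "0 < h" "h < r" "h < min 1 (min r1 r2)" using r(1) r1(1) r2(1) by (auto simp: h_def)
    then show False using r(2)[of h] le1[of h] by simp
  qed
  then show ?thesis using trV by (simp add: V_def)
qed

lemma affine_bounded_imp_zero:
  fixes a c :: real
  assumes "\<And>s. s * a + c \<le> 0" shows "a = 0"
  using assms[of "(1 - c) / a"] by (cases "a = 0") auto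

lemma affine_bounded_imp_nonneg:
  fixes a c :: real
  assumes "\<And>k. 0 \<le> k \<Longrightarrow> c - k * a \<le> 0" shows "0 \<le> a"
proof (rule ccontr)
  assume a: "\<not> 0 \<le> a"
  then have "0 \<le> (\<bar>c\<bar> + 1) / (- a)" by (intro divide_nonneg_pos) auto
  from assms[OF this] a have "c + (\<bar>c\<bar> + 1) \<le> 0" by simp
  then show False by linarith
qed

text \<open>
  Lagrange multipliers.  The convex set \<open>S\<close> collects the constraint slacks \<open>(Y, Z, \<tau>)\<close>, together with a value \<open>r\<close>
  of the linearised objective, that some pair \<open>(P', Q')\<close> can afford; first-order optimality says that zero slack never
  comes with \<open>r > 0\<close>.  Separate \<open>S\<close> from that ray; strict feasibility shows that the multiplier \<open>\<rho>\<close> of the objective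
  is positive, so it can be normalised to \<open>1\<close>.
\<close>

lemma separating_multipliers:
  assumes Q: "pos_def Q"
    and FO: "\<And>P' Q'. relaxed_feasible B W D P' Q' \<Longrightarrow> matrix_inv Q \<bullet> (Q' - Q) \<le> 0"
  obtains \<Psi> :: "real^('n + 'n)^('n + 'n)" and \<Theta> :: "real^'n^'n" and \<mu> :: real where
    "\<And>P' Q' Y Z \<tau>. transpose P' = P' \<Longrightarrow> transpose Q' = Q' \<Longrightarrow>
       (\<And>e v. quad Y (join e v) \<le> schur_form B W P' Q' e v) \<Longrightarrow>
       (\<And>v. quad Z v \<le> gap_form B W P' v) \<Longrightarrow> \<tau> \<le> D - trace P' \<Longrightarrow>
       \<Psi> \<bullet> Y + \<Theta> \<bullet> Z + \<mu> * \<tau> + matrix_inv Q \<bullet> (Q' - Q) \<le> 0"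
proof -
  define ok where "ok = (\<lambda>(Y :: real^('n + 'n)^('n + 'n)) (Z :: real^'n^'n) \<tau> (r::real) P' Q'.
      transpose P' = P' \<and> transpose Q' = Q' \<and>
      (\<forall>e v. quad Y (join e v) \<le> schur_form B W P' Q' e v) \<and>
      (\<forall>v. quad Z v \<le> gap_form B W P' v) \<and> \<tau> \<le> D - trace P' \<and> r \<le> matrix_inv Q \<bullet> (Q' - Q))"
  define S where "S = {(Y, Z, \<tau>, r). \<exists>P' Q'. ok Y Z \<tau> r P' Q'}"
  define T where "T = {(0 :: real^('n + 'n)^('n + 'n), 0 :: real^'n^'n, 0 :: real, r :: real) | r. 0 < r}"
  have convS: "convex S"
  proof (rule convexI)
    fix x y :: "(real^('n + 'n)^('n + 'n)) \<times> (real^'n^'n) \<times> real \<times> real" and a c :: real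
    assume xy: "x \<in> S" "y \<in> S" and ac: "0 \<le> a" "0 \<le> c" "a + c = 1"
    obtain Y1 Z1 t1 r1 where x: "x = (Y1, Z1, t1, r1)" by (metis prod_cases4)
    obtain Y2 Z2 t2 r2 where y: "y = (Y2, Z2, t2, r2)" by (metis prod_cases4)
    obtain P1 Q1 where 1: "ok Y1 Z1 t1 r1 P1 Q1" using xy(1) by (auto simp: S_def x)
    obtain P2 Q2 where 2: "ok Y2 Z2 t2 r2 P2 Q2" using xy(2) by (auto simp: S_def y)
    have c: "c = 1 - a" using ac by simp
    have "ok (a *\<^sub>R Y1 + c *\<^sub>R Y2) (a *\<^sub>R Z1 + c *\<^sub>R Z2) (a * t1 + c * t2) (a * r1 + c * r2)
       (a *\<^sub>R P1 + c *\<^sub>R P2) (a *\<^sub>R Q1 + c *\<^sub>R Q2)"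
      unfolding ok_def
    proof (intro conjI allI)
      show "transpose (a *\<^sub>R P1 + c *\<^sub>R P2) = a *\<^sub>R P1 + c *\<^sub>R P2"
        "transpose (a *\<^sub>R Q1 + c *\<^sub>R Q2) = a *\<^sub>R Q1 + c *\<^sub>R Q2"
        using 1 2 by (simp_all add: ok_def transpose_add transpose_scalar)
    next
      fix e v :: "real^'n"
      have "quad (a *\<^sub>R Y1 + c *\<^sub>R Y2) (join e v) = a * quad Y1 (join e v) + c * quad Y2 (join e v)"
        by (simp only: matrix_vector_mult_add_rdistrib inner_right_distrib scaleR_quadratic)
      also have "\<dots> \<le> a * schur_form B W P1 Q1 e v + c * schur_form B W P2 Q2 e v"
        using 1 2 ac by (intro add_mono mult_left_mono) (auto simp: ok_def)
      also have "\<dots> = schur_form B W (a *\<^sub>R P1 + c *\<^sub>R P2) (a *\<^sub>R Q1 + c *\<^sub>R Q2) e v"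
        unfolding schur_form_def
        by (simp only: matrix_vector_mult_add_rdistrib inner_right_distrib[of _ "(_ *\<^sub>R _) *v _" "(_ *\<^sub>R _) *v _"] scaleR_quadratic)
           (simp add: c algebra_simps)
      finally show "quad (a *\<^sub>R Y1 + c *\<^sub>R Y2) (join e v) \<le> schur_form B W (a *\<^sub>R P1 + c *\<^sub>R P2) (a *\<^sub>R Q1 + c *\<^sub>R Q2) e v" .
    next
      fix v :: "real^'n"
      have "quad (a *\<^sub>R Z1 + c *\<^sub>R Z2) v = a * quad Z1 v + c * quad Z2 v"
        by (simp only: matrix_vector_mult_add_rdistrib inner_right_distrib scaleR_quadratic)
      also have "\<dots> \<le> a * gap_form B W P1 v + c * gap_form B W P2 v"
        using 1 2 ac by (intro add_mono mult_left_mono) (auto simp: ok_def)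
      also have "\<dots> = gap_form B W (a *\<^sub>R P1 + c *\<^sub>R P2) v"
        unfolding gap_form_def
        by (simp only: matrix_vector_mult_add_rdistrib inner_right_distrib[of _ "(_ *\<^sub>R _) *v _" "(_ *\<^sub>R _) *v _"] scaleR_quadratic)
           (simp add: c algebra_simps)
      finally show "quad (a *\<^sub>R Z1 + c *\<^sub>R Z2) v \<le> gap_form B W (a *\<^sub>R P1 + c *\<^sub>R P2) v" .
    next
      have "a * t1 + c * t2 \<le> a * (D - trace P1) + c * (D - trace P2)"
        using 1 2 ac by (intro add_mono mult_left_mono) (auto simp: ok_def)
      also have "\<dots> = D - trace (a *\<^sub>R P1 + c *\<^sub>R P2)"
        by (simp only: trace_add trace_scaleR) (simp add: c algebra_simps)
      finally show "a * t1 + c * t2 \<le> D - trace (a *\<^sub>R P1 + c *\<^sub>R P2)" .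
      have "a * r1 + c * r2 \<le> a * (matrix_inv Q \<bullet> (Q1 - Q)) + c * (matrix_inv Q \<bullet> (Q2 - Q))"
        using 1 2 ac by (intro add_mono mult_left_mono) (auto simp: ok_def)
      also have "\<dots> = matrix_inv Q \<bullet> (a *\<^sub>R Q1 + c *\<^sub>R Q2 - Q)"
        by (simp only: inner_diff_right inner_right_distrib inner_scaleR_right) (simp add: c algebra_simps)
      finally show "a * r1 + c * r2 \<le> matrix_inv Q \<bullet> (a *\<^sub>R Q1 + c *\<^sub>R Q2 - Q)" .
    qed
    then show "a *\<^sub>R x + c *\<^sub>R y \<in> S" by (auto simp: S_def x y)
  qed
  have convT: "convex T"
  proof (rule convexI)
    fix x y :: "(real^('n + 'n)^('n + 'n)) \<times> (real^'n^'n) \<times> real \<times> real" and a c :: real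
    assume xy: "x \<in> T" "y \<in> T" and ac: "0 \<le> a" "0 \<le> c" "a + c = 1"
    then obtain r1 r2 where r: "x = (0, 0, 0, r1)" "y = (0, 0, 0, r2)" "0 < r1" "0 < r2" by (auto simp: T_def)
    have "0 < a * r1 + c * r2"
    proof (cases "a = 0")
      case True then show ?thesis using ac r by simp
    next
      case False then show ?thesis using ac r by (intro add_pos_nonneg) auto
    qed
    then show "a *\<^sub>R x + c *\<^sub>R y \<in> T" by (simp add: T_def r)
  qed
  obtain P0 Q0 :: "real^'n^'n" and \<sigma> where s: "0 < \<sigma>" and P0: "pos_def P0" and Q0: "pos_def Q0" and
    s1: "\<And>e v. \<sigma> * ((norm e)\<^sup>2 + (norm v)\<^sup>2) \<le> schur_form B W P0 Q0 e v" and
    s2: "\<And>v. \<sigma> * (norm v)\<^sup>2 \<le> gap_form B W P0 v" and s3: "trace P0 + \<sigma> \<le> D"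
    by (rule strictly_feasible_point) blast
  \<comment> \<open>around zero slack there is a whole ball of affordable slacks\<close>
  have slater: "(Y, Z, \<tau>, matrix_inv Q \<bullet> (Q0 - Q)) \<in> S"
    if "\<And>z. quad Y z \<le> \<sigma> * (norm z)\<^sup>2" "\<And>v. quad Z v \<le> \<sigma> * (norm v)\<^sup>2" "\<tau> \<le> \<sigma>" for Y Z \<tau>
  proof -
    have nj: "(norm (join e v))\<^sup>2 = (norm e)\<^sup>2 + (norm v)\<^sup>2" for e v :: "real^'n"
      by (simp add: power2_norm_eq_inner inner_join)
    have "ok Y Z \<tau> (matrix_inv Q \<bullet> (Q0 - Q)) P0 Q0"
      unfolding ok_def
    proof (intro conjI allI)
      show "quad Y (join e v) \<le> schur_form B W P0 Q0 e v" for e v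
        using that(1)[of "join e v"] s1[of e v] by (simp only: nj)
      show "quad Z v \<le> gap_form B W P0 v" for v using that(2)[of v] s2[of v] by simp
    qed (use P0 Q0 that(3) s3 in \<open>auto simp: pos_def_def\<close>)
    then show ?thesis by (auto simp: S_def)
  qed
  have "S \<noteq> {}" using slater[of 0 0 0] s by auto
  moreover have "T \<noteq> {}" by (auto simp: T_def intro: exI[of _ 1])
  moreover have "S \<inter> T = {}"
  proof (rule ccontr)
    assume "S \<inter> T \<noteq> {}"
    then obtain r P' Q' where r: "0 < r" and o: "ok 0 0 0 r P' Q'" by (auto simp: S_def T_def)
    then have "relaxed_feasible B W D P' Q'" by (auto simp: ok_def relaxed_feasible_def)
    from FO[OF this] o r show False by (simp add: ok_def)
  qed
  ultimately obtain a b where ab: "a \<noteq> 0" "\<forall>x\<in>S. a \<bullet> x \<le> b" "\<forall>x\<in>T. b \<le> a \<bullet> x"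
    using separating_hyperplane_sets[OF convS convT] by blast
  obtain \<Psi> \<Theta> \<mu> \<rho> where a: "a = (\<Psi>, \<Theta>, \<mu>, \<rho>)" by (metis prod_cases4)
  have bT: "b \<le> \<rho> * r" if "0 < r" for r using ab(3) that by (auto simp: T_def a inner_prod_def)
  have b0: "b \<le> 0"
  proof (rule ccontr)
    assume b: "\<not> b \<le> 0"
    then have p: "0 < b / (2 * (\<bar>\<rho>\<bar> + 1))" by simp
    have "\<rho> * (b / (2 * (\<bar>\<rho>\<bar> + 1))) \<le> (\<bar>\<rho>\<bar> + 1) * (b / (2 * (\<bar>\<rho>\<bar> + 1)))"
      using p by (intro mult_right_mono) auto
    also have "\<dots> = b / 2" by (simp add: field_simps)
    finally have "\<rho> * (b / (2 * (\<bar>\<rho>\<bar> + 1))) \<le> b / 2" .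
    then show False using bT[OF p] b by linarith
  qed
  have \<rho>0: "0 \<le> \<rho>"
  proof (rule ccontr)
    assume "\<not> 0 \<le> \<rho>"
    then have "0 < (\<bar>b\<bar> + 1) / (- \<rho>)" by (intro divide_pos_pos) auto
    from bT[OF this] \<open>\<not> 0 \<le> \<rho>\<close> have "b \<le> - (\<bar>b\<bar> + 1)" by simp
    then show False by linarith
  qed
  have S0: "\<Psi> \<bullet> Y + \<Theta> \<bullet> Z + \<mu> * \<tau> + \<rho> * r \<le> 0" if "(Y, Z, \<tau>, r) \<in> S" for Y Z \<tau> r
  proof -
    have "a \<bullet> (Y, Z, \<tau>, r) \<le> b" using ab(2) that by blast
    then show ?thesis using b0 by (simp add: a inner_prod_def)
  qed
  have \<rho>: "0 < \<rho>"
  proof (rule ccontr)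
    assume "\<not> 0 < \<rho>"
    then have z: "\<rho> = 0" using \<rho>0 by simp
    \<comment> \<open>if \<open>\<rho> = 0\<close>, the multipliers themselves, scaled down, are affordable slacks, which forces them to vanish\<close>
    define c where "c = onorm ((*v) \<Psi>) + onorm ((*v) \<Theta>) + \<bar>\<mu>\<bar> + 1"
    have o: "0 \<le> onorm ((*v) \<Psi>)" "0 \<le> onorm ((*v) \<Theta>)"
      by (intro onorm_pos_le; simp add: linear_conv_bounded_linear[symmetric])+
    then have c: "0 < c" "onorm ((*v) \<Psi>) \<le> c" "onorm ((*v) \<Theta>) \<le> c" "\<mu> \<le> c" unfolding c_def by linarith+
    define \<eta> where "\<eta> = \<sigma> / c"
    have \<eta>: "0 < \<eta>" using s c by (simp add: \<eta>_def)
    have sc: "\<eta> * x \<le> \<sigma> * y" if "x \<le> k * y" "k \<le> c" "0 \<le> y" for x y k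
    proof -
      have "\<eta> * x \<le> \<eta> * (c * y)" using that \<eta> by (intro mult_left_mono order_trans[OF that(1)] mult_right_mono) auto
      also have "\<dots> = \<sigma> * y" using c by (simp add: \<eta>_def)
      finally show ?thesis .
    qed
    have "(\<eta> *\<^sub>R \<Psi>, \<eta> *\<^sub>R \<Theta>, \<eta> * \<mu>, matrix_inv Q \<bullet> (Q0 - Q)) \<in> S"
    proof (rule slater)
      show "quad (\<eta> *\<^sub>R \<Psi>) z \<le> \<sigma> * (norm z)\<^sup>2" for z
        unfolding scaleR_quadratic by (rule sc[OF quadratic_le_norm c(2)]) simp
      show "quad (\<eta> *\<^sub>R \<Theta>) v \<le> \<sigma> * (norm v)\<^sup>2" for v
        unfolding scaleR_quadratic by (rule sc[OF quadratic_le_norm c(3)]) simp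
      show "\<eta> * \<mu> \<le> \<sigma>" using sc[of \<mu> \<mu> 1] c by simp
    qed
    from S0[OF this] have "\<eta> * (\<Psi> \<bullet> \<Psi> + \<Theta> \<bullet> \<Theta> + \<mu> * \<mu>) \<le> 0" by (simp add: z algebra_simps)
    then have "\<Psi> \<bullet> \<Psi> + \<Theta> \<bullet> \<Theta> + \<mu> * \<mu> \<le> 0" using \<eta> by (simp add: mult_le_0_iff)
    moreover have "0 \<le> \<Psi> \<bullet> \<Psi>" "0 \<le> \<Theta> \<bullet> \<Theta>" "0 \<le> \<mu> * \<mu>" by auto
    ultimately have "\<Psi> \<bullet> \<Psi> = 0" "\<Theta> \<bullet> \<Theta> = 0" "\<mu> * \<mu> = 0" by linarith+
    then show False using ab(1) by (simp add: a z zero_prod_def)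
  qed
  show ?thesis
  proof (rule that[of "(1 / \<rho>) *\<^sub>R \<Psi>" "(1 / \<rho>) *\<^sub>R \<Theta>" "\<mu> / \<rho>"])
    fix P' Q' Y Z \<tau>
    assume *: "transpose P' = P'" "transpose Q' = Q'"
       "\<And>e v. quad Y (join e v) \<le> schur_form B W P' Q' e v"
       "\<And>v. quad Z v \<le> gap_form B W P' v" "\<tau> \<le> D - trace P'"
    have "(Y, Z, \<tau>, matrix_inv Q \<bullet> (Q' - Q)) \<in> S"
      unfolding S_def ok_def using * by auto
    from S0[OF this] have "(\<Psi> \<bullet> Y + \<Theta> \<bullet> Z + \<mu> * \<tau> + \<rho> * (matrix_inv Q \<bullet> (Q' - Q))) / \<rho> \<le> 0"
      using \<rho> by (simp add: divide_le_0_iff)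
    then show "((1 / \<rho>) *\<^sub>R \<Psi>) \<bullet> Y + ((1 / \<rho>) *\<^sub>R \<Theta>) \<bullet> Z + \<mu> / \<rho> * \<tau> + matrix_inv Q \<bullet> (Q' - Q) \<le> 0"
      using \<rho> by (simp add: add_divide_distrib)
  qed
qed

text \<open>
  Evaluating the multiplier inequality at rank-one pairs \<open>P' = s \<epsilon> \<epsilon>\<^sup>T\<close>, \<open>Q' = q e\<^sub>0 e\<^sub>0\<^sup>T\<close>, whose coefficients
  \<open>s\<close>, \<open>q\<close> range over all reals, makes the affine expressions in \<open>s\<close> and \<open>q\<close> constant: this is stationarity in \<open>P\<close>
  and in \<open>Q\<close>.  Stationarity in \<open>Q\<close> identifies the upper left block of the multiplier \<open>\<Psi>\<close> as \<open>Q\<^sup>-\<^sup>1\<close>, and completing the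
  square in the positive semidefinite \<open>\<Psi>\<close> produces the gain \<open>L\<close>.  The first inequality is what remains of
  stationarity in \<open>P\<close> after dropping the completed part, the second one is the constant term, that is the
  case \<open>s = q = 0\<close>.
\<close>

lemma optimality_certificate:
  assumes Q: "pos_def Q"
    and FO: "\<And>P' Q'. relaxed_feasible B W D P' Q' \<Longrightarrow> matrix_inv Q \<bullet> (Q' - Q) \<le> 0"
  obtains L \<Theta> :: "real^'n^'n" and \<mu> :: real where "pos_semidef \<Theta>" "0 \<le> \<mu>"
    "\<And>\<epsilon>. quad (matrix_inv Q) (\<epsilon> - L *v (transpose B *v \<epsilon>))
        + quad \<Theta> (transpose B *v \<epsilon>) \<le> quad \<Theta> \<epsilon> + \<mu> * (norm \<epsilon>)\<^sup>2"
    "(transpose L ** matrix_inv Q ** L) \<bullet> W + \<Theta> \<bullet> W + \<mu> * D \<le> real CARD('n)"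
proof -
  obtain \<Psi> :: "real^('n + 'n)^('n + 'n)" and \<Theta> :: "real^'n^'n" and \<mu> :: real where
    sep: "\<And>P' Q' Y Z \<tau>. transpose P' = P' \<Longrightarrow> transpose Q' = Q' \<Longrightarrow>
       (\<And>e v. quad Y (join e v) \<le> schur_form B W P' Q' e v) \<Longrightarrow>
       (\<And>v. quad Z v \<le> gap_form B W P' v) \<Longrightarrow> \<tau> \<le> D - trace P' \<Longrightarrow>
       \<Psi> \<bullet> Y + \<Theta> \<bullet> Z + \<mu> * \<tau> + matrix_inv Q \<bullet> (Q' - Q) \<le> 0"
    by (rule separating_multipliers[OF Q FO]) blast+
  \<comment> \<open>here \<open>f\<close> and \<open>g\<close> are the forms of the two matrix multipliers, and \<open>Wb\<close> is the block matrix \<open>diag(0, W)\<close>\<close>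
  define A where "A = transpose B"
  let ?Qi = "matrix_inv Q"
  define f where "f = (\<lambda>z. quad \<Psi> z)"
  define g where "g = (\<lambda>v. quad \<Theta> v)"
  obtain C :: "real^'n^'n" where C: "W = C ** transpose C" by (rule pos_def_factor[OF W])
  define \<omega> where "\<omega> = (\<Sum>k\<in>UNIV. f (join 0 (column k C)))"
  define Wb where "Wb = (\<Sum>k\<in>UNIV. outer (join (0::real^'n) (column k C)))"
  have sumq: "quad (\<Sum>k\<in>(UNIV::'n set). N k) z = (\<Sum>k\<in>UNIV. quad (N k) z)" for z :: "real^('n+'n)" and N
    by (simp only: inner_outer[symmetric] inner_sum_left)
  have sumq': "quad (\<Sum>k\<in>(UNIV::'n set). N k) z = (\<Sum>k\<in>UNIV. quad (N k) z)" for z :: "real^'n" and N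
    by (simp only: inner_outer[symmetric] inner_sum_left)
  have Wb_form: "quad Wb (join e v) = quad W v" for e v
    unfolding Wb_def sumq C outer_columns sumq' by (simp add: outer_quadratic inner_join)
  have Wb_inner: "\<Psi> \<bullet> Wb = \<omega>"
    by (simp add: Wb_def \<omega>_def f_def inner_sum_right inner_outer)
  have QiQ: "?Qi \<bullet> Q = real CARD('n)"
    using Q by (simp add: trace_mult_symmetric[symmetric] pos_def_def pos_def_matrix_inv[OF Q] trace_I)
  \<comment> \<open>the slack vectors \<open>z1\<close>, \<open>z2\<close> and \<open>k3\<close> probe the signs of the three multipliers\<close>
  have main: "s * (f (join \<epsilon> (A *v \<epsilon>)) + g (A *v \<epsilon>) - g \<epsilon> - \<mu> * (norm \<epsilon>)\<^sup>2) + q * (quad ?Qi e0 - f (join e0 0))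
      + (\<omega> + \<Theta> \<bullet> W + \<mu> * D - real CARD('n)) - k1 * f z1 - k2 * g z2 - k3 * \<mu> \<le> 0"
    if k: "0 \<le> k1" "0 \<le> k2" "0 \<le> k3" for s q \<epsilon> e0 k1 k2 k3 z1 z2
  proof -
    let ?Y = "s *\<^sub>R outer (join \<epsilon> (A *v \<epsilon>)) - q *\<^sub>R outer (join e0 0) + Wb - k1 *\<^sub>R outer z1"
    let ?Z = "s *\<^sub>R outer (A *v \<epsilon>) - s *\<^sub>R outer \<epsilon> + W - k2 *\<^sub>R outer z2"
    have tr: "\<epsilon> \<bullet> (B *v v) = (A *v \<epsilon>) \<bullet> v" for v by (simp only: A_def inner_matrix_transpose[of \<epsilon>])
    have "\<Psi> \<bullet> ?Y + \<Theta> \<bullet> ?Z + \<mu> * (D - s * (norm \<epsilon>)\<^sup>2 - k3) + ?Qi \<bullet> (q *\<^sub>R outer e0 - Q) \<le> 0"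
    proof (rule sep[where P'="s *\<^sub>R outer \<epsilon>"])
      fix e v
      have "quad ?Y (join e v) = s * (\<epsilon> \<bullet> e + (A *v \<epsilon>) \<bullet> v)\<^sup>2 - q * (e0 \<bullet> e)\<^sup>2 + quad W v - k1 * (z1 \<bullet> join e v)\<^sup>2"
        by (simp only: matrix_vector_mult_add_rdistrib matrix_vector_mult_diff_rdistrib inner_right_distrib
            inner_diff_right scaleR_quadratic outer_quadratic Wb_form inner_join) simp
      also have "\<dots> \<le> schur_form B W (s *\<^sub>R outer \<epsilon>) (q *\<^sub>R outer e0) e v"
        using k by (simp add: schur_form_def scaleR_quadratic outer_quadratic inner_right_distrib tr)
      finally show "quad ?Y (join e v) \<le> schur_form B W (s *\<^sub>R outer \<epsilon>) (q *\<^sub>R outer e0) e v" .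
    next
      fix v
      have "quad ?Z v = s * ((A *v \<epsilon>) \<bullet> v)\<^sup>2 - s * (\<epsilon> \<bullet> v)\<^sup>2 + quad W v - k2 * (z2 \<bullet> v)\<^sup>2"
        by (simp only: matrix_vector_mult_add_rdistrib matrix_vector_mult_diff_rdistrib inner_right_distrib
            inner_diff_right scaleR_quadratic outer_quadratic)
      also have "\<dots> \<le> gap_form B W (s *\<^sub>R outer \<epsilon>) v"
        using k by (simp add: gap_form_def scaleR_quadratic outer_quadratic tr)
      finally show "quad ?Z v \<le> gap_form B W (s *\<^sub>R outer \<epsilon>) v" .
    qed (use k in \<open>simp_all add: transpose_scalar trace_scaleR trace_outer\<close>)
    then show ?thesis
      by (simp only: inner_right_distrib inner_diff_right inner_scaleR_right inner_outer Wb_inner QiQ f_def[symmetric] g_def[symmetric])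
         (simp add: f_def g_def algebra_simps)
  qed
  \<comment> \<open>coefficients of a bounded affine function: free ones vanish, those of nonnegative parameters have a sign\<close>
  have s0: "f (join \<epsilon> (A *v \<epsilon>)) + g (A *v \<epsilon>) - g \<epsilon> - \<mu> * (norm \<epsilon>)\<^sup>2 = 0" for \<epsilon>
    by (rule affine_bounded_imp_zero[where c="\<omega> + \<Theta> \<bullet> W + \<mu> * D - real CARD('n)"])
       (use main[of 0 0 0 _ \<epsilon> 0] in simp)
  have q0: "quad ?Qi e0 = f (join e0 0)" for e0
    using affine_bounded_imp_zero[of "quad ?Qi e0 - f (join e0 0)" "\<omega> + \<Theta> \<bullet> W + \<mu> * D - real CARD('n)"]
      main[of 0 0 0 0 0 _ e0] by simp
  have f0: "0 \<le> f z" for z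
    by (rule affine_bounded_imp_nonneg[where c="\<omega> + \<Theta> \<bullet> W + \<mu> * D - real CARD('n)"])
       (use main[of _ 0 0 0 0 0 0 z] in simp)
  have g0: "0 \<le> g z" for z
    by (rule affine_bounded_imp_nonneg[where c="\<omega> + \<Theta> \<bullet> W + \<mu> * D - real CARD('n)"])
       (use main[of 0 _ 0 0 0 0 0 0 z] in simp)
  have \<mu>0: "0 \<le> \<mu>"
    by (rule affine_bounded_imp_nonneg[where c="\<omega> + \<Theta> \<bullet> W + \<mu> * D - real CARD('n)"])
       (use main[of 0 0 _ 0 0 0 0] in simp)
  have const: "\<omega> + \<Theta> \<bullet> W + \<mu> * D \<le> real CARD('n)" using main[of 0 0 0 0 0 0 0] by simp
  define \<Psi>11 \<Psi>12 \<Psi>21 \<Psi>22 :: "real^'n^'n" where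
    "\<Psi>11 = (\<chi> i j. \<Psi> $ Inl i $ Inl j)" and "\<Psi>12 = (\<chi> i j. \<Psi> $ Inl i $ Inr j)" and
    "\<Psi>21 = (\<chi> i j. \<Psi> $ Inr i $ Inl j)" and "\<Psi>22 = (\<chi> i j. \<Psi> $ Inr i $ Inr j)"
  have blk: "\<Psi> = block_matrix \<Psi>11 \<Psi>12 \<Psi>21 \<Psi>22"
    by (simp add: vec_eq_iff block_matrix_def \<Psi>11_def \<Psi>12_def \<Psi>21_def \<Psi>22_def split: sum.split)
  define N where "N = \<Psi>12 + transpose \<Psi>21"
  define h where "h = (\<lambda>v. quad \<Psi>22 v)"
  have f_join: "f (join e v) = quad ?Qi e + e \<bullet> (N *v v) + h v" for e v
  proof -
    have "v \<bullet> (\<Psi>21 *v e) = e \<bullet> (transpose \<Psi>21 *v v)" by (subst inner_matrix_transpose) (rule inner_commute)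
    then have "f (join e v) = quad \<Psi>11 e + e \<bullet> (N *v v) + h v" for e v
      by (simp only: f_def blk block_matrix_mult_join inner_join inner_right_distrib N_def matrix_vector_mult_add_rdistrib h_def)
         (subst inner_matrix_transpose, simp add: inner_commute)
    moreover from this[of e 0] have "quad \<Psi>11 e = quad ?Qi e" by (simp add: q0 h_def)
    ultimately show ?thesis by simp
  qed
  \<comment> \<open>\<open>L v\<close> minimises \<open>e \<mapsto> f (join e v)\<close>\<close>
  define L where "L = (- 1/2) *\<^sub>R (Q ** N)"
  have QiL: "?Qi *v (L *v v) = (- 1/2) *\<^sub>R (N *v v)" for v
  proof -
    have "L *v v = (- 1/2) *\<^sub>R (Q *v (N *v v))"
      by (simp only: L_def scaleR_matrix_vector_assoc[symmetric] matrix_vector_mul_assoc)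
    then show ?thesis
      by (simp only: matrix_vector_mult_scaleR matrix_vector_mul_assoc[of ?Qi Q] pos_def_matrix_inv[OF Q] matrix_vector_mul_lid)
  qed
  have schur: "quad ?Qi (e - L *v v) \<le> f (join e v)" for e v
  proof -
    have "f (join (L *v v) v) = - quad ?Qi (L *v v) + h v"
      by (simp add: f_join QiL)
    then have "quad ?Qi (L *v v) \<le> h v" using f0[of "join (L *v v) v"] by simp
    moreover have "quad ?Qi (e - L *v v) = quad ?Qi e - 2 * (e \<bullet> (?Qi *v (L *v v))) + quad ?Qi (L *v v)"
      using inner_symmetric_matrix[OF pos_def_matrix_inv(4)[OF Q], of "L *v v" e]
      by (simp only: matrix_vector_mult_diff_distrib inner_diff_left inner_diff_right)
    moreover have "e \<bullet> (?Qi *v (L *v v)) = - (e \<bullet> (N *v v)) / 2" by (simp add: QiL)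
    ultimately show ?thesis by (simp add: f_join)
  qed
  \<comment> \<open>the multiplier is determined only as a form, so it may be symmetrised\<close>
  define \<Theta>s where "\<Theta>s = (1/2) *\<^sub>R (\<Theta> + transpose \<Theta>)"
  have \<Theta>s: "quad \<Theta>s v = g v" for v
  proof -
    have "quad (transpose \<Theta>) v = quad \<Theta> v" by (subst inner_matrix_transpose) (simp only: transpose_transpose inner_commute)
    then show ?thesis
      by (simp only: \<Theta>s_def scaleR_quadratic matrix_vector_mult_add_rdistrib inner_right_distrib g_def) simp
  qed
  have inner_W: "R \<bullet> W = (\<Sum>k\<in>UNIV. quad R (column k C))" for R
    by (simp add: C outer_columns inner_sum_right inner_outer)
  show ?thesis
  proof (rule that[of \<Theta>s \<mu> L])
    show "pos_semidef \<Theta>s"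
      by (simp add: pos_semidef_def \<Theta>s g0) (simp add: \<Theta>s_def transpose_scalar transpose_add add.commute)
    show "0 \<le> \<mu>" by (rule \<mu>0)
    show "quad ?Qi (\<epsilon> - L *v (transpose B *v \<epsilon>))
        + quad \<Theta>s (transpose B *v \<epsilon>) \<le> quad \<Theta>s \<epsilon> + \<mu> * (norm \<epsilon>)\<^sup>2" for \<epsilon>
      unfolding \<Theta>s A_def[symmetric] using schur[of \<epsilon> "A *v \<epsilon>"] s0[of \<epsilon>] by linarith
    have "(transpose L ** ?Qi ** L) \<bullet> W \<le> \<omega>"
      unfolding inner_W \<omega>_def
    proof (rule sum_mono)
      fix k
      have "quad (transpose L ** ?Qi ** L) (column k C) = quad ?Qi (0 - L *v column k C)"
        using congruence_quadratic[of "column k C" "transpose L" ?Qi]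
        by (simp only: transpose_transpose) (simp add: matrix_vector_mult_diff_distrib[of _ 0, simplified])
      also have "\<dots> \<le> f (join 0 (column k C))" by (rule schur)
      finally show "quad (transpose L ** ?Qi ** L) (column k C) \<le> f (join 0 (column k C))" .
    qed
    moreover have "\<Theta>s \<bullet> W = \<Theta> \<bullet> W" unfolding inner_W by (simp only: \<Theta>s g_def)
    ultimately show "(transpose L ** ?Qi ** L) \<bullet> W + \<Theta>s \<bullet> W + \<mu> * D \<le> real CARD('n)" using const by simp
  qed
qed

end

section \<open>The lower bound\<close>

text \<open>
  The Gibbs variational bound: with \<open>r\<close> the density of \<open>J\<close>, integrate \<open>ln (h / r) \<le> h / r - 1\<close>.  Every \<open>h\<close> of
  mass at most \<open>1\<close> is a guess for the density and yields a lower bound for the divergence.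
\<close>

lemma KL_divergence_ge:
  fixes h :: "'a \<Rightarrow> real"
  assumes b: "1 < b" and prd: "prob_space N" and jnt: "prob_space J" and sets: "sets J = sets N"
    and ac: "absolutely_continuous N J" and ent: "integrable J (entropy_density b N J)"
    and h[measurable]: "h \<in> borel_measurable N" and h0: "\<And>p. 0 < h p"
    and mass: "(\<integral>\<^sup>+p. ennreal (h p) \<partial>N) \<le> 1" and lnh: "integrable J (\<lambda>p. ln (h p))"
  shows "(\<integral>p. ln (h p) \<partial>J) / ln b \<le> KL_divergence b N J"
proof -
  interpret N: prob_space N by fact
  interpret J: prob_space J by fact
  define R where "R = RN_deriv N J"
  define r where "r = (\<lambda>p. enn2real (R p))"
  have [measurable]: "R \<in> borel_measurable N" by (simp add: R_def)
  have [measurable]: "r \<in> borel_measurable N" by (simp add: r_def)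
  have [measurable_cong]: "sets J = sets N" by fact
  have J: "J = density N R" unfolding R_def by (rule N.density_RN_deriv[OF ac sets, symmetric])
  have "AE p in N. R p \<noteq> \<infinity>"
    unfolding R_def by (rule N.RN_deriv_finite[OF J.sigma_finite_measure_axioms ac sets])
  then have fin: "AE p in N. R p = ennreal (r p)" by (auto simp: r_def less_top elim!: eventually_mono)
  have "AE p in density N R. 0 < r p"
    by (subst AE_density) (use fin in \<open>auto elim!: eventually_mono\<close>)
  then have pos: "AE p in J. 0 < r p" by (simp only: J[symmetric])
  have "(\<integral>\<^sup>+p. ennreal (h p / r p) \<partial>J) = (\<integral>\<^sup>+p. R p * ennreal (h p / r p) \<partial>N)"
    by (subst J, subst nn_integral_density) simp_all
  also have "\<dots> \<le> (\<integral>\<^sup>+p. ennreal (h p) \<partial>N)"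
  proof (rule nn_integral_mono_AE)
    show "AE p in N. R p * ennreal (h p / r p) \<le> ennreal (h p)"
      using fin
    proof eventually_elim
      case (elim p)
      have "0 \<le> r p" by (simp add: r_def)
      then show ?case using h0[of p] elim by (cases "r p = 0") (auto simp: ennreal_mult[symmetric])
    qed
  qed
  finally have le1: "(\<integral>\<^sup>+p. ennreal (h p / r p) \<partial>J) \<le> 1" using mass by simp
  have nn: "0 \<le> h p / r p" for p using h0[of p] by (simp add: r_def)
  have int: "integrable J (\<lambda>p. h p / r p)"
    using le1 nn by (intro integrableI_nonneg) (auto simp: le_less_trans)
  have "ennreal (\<integral>p. h p / r p \<partial>J) = (\<integral>\<^sup>+p. ennreal (h p / r p) \<partial>J)"
    by (rule nn_integral_eq_integral[symmetric, OF int]) (simp add: nn)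
  with le1 have "(\<integral>p. h p / r p \<partial>J) \<le> 1" by (metis ennreal_le_1)
  moreover have ed: "entropy_density b N J = (\<lambda>p. ln (r p) / ln b)"
    by (simp add: entropy_density_def fun_eq_iff r_def R_def log_def)
  then have "integrable J (\<lambda>p. ln (r p) / ln b)" using ent by simp
  from integrable_mult_right[OF this, of "ln b"] have lnr: "integrable J (\<lambda>p. ln (r p))" using b by simp
  have "(\<integral>p. ln (h p) - ln (r p) \<partial>J) \<le> (\<integral>p. h p / r p - 1 \<partial>J)"
  proof (rule integral_mono_AE)
    show "AE p in J. ln (h p) - ln (r p) \<le> h p / r p - 1"
      using pos
    proof eventually_elim
      case (elim p)
      then have "ln (h p) - ln (r p) = ln (h p / r p)" using h0[of p] by (simp add: ln_div)
      also have "\<dots> \<le> h p / r p - 1" using elim h0[of p] by (intro ln_le_minus_one) simp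
      finally show ?case .
    qed
  qed (use int lnh lnr in auto)
  ultimately have "(\<integral>p. ln (h p) \<partial>J) \<le> (\<integral>p. ln (r p) \<partial>J)"
    using int lnh lnr by (simp add: J.prob_space)
  then have "(\<integral>p. ln (h p) \<partial>J) / ln b \<le> (\<integral>p. ln (r p) \<partial>J) / ln b"
    using b by (simp add: divide_right_mono)
  then show ?thesis by (simp add: KL_divergence_def ed)
qed

lemma ln_gaussian_density:
  fixes S :: "real^'n^'n"
  assumes S: "pos_def S"
  shows "ln (gaussian_density S v) = - quad (matrix_inv S) v / 2 - (real CARD('n) * ln (2 * pi) + ln (det S)) / 2"
proof -
  have d: "0 < det S" by (rule pos_def_det_pos[OF S])
  have "ln (sqrt ((2 * pi) ^ CARD('n) * det S)) = (real CARD('n) * ln (2 * pi) + ln (det S)) / 2"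
    using d by (simp add: ln_sqrt ln_mult ln_realpow distrib_left)
  then show ?thesis unfolding gaussian_density_def using d by (simp add: ln_div)
qed

lemma (in random_source) distr_joint_law_fst_function:
  assumes K: "K \<in> causal_kernels" and g[measurable]: "g \<in> hist (Suc n) \<rightarrow>\<^sub>M N"
  shows "distr (joint_law M x K n) N (\<lambda>p. g (fst p)) = distr M N (\<lambda>\<omega>. g (source_path (Suc n) \<omega>))"
proof -
  note sets_joint_law[OF K, measurable_cong]
  have "distr (joint_law M x K n) N (\<lambda>p. g (fst p)) = distr (distr (joint_law M x K n) (hist (Suc n)) fst) N g"
    by (subst distr_distr) (simp_all add: comp_def)
  also have "\<dots> = distr (distr M (hist (Suc n)) (source_path (Suc n))) N g"
    by (simp only: distr_joint_law_fst[OF K] source_law_eq)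
  also have "\<dots> = distr M N (\<lambda>\<omega>. g (source_path (Suc n) \<omega>))"
    by (subst distr_distr) (simp_all add: comp_def)
  finally show ?thesis .
qed

text \<open>
  A linear filter with the constant gain \<open>G\<close> that treats the reconstruction \<open>y\<^sub>t\<close> as a measurement of the state.  Its gain
  comes from the certificate, not from the joint law of \<open>x\<close> and \<open>y\<close>.
\<close>

primrec predict :: "real^'n^'n \<Rightarrow> real^'n^'n \<Rightarrow> (nat \<Rightarrow> real^'n) \<Rightarrow> nat \<Rightarrow> real^'n" where
  "predict A G y 0 = 0"
| "predict A G y (Suc t) = A *v (predict A G y t + G *v (y t - predict A G y t))"

definition estimate :: "real^'n^'n \<Rightarrow> real^'n^'n \<Rightarrow> (nat \<Rightarrow> real^'n) \<Rightarrow> nat \<Rightarrow> real^'n" where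
  "estimate A G y t = predict A G y t + G *v (y t - predict A G y t)"

lemma predict_Suc: "predict A G y (Suc t) = A *v estimate A G y t"
  by (simp add: estimate_def)

lemma predict_measurable: "t \<le> m \<Longrightarrow> (\<lambda>y. predict A G y t) \<in> borel_measurable (hist m)"
proof (induction t)
  case (Suc t)
  then have [measurable]: "(\<lambda>y. predict A G y t) \<in> borel_measurable (hist m)"
    "(\<lambda>y. y t) \<in> hist m \<rightarrow>\<^sub>M (borel :: (real^'a) measure)"
    by (auto intro: measurable_hist_component)
  show ?case by simp
qed simp

lemma estimate_measurable: "t < m \<Longrightarrow> (\<lambda>y. estimate A G y t) \<in> borel_measurable (hist m)"
proof -
  assume t: "t < m"
  have [measurable]: "(\<lambda>y. predict A G y t) \<in> borel_measurable (hist m)"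
    "(\<lambda>y. y t) \<in> hist m \<rightarrow>\<^sub>M (borel :: (real^'a) measure)"
    using t by (auto intro: measurable_hist_component predict_measurable)
  show ?thesis unfolding estimate_def by simp
qed

lemma predict_cong: "(\<And>i. i < t \<Longrightarrow> y i = y' i) \<Longrightarrow> predict A G y t = predict A G y' t"
  by (induction t) auto

lemma estimate_cong: "(\<And>i. i \<le> t \<Longrightarrow> y i = y' i) \<Longrightarrow> estimate A G y t = estimate A G y' t"
  using predict_cong[of t y y' A G] by (simp add: estimate_def)

text \<open>
  The deviation of \<open>u\<^sub>t\<close> from its mean in a backward model, in which \<open>u\<^sub>t\<close> given \<open>u\<^sub>t\<^sub>+\<^sub>1\<close> and \<open>y\<^sup>t\<close> is Gaussian with
  covariance \<open>Q\<close> around the filter estimate corrected by \<open>L\<close> times the prediction error of \<open>u\<^sub>t\<^sub>+\<^sub>1\<close>.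
\<close>

definition smooth_residual :: "real^'n^'n \<Rightarrow> real^'n^'n \<Rightarrow> real^'n^'n \<Rightarrow> (nat \<Rightarrow> real^'n) \<Rightarrow> (nat \<Rightarrow> real^'n) \<Rightarrow> nat \<Rightarrow> real^'n" where
  "smooth_residual A G L u y t = (u t - estimate A G y t) - L *v (u (Suc t) - A *v estimate A G y t)"

context gauss_markov
begin

text \<open>
  Backward conditional densities divided by the density of the source path.  The density of the last state in
  the backward model is left out; any probability density can be chosen for it.
\<close>

primrec backward_ratio :: "real^'p^'p \<Rightarrow> real^'p^'p \<Rightarrow> real^'p^'p \<Rightarrow> (nat \<Rightarrow> real^'p) \<Rightarrow> nat \<Rightarrow> (nat \<Rightarrow> real^'p) \<Rightarrow> real" where
  "backward_ratio Q L G y 0 u = 1 / gaussian_density S0 (u 0)"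
| "backward_ratio Q L G y (Suc t) u = backward_ratio Q L G y t u *
     (gaussian_density Q (smooth_residual A G L u y t) / gaussian_density Sw (u (Suc t) - A *v u t))"

lemma backward_ratio_pos: "pos_def Q \<Longrightarrow> 0 < backward_ratio Q L G y t u"
  by (induction t) (simp_all add: gaussian_density_pos S0_pos_def Sw_pos_def)

lemma smooth_residual_measurable [measurable]:
  assumes "Suc t < m"
  shows "(\<lambda>p. smooth_residual A G L (fst p) (snd p) t) \<in> borel_measurable (hist_pair m)"
proof -
  have [measurable]: "(\<lambda>y. estimate A G y t) \<in> borel_measurable (hist m)"
    "(\<lambda>y. y t) \<in> hist m \<rightarrow>\<^sub>M (borel :: (real^'p) measure)" "(\<lambda>y. y (Suc t)) \<in> hist m \<rightarrow>\<^sub>M (borel :: (real^'p) measure)"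
    using assms by (auto intro: measurable_hist_component estimate_measurable)
  show ?thesis unfolding smooth_residual_def by measurable
qed

lemma backward_ratio_measurable:
  "t < m \<Longrightarrow> (\<lambda>p. backward_ratio Q L G (snd p) t (fst p)) \<in> borel_measurable (hist_pair m)"
proof (induction t)
  case 0
  then have [measurable]: "(\<lambda>y. y 0) \<in> hist m \<rightarrow>\<^sub>M (borel :: (real^'p) measure)"
    by (auto intro: measurable_hist_component)
  show ?case by simp
next
  case (Suc t)
  then have [measurable]: "(\<lambda>p. backward_ratio Q L G (snd p) t (fst p)) \<in> borel_measurable (hist_pair m)"
    "(\<lambda>y. y t) \<in> hist m \<rightarrow>\<^sub>M (borel :: (real^'p) measure)" "(\<lambda>y. y (Suc t)) \<in> hist m \<rightarrow>\<^sub>M (borel :: (real^'p) measure)"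
    by (auto intro: measurable_hist_component)
  note smooth_residual_measurable[OF Suc.prems, measurable]
  show ?case by simp
qed

lemma backward_ratio_cong:
  "(\<And>i. i \<le> t \<Longrightarrow> u i = u' i) \<Longrightarrow> backward_ratio Q L G y t u = backward_ratio Q L G y t u'"
  by (induction t) (simp_all add: smooth_residual_def)

lemma backward_ratio_measurable1:
  assumes "t < m"
  shows "backward_ratio Q L G y t \<in> borel_measurable (hist m)"
proof -
  have y: "restrict y {0..<m} \<in> space (hist m)" by (simp add: space_PiM)
  have "backward_ratio Q L G (restrict y {0..<m}) s u = backward_ratio Q L G y s u" if "s < m" for s u
    using that
  proof (induction s)
    case (Suc s)
    have "estimate A G (restrict y {0..<m}) s = estimate A G y s" using Suc by (intro estimate_cong) simp
    then show ?case using Suc by (simp only: backward_ratio.simps smooth_residual_def Suc_lessD)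
  qed simp
  with measurable_compose[OF measurable_Pair2'[OF y] backward_ratio_measurable[OF assms, of Q L G]] assms
  show ?thesis by simp
qed

text \<open>
  For fixed \<open>y\<close>, the source density cancels and the states \<open>u\<^sub>0, u\<^sub>1, \<dots>\<close> integrate out in this order, each backward
  density having mass \<open>1\<close> because its mean depends on later states and on \<open>y\<close> only.
\<close>

lemma nn_integral_backward_ratio:
  fixes \<psi> :: "real^'p \<Rightarrow> ennreal"
  assumes Q: "pos_def Q" and "\<psi> \<in> borel_measurable borel"
  shows "(\<integral>\<^sup>+\<omega>. ennreal (backward_ratio Q L G y t (source_path (Suc t) \<omega>)) * \<psi> (x t \<omega>) \<partial>M) = (\<integral>\<^sup>+v. \<psi> v \<partial>lborel)"
  using assms(2)
proof (induction t arbitrary: \<psi>)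
  case 0
  note [measurable] = 0
  have "(\<integral>\<^sup>+\<omega>. ennreal (backward_ratio Q L G y 0 (source_path (Suc 0) \<omega>)) * \<psi> (x 0 \<omega>) \<partial>M)
     = (\<integral>\<^sup>+\<omega>. ennreal (1 / gaussian_density S0 (x 0 \<omega>)) * \<psi> (x 0 \<omega>) \<partial>M)"
    by (simp add: source_path_nth)
  also have "\<dots> = (\<integral>\<^sup>+v. ennreal (1 / gaussian_density S0 v) * \<psi> v \<partial>normal_law S0)"
    by (subst distr_init[symmetric], subst nn_integral_distr) simp_all
  also have "\<dots> = (\<integral>\<^sup>+v. gauss S0 v * (ennreal (1 / gaussian_density S0 v) * \<psi> v) \<partial>lborel)"
    by (rule nn_integral_normal_law) simp
  also have "\<dots> = (\<integral>\<^sup>+v. \<psi> v \<partial>lborel)"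
    using gaussian_density_pos[OF S0_pos_def]
    by (intro nn_integral_cong) (simp add: mult.assoc[symmetric] ennreal_mult[symmetric] less_imp_le less_imp_neq[symmetric])
  finally show ?case .
next
  case (Suc t)
  note [measurable] = Suc.prems
  let ?g = "backward_ratio Q L G y t" and ?e = "estimate A G y t"
  let ?q = "\<lambda>u v. gaussian_density Q ((u - ?e) - L *v (v - A *v ?e))"
  have g[measurable]: "?g \<in> borel_measurable (hist (Suc t))" by (rule backward_ratio_measurable1) simp
  have g0: "0 \<le> ?g u" for u by (rule less_imp_le[OF backward_ratio_pos[OF Q]])
  have q0: "0 \<le> ?q u v" for u v by (rule less_imp_le[OF gaussian_density_pos[OF Q]])
  define f where "f = (\<lambda>p. ennreal (?g (fst p)) * (ennreal (?q (fst p t) (A *v fst p t + snd p) / gaussian_density Sw (snd p)) * \<psi> (A *v fst p t + snd p)))"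
  have f: "f \<in> borel_measurable (hist (Suc t) \<Otimes>\<^sub>M borel)"
  proof -
    have [measurable]: "(\<lambda>y. y t) \<in> hist (Suc t) \<rightarrow>\<^sub>M (borel :: (real^'p) measure)"
      by (auto intro: measurable_hist_component)
    show ?thesis unfolding f_def by measurable
  qed
  have "(\<integral>\<^sup>+\<omega>. ennreal (backward_ratio Q L G y (Suc t) (source_path (Suc (Suc t)) \<omega>)) * \<psi> (x (Suc t) \<omega>) \<partial>M)
      = (\<integral>\<^sup>+\<omega>. f (source_path (Suc t) \<omega>, w t \<omega>) \<partial>M)"
  proof (rule nn_integral_cong)
    fix \<omega> assume \<omega>: "\<omega> \<in> space M"
    have 1: "?g (source_path (Suc (Suc t)) \<omega>) = ?g (source_path (Suc t) \<omega>)"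
      by (rule backward_ratio_cong) (simp add: source_path_nth)
    have eq: "backward_ratio Q L G y (Suc t) (source_path (Suc (Suc t)) \<omega>)
      = ?g (source_path (Suc t) \<omega>) * (?q (x t \<omega>) (x (Suc t) \<omega>) / gaussian_density Sw (x (Suc t) \<omega> - A *v x t \<omega>))"
      by (simp only: backward_ratio.simps 1) (simp add: source_path_nth smooth_residual_def)
    show "ennreal (backward_ratio Q L G y (Suc t) (source_path (Suc (Suc t)) \<omega>)) * \<psi> (x (Suc t) \<omega>) = f (source_path (Suc t) \<omega>, w t \<omega>)"
      unfolding eq f_def ennreal_mult'[OF g0] using \<omega> by (simp add: step source_path_nth mult.assoc)
  qed
  also have "\<dots> = (\<integral>\<^sup>+\<omega>. \<integral>\<^sup>+v. f (source_path (Suc t) \<omega>, v) \<partial>normal_law Sw \<partial>M)"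
    by (rule nn_integral_path_noise[OF f])
  also have "\<dots> = (\<integral>\<^sup>+\<omega>. ennreal (?g (source_path (Suc t) \<omega>)) * (\<integral>\<^sup>+v. ennreal (?q (x t \<omega>) v) * \<psi> v \<partial>lborel) \<partial>M)"
  proof (rule nn_integral_cong)
    fix \<omega> assume \<omega>: "\<omega> \<in> space M"
    have *: "gaussian_density Sw v \<noteq> 0" "0 \<le> gaussian_density Sw v" for v
      using gaussian_density_pos[OF Sw_pos_def, of v] by auto
    have "(\<integral>\<^sup>+v. f (source_path (Suc t) \<omega>, v) \<partial>normal_law Sw)
       = (\<integral>\<^sup>+v. ennreal (?g (source_path (Suc t) \<omega>)) *
            (ennreal (?q (x t \<omega>) (A *v x t \<omega> + v) / gaussian_density Sw v) * \<psi> (A *v x t \<omega> + v)) \<partial>normal_law Sw)"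
      by (simp add: f_def source_path_nth)
    also have "\<dots> = ennreal (?g (source_path (Suc t) \<omega>)) *
      (\<integral>\<^sup>+v. ennreal (?q (x t \<omega>) (A *v x t \<omega> + v) / gaussian_density Sw v) * \<psi> (A *v x t \<omega> + v) \<partial>normal_law Sw)"
      by (rule nn_integral_cmult) measurable
    also have "(\<integral>\<^sup>+v. ennreal (?q (x t \<omega>) (A *v x t \<omega> + v) / gaussian_density Sw v) * \<psi> (A *v x t \<omega> + v) \<partial>normal_law Sw)
      = (\<integral>\<^sup>+v. gauss Sw v * (ennreal (?q (x t \<omega>) (A *v x t \<omega> + v) / gaussian_density Sw v) * \<psi> (A *v x t \<omega> + v)) \<partial>lborel)"
      by (rule nn_integral_normal_law) measurable
    also have "\<dots> = (\<integral>\<^sup>+v. ennreal (?q (x t \<omega>) (A *v x t \<omega> + v)) * \<psi> (A *v x t \<omega> + v) \<partial>lborel)"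
      using * by (intro nn_integral_cong) (simp add: mult.assoc[symmetric] ennreal_mult'[symmetric])
    also have "\<dots> = (\<integral>\<^sup>+v. ennreal (?q (x t \<omega>) v) * \<psi> v \<partial>lborel)"
      by (rule nn_integral_lborel_translate) measurable
    finally show "(\<integral>\<^sup>+v. f (source_path (Suc t) \<omega>, v) \<partial>normal_law Sw)
      = ennreal (?g (source_path (Suc t) \<omega>)) * (\<integral>\<^sup>+v. ennreal (?q (x t \<omega>) v) * \<psi> v \<partial>lborel)" .
  qed
  also have "\<dots> = (\<integral>\<^sup>+u. \<integral>\<^sup>+v. ennreal (?q u v) * \<psi> v \<partial>lborel \<partial>lborel)"
    by (rule Suc.IH) measurable
  also have "\<dots> = (\<integral>\<^sup>+v. \<integral>\<^sup>+u. ennreal (?q u v) * \<psi> v \<partial>lborel \<partial>lborel)"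
    by (rule lborel_pair.Fubini') measurable
  also have "\<dots> = (\<integral>\<^sup>+v. \<psi> v \<partial>lborel)"
  proof (rule nn_integral_cong)
    fix v
    have "(\<integral>\<^sup>+u. ennreal (?q u v) \<partial>lborel) = 1"
      using nn_integral_gaussian_density_shift[OF Q, of "?e + L *v (v - A *v ?e)"] by (simp add: diff_diff_eq)
    then show "(\<integral>\<^sup>+u. ennreal (?q u v) * \<psi> v \<partial>lborel) = \<psi> v" by (simp add: nn_integral_multc)
  qed
  finally show ?case .
qed

lemma integrable_inner_matrix:
  fixes f :: "'z \<Rightarrow> real^'n" and g :: "'z \<Rightarrow> real^'m" and V :: "real^'m^'n"
  assumes [measurable]: "f \<in> borel_measurable N" "g \<in> borel_measurable N"
    and f: "integrable N (\<lambda>z. (norm (f z))\<^sup>2)" and g: "integrable N (\<lambda>z. (norm (g z))\<^sup>2)"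
  shows "integrable N (\<lambda>z. f z \<bullet> (V *v g z))"
proof (rule Bochner_Integration.integrable_bound)
  show "integrable N (\<lambda>z. (norm (f z))\<^sup>2 + (norm (V *v g z))\<^sup>2)"
    using f integrable_norm_square_matrix[OF assms(2) g, of V] by simp
  have "\<bar>f z \<bullet> (V *v g z)\<bar> \<le> (norm (f z))\<^sup>2 + (norm (V *v g z))\<^sup>2" for z
  proof -
    have "\<bar>f z \<bullet> (V *v g z)\<bar> \<le> norm (f z) * norm (V *v g z)" by (rule Cauchy_Schwarz_ineq2)
    also have "\<dots> \<le> (norm (f z))\<^sup>2 + (norm (V *v g z))\<^sup>2"
      using sum_squares_bound[of "norm (f z)" "norm (V *v g z)"]
        zero_le_power2[of "norm (f z)"] zero_le_power2[of "norm (V *v g z)"] by linarith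
    finally show ?thesis .
  qed
  then show "AE z in N. norm (f z \<bullet> (V *v g z)) \<le> norm ((norm (f z))\<^sup>2 + (norm (V *v g z))\<^sup>2)" by simp
qed simp

lemma integrable_norm_square_diff:
  fixes f g :: "'z \<Rightarrow> real^'n"
  assumes [measurable]: "f \<in> borel_measurable N" "g \<in> borel_measurable N"
    and f: "integrable N (\<lambda>z. (norm (f z))\<^sup>2)" and g: "integrable N (\<lambda>z. (norm (g z))\<^sup>2)"
  shows "integrable N (\<lambda>z. (norm (f z - g z))\<^sup>2)"
  using integrable_norm_square_add[of f N "\<lambda>z. - g z"] assms by simp

text \<open>
  The noise is independent of \<open>(x\<^sup>t, y\<^sup>t)\<close> and has mean zero.
\<close>

lemma noise_uncorrelated:
  assumes K: "K \<in> causal_kernels" and tn: "t < n"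
    and f: "f \<in> borel_measurable (hist_pair (Suc t))"
    and int: "integrable (joint_law M x K n) (\<lambda>p. (norm (f (truncate_pair (Suc t) p) :: real^'p))\<^sup>2)"
  shows "(\<integral>p. f (truncate_pair (Suc t) p) \<bullet> (fst p (Suc t) - A *v fst p t) \<partial>joint_law M x K n) = 0"
proof -
  let ?J = "joint_law M x K n" and ?Jt = "joint_law M x K t"
  let ?T = "\<lambda>p. (truncate_pair (Suc t) p, fst p (Suc t) - A *v fst p t)"
  have le: "Suc t \<le> Suc n" using tn by simp
  note truncate_pair_measurable[OF le, measurable] and f[measurable]
  note sets_joint_law[OF K, measurable_cong]
  interpret N: prob_space "normal_law Sw" by (rule prob_space_normal_law[OF Sw_pos_def])
  interpret Jt: prob_space ?Jt by (rule prob_space_joint_law[OF K])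
  interpret pair_sigma_finite ?Jt "normal_law Sw" ..
  have [measurable]: "(\<lambda>u. u (Suc t)) \<in> hist (Suc n) \<rightarrow>\<^sub>M (borel :: (real^'p) measure)"
      "(\<lambda>u. u t) \<in> hist (Suc n) \<rightarrow>\<^sub>M (borel :: (real^'p) measure)"
    using tn by (auto intro!: measurable_hist_component)
  have T[measurable]: "?T \<in> ?J \<rightarrow>\<^sub>M (hist_pair (Suc t)) \<Otimes>\<^sub>M borel" by measurable
  have D: "distr ?J ((hist_pair (Suc t)) \<Otimes>\<^sub>M borel) ?T = ?Jt \<Otimes>\<^sub>M normal_law Sw"
    by (rule distr_joint_law_noise[OF K tn])
  have w2: "integrable ?J (\<lambda>p. (norm (fst p (Suc t) - A *v fst p t))\<^sup>2)"
  proof -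
    have "integrable (distr ?J borel (\<lambda>p. fst p (Suc t) - A *v fst p t)) (\<lambda>v. (norm v)\<^sup>2)"
      using noise_integrable[of t] tn
      by (subst distr_joint_law_fst_function[OF K, of "\<lambda>u. u (Suc t) - A *v u t"])
         (simp_all add: integrable_distr_eq source_path_nth step cong: Bochner_Integration.integrable_cong)
    then show ?thesis by (subst (asm) integrable_distr_eq) simp_all
  qed
  have "integrable ?J (\<lambda>p. f (truncate_pair (Suc t) p) \<bullet> (mat 1 *v (fst p (Suc t) - A *v fst p t)))"
    by (rule integrable_inner_matrix) (use int w2 in measurable)
  then have "integrable (distr ?J ((hist_pair (Suc t)) \<Otimes>\<^sub>M borel) ?T) (\<lambda>q. f (fst q) \<bullet> snd q)"
    by (subst integrable_distr_eq) simp_all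
  then have i: "integrable (?Jt \<Otimes>\<^sub>M normal_law Sw) (\<lambda>q. f (fst q) \<bullet> snd q)" by (simp only: D)
  have "(\<integral>p. f (truncate_pair (Suc t) p) \<bullet> (fst p (Suc t) - A *v fst p t) \<partial>?J)
     = (\<integral>q. f (fst q) \<bullet> snd q \<partial>distr ?J ((hist_pair (Suc t)) \<Otimes>\<^sub>M borel) ?T)"
    by (subst integral_distr) simp_all
  also have "\<dots> = (\<integral>q. f (fst q) \<bullet> snd q \<partial>(?Jt \<Otimes>\<^sub>M normal_law Sw))" by (simp only: D)
  also have "\<dots> = (\<integral>a. \<integral>v. f a \<bullet> v \<partial>normal_law Sw \<partial>?Jt)"
    using integral_fst'[OF i] by simp
  also have "\<dots> = 0" by (simp add: normal_law_integral_linear)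
  finally show ?thesis .
qed

lemma noise_quadratic:
  assumes K: "K \<in> causal_kernels" and tn: "t < n" and V: "pos_semidef V"
  shows "has_bochner_integral (joint_law M x K n)
     (\<lambda>p. quad V (fst p (Suc t) - A *v fst p t)) (V \<bullet> Sw)"
proof -
  note sets_joint_law[OF K, measurable_cong]
  have [measurable]: "(\<lambda>u. u (Suc t)) \<in> hist (Suc n) \<rightarrow>\<^sub>M (borel :: (real^'p) measure)"
      "(\<lambda>u. u t) \<in> hist (Suc n) \<rightarrow>\<^sub>M (borel :: (real^'p) measure)"
    using tn by (auto intro!: measurable_hist_component)
  have m: "(\<lambda>p. fst p (Suc t) - A *v fst p t) \<in> joint_law M x K n \<rightarrow>\<^sub>M borel" by measurable
  have "distr (joint_law M x K n) borel (\<lambda>p. fst p (Suc t) - A *v fst p t)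
      = distr M borel (\<lambda>\<omega>. source_path (Suc n) \<omega> (Suc t) - A *v source_path (Suc n) \<omega> t)"
    by (rule distr_joint_law_fst_function[OF K]) measurable
  also have "\<dots> = distr M borel (w t)"
    using tn by (intro distr_cong) (simp_all add: source_path_nth step)
  also have "\<dots> = normal_law Sw" by (rule distr_noise)
  finally have D: "distr (joint_law M x K n) borel (\<lambda>p. fst p (Suc t) - A *v fst p t) = normal_law Sw" .
  have "transpose Sw = Sw" using Sw_pos_def by (simp add: pos_def_def)
  then have "has_bochner_integral (distr (joint_law M x K n) borel (\<lambda>p. fst p (Suc t) - A *v fst p t)) (\<lambda>v. quad V v) (V \<bullet> Sw)"
    unfolding D using has_bochner_integral_normal_law_quadratic[OF Sw_pos_def V] by (simp add: trace_mult_symmetric)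
  then show ?thesis
    by (simp add: has_bochner_integral_iff integrable_distr_eq[OF m] integral_distr[OF m])
qed

lemma state_integrable_joint:
  assumes K: "K \<in> causal_kernels" and tn: "t \<le> n"
  shows "integrable (joint_law M x K n) (\<lambda>p. (norm (fst p t))\<^sup>2)"
proof -
  note sets_joint_law[OF K, measurable_cong]
  have [measurable]: "(\<lambda>u. u t) \<in> hist (Suc n) \<rightarrow>\<^sub>M (borel :: (real^'p) measure)"
    using tn by (auto intro!: measurable_hist_component)
  have m: "(\<lambda>p. fst p t) \<in> joint_law M x K n \<rightarrow>\<^sub>M borel" by measurable
  have "integrable (distr (joint_law M x K n) borel (\<lambda>p. fst p t)) (\<lambda>v. (norm v)\<^sup>2)"
    using state_integrable[of t] tn
    by (subst distr_joint_law_fst_function[OF K, of "\<lambda>u. u t"])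
       (simp_all add: integrable_distr_eq source_path_nth cong: Bochner_Integration.integrable_cong)
  then show ?thesis by (subst (asm) integrable_distr_eq[OF m]) simp_all
qed

context
  fixes K :: "(real^'p) kernels"
  assumes K: "K \<in> causal_kernels"
begin

lemma state_measurable_joint: "t \<le> n \<Longrightarrow> (\<lambda>q. fst q t) \<in> borel_measurable (joint_law M x K n)"
proof -
  assume "t \<le> n"
  then have [measurable]: "(\<lambda>u. u t) \<in> hist (Suc n) \<rightarrow>\<^sub>M (borel :: (real^'p) measure)" by (auto intro!: measurable_hist_component)
  note sets_joint_law[OF K, measurable_cong]
  show ?thesis by measurable
qed

lemma noise_measurable_joint: "t < n \<Longrightarrow> (\<lambda>q. fst q (Suc t) - A *v fst q t) \<in> borel_measurable (joint_law M x K n)"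
proof -
  assume "t < n"
  then have [measurable]: "(\<lambda>u. u t) \<in> hist (Suc n) \<rightarrow>\<^sub>M (borel :: (real^'p) measure)"
    "(\<lambda>u. u (Suc t)) \<in> hist (Suc n) \<rightarrow>\<^sub>M (borel :: (real^'p) measure)" by (auto intro!: measurable_hist_component)
  note sets_joint_law[OF K, measurable_cong]
  show ?thesis by measurable
qed

end

lemma noise_integrable_joint:
  assumes K: "K \<in> causal_kernels" and "t < n"
  shows "integrable (joint_law M x K n) (\<lambda>q. (norm (fst q (Suc t) - A *v fst q t))\<^sup>2)"
  using assms(2) by (intro integrable_norm_square_diff integrable_norm_square_matrix state_integrable_joint[OF K]
      state_measurable_joint[OF K] borel_measurable_matrix_vector) auto

text \<open>
  The cost of one stage: what is known at time \<open>t\<close> and the noise entering at time \<open>t\<close> contribute separately, the latter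
  by an amount that does not depend on the kernels.
\<close>

lemma quadratic_noise_split:
  fixes f :: "(nat \<Rightarrow> real^'p) \<times> (nat \<Rightarrow> real^'p) \<Rightarrow> real^'p" and B C V :: "real^'p^'p"
  assumes K: "K \<in> causal_kernels" and tn: "t < n" and V: "pos_semidef V"
    and f: "f \<in> borel_measurable (hist_pair (Suc t))" and past: "\<And>q. f (truncate_pair (Suc t) q) = f q"
    and int: "integrable (joint_law M x K n) (\<lambda>q. (norm (f q))\<^sup>2)"
  shows "integrable (joint_law M x K n) (\<lambda>q. quad V (B *v f q))"
    and "(\<integral>q. quad V (B *v f q + C *v (fst q (Suc t) - A *v fst q t)) \<partial>joint_law M x K n)
       = (\<integral>q. quad V (B *v f q) \<partial>joint_law M x K n) + (transpose C ** V ** C) \<bullet> Sw"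
proof -
  define J where "J = joint_law M x K n"
  define v where "v = (\<lambda>q :: (nat \<Rightarrow> real^'p) \<times> (nat \<Rightarrow> real^'p). fst q (Suc t) - A *v fst q t)"
  have v: "v \<in> borel_measurable J" "integrable J (\<lambda>q. (norm (v q))\<^sup>2)"
    unfolding v_def J_def by (rule noise_measurable_joint[OF K tn], rule noise_integrable_joint[OF K tn])
  have Vs: "transpose V = V" using V by (simp add: pos_semidef_def)
  have fJ: "f \<in> borel_measurable J"
  proof -
    have "truncate_pair (Suc t) \<in> J \<rightarrow>\<^sub>M hist_pair (Suc t)"
      using truncate_pair_measurable[of "Suc t" "Suc n"] tn
      by (simp cong: measurable_cong_sets add: J_def sets_joint_law[OF K])
    from measurable_compose[OF this f] show ?thesis by (simp add: past)
  qed
  have iJ: "integrable J (\<lambda>q. (norm (f q))\<^sup>2)" using int by (simp add: J_def)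
  have CVC: "pos_semidef (transpose C ** V ** C)"
    using V congruence_quadratic[of _ "transpose C" V]
    by (simp only: pos_semidef_def transpose_transpose) (simp add: matrix_transpose_mul matrix_mul_assoc)
  have expand: "quad V (B *v f q + C *v v q)
      = quad V (B *v f q) + 2 * (((transpose C ** V ** B) *v f q) \<bullet> v q) + quad (transpose C ** V ** C) (v q)" for q
  proof -
    have 1: "(C *v v q) \<bullet> (V *v (B *v f q)) = (B *v f q) \<bullet> (V *v (C *v v q))" by (rule inner_symmetric_matrix[OF Vs])
    have 2: "(C *v v q) \<bullet> (V *v (B *v f q)) = ((transpose C ** V ** B) *v f q) \<bullet> v q"
      by (subst inner_commute, subst inner_matrix_transpose) (simp only: matrix_vector_mul_assoc matrix_mul_assoc)
    have 3: "quad V (C *v v q) = quad (transpose C ** V ** C) (v q)"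
      using congruence_quadratic[of "v q" "transpose C" V] by (simp only: transpose_transpose)
    show ?thesis
      by (simp only: matrix_vector_right_distrib[of V] inner_left_distrib inner_right_distrib 1[symmetric] 2 3)
  qed
  have 1: "integrable J (\<lambda>q. quad V (B *v f q))"
    by (intro integrable_inner_matrix integrable_norm_square_matrix borel_measurable_matrix_vector fJ iJ)
  then show "integrable (joint_law M x K n) (\<lambda>q. quad V (B *v f q))" by (simp add: J_def)
  have "integrable J (\<lambda>q. ((transpose C ** V ** B) *v f q) \<bullet> (mat 1 *v v q))"
    by (intro integrable_inner_matrix integrable_norm_square_matrix borel_measurable_matrix_vector fJ iJ v)
  then have 2: "integrable J (\<lambda>q. ((transpose C ** V ** B) *v f q) \<bullet> v q)" by simp
  have "(\<integral>q. ((transpose C ** V ** B) *v f (truncate_pair (Suc t) q)) \<bullet> (fst q (Suc t) - A *v fst q t) \<partial>joint_law M x K n) = 0"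
    by (rule noise_uncorrelated[OF K tn borel_measurable_matrix_vector[OF f]])
       (use integrable_norm_square_matrix[OF fJ iJ] in \<open>simp add: past J_def\<close>)
  then have 3: "(\<integral>q. ((transpose C ** V ** B) *v f q) \<bullet> v q \<partial>J) = 0" by (simp only: past v_def J_def)
  have 4: "has_bochner_integral J (\<lambda>q. quad (transpose C ** V ** C) (v q)) ((transpose C ** V ** C) \<bullet> Sw)"
    unfolding J_def v_def by (rule noise_quadratic[OF K tn CVC])
  have "(\<integral>q. quad V (B *v f q + C *v v q) \<partial>J) = (\<integral>q. quad V (B *v f q) \<partial>J) + (transpose C ** V ** C) \<bullet> Sw"
    unfolding expand using 1 2 3 4 by (simp add: has_bochner_integral_iff)
  then show "(\<integral>q. quad V (B *v f q + C *v (fst q (Suc t) - A *v fst q t)) \<partial>joint_law M x K n)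
       = (\<integral>q. quad V (B *v f q) \<partial>joint_law M x K n) + (transpose C ** V ** C) \<bullet> Sw" by (simp add: J_def v_def)
qed

lemma init_integral_joint:
  fixes f :: "real^'p \<Rightarrow> real"
  assumes K: "K \<in> causal_kernels" and [measurable]: "f \<in> borel_measurable borel"
  shows "(\<integral>p. f (fst p 0) \<partial>joint_law M x K n) = (\<integral>v. f v \<partial>normal_law S0)"
proof -
  note sets_joint_law[OF K, measurable_cong]
  have [measurable]: "(\<lambda>u. u 0) \<in> hist (Suc n) \<rightarrow>\<^sub>M (borel :: (real^'p) measure)"
    by (auto intro!: measurable_hist_component)
  have m: "(\<lambda>p. fst p 0) \<in> joint_law M x K n \<rightarrow>\<^sub>M borel" by measurable
  have "distr (joint_law M x K n) borel (\<lambda>p. fst p 0) = distr M borel (\<lambda>\<omega>. source_path (Suc n) \<omega> 0)"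
    by (rule distr_joint_law_fst_function[OF K]) measurable
  also have "\<dots> = normal_law S0" by (simp add: source_path_nth distr_init)
  finally show ?thesis by (subst (asm) eq_commute) (simp add: integral_distr[OF m])
qed

lemma integrable_ln_gaussian:
  fixes f :: "'z \<Rightarrow> real^'n"
  assumes S: "pos_def S" and N: "prob_space N" and [measurable]: "f \<in> borel_measurable N"
    and f: "integrable N (\<lambda>z. (norm (f z))\<^sup>2)"
  shows "integrable N (\<lambda>z. ln (gaussian_density S (f z)))"
    and "(\<integral>z. ln (gaussian_density S (f z)) \<partial>N) = - (\<integral>z. quad (matrix_inv S) (f z) \<partial>N) / 2
        - (real CARD('n) * ln (2 * pi) + ln (det S)) / 2"
proof -
  interpret N: prob_space N by fact
  have i: "integrable N (\<lambda>z. quad (matrix_inv S) (f z))" by (rule integrable_inner_matrix[OF _ _ f f]) simp_all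
  then show "integrable N (\<lambda>z. ln (gaussian_density S (f z)))"
    unfolding ln_gaussian_density[OF S] by simp
  show "(\<integral>z. ln (gaussian_density S (f z)) \<partial>N) = - (\<integral>z. quad (matrix_inv S) (f z) \<partial>N) / 2
        - (real CARD('n) * ln (2 * pi) + ln (det S)) / 2"
    unfolding ln_gaussian_density[OF S] using i by (simp add: N.prob_space)
qed

text \<open>
  The constraint bounds an extended integral; the Bochner integral of the same function is meaningful because that
  bound is finite.
\<close>

lemma srd_admissibleD:
  assumes K: "K \<in> srd_admissible M x n D" and D: "0 \<le> D" and tn: "t \<le> n"
  shows "integrable (joint_law M x K n) (\<lambda>p. (norm (fst p t - snd p t))\<^sup>2)"
    and "(\<integral>p. (norm (fst p t - snd p t))\<^sup>2 \<partial>joint_law M x K n) \<le> D"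
proof -
  have Kc: "K \<in> causal_kernels" using K by (simp add: srd_admissible_def)
  note sets_joint_law[OF Kc, measurable_cong]
  have [measurable]: "(\<lambda>u. u t) \<in> hist (Suc n) \<rightarrow>\<^sub>M (borel :: (real^'p) measure)"
    using tn by (auto intro!: measurable_hist_component)
  have m: "(\<lambda>p. (norm (fst p t - snd p t))\<^sup>2) \<in> borel_measurable (joint_law M x K n)" by measurable
  have le: "(\<integral>\<^sup>+p. ennreal ((norm (fst p t - snd p t))\<^sup>2) \<partial>joint_law M x K n) \<le> ennreal D"
    using K tn by (simp add: srd_admissible_def case_prod_unfold)
  then show i: "integrable (joint_law M x K n) (\<lambda>p. (norm (fst p t - snd p t))\<^sup>2)"
    using m by (intro integrableI_nonneg) (auto intro: le_less_trans)
  from nn_integral_eq_integral[OF i] le D show "(\<integral>p. (norm (fst p t - snd p t))\<^sup>2 \<partial>joint_law M x K n) \<le> D"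
    by simp
qed

lemma ext_mutual_information_joint:
  fixes n :: nat and b :: real
  assumes K: "K \<in> causal_kernels"
  defines "J \<equiv> joint_law M x K n"
  defines "prd \<equiv> source_law M x n \<Otimes>\<^sub>M distr J (hist (Suc n)) snd"
  shows "ext_mutual_information b J (hist (Suc n)) (hist (Suc n)) fst snd =
    (if absolutely_continuous prd J \<and> integrable J (entropy_density b prd J) then ereal (KL_divergence b prd J) else \<infinity>)"
proof -
  note sets_joint_law[OF K, measurable_cong]
  have "distr J (hist_pair (Suc n)) (\<lambda>\<omega>. (fst \<omega>, snd \<omega>)) = J"
    by (simp add: J_def distr_id2 sets_joint_law[OF K])
  moreover have "distr J (hist (Suc n)) fst = source_law M x n" unfolding J_def by (rule distr_joint_law_fst[OF K])
  ultimately show ?thesis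
    using prob_space.mutual_information_def[OF prob_space_joint_law[OF K], of n b "hist (Suc n)" "hist (Suc n)" fst snd]
    by (simp add: ext_mutual_information_def Let_def J_def[symmetric] prd_def)
qed

text \<open>
  The converse.  The guess \<open>h\<close> for the density of the joint law is the backward Gaussian model; by the Gibbs bound the
  information is at least the expectation of \<open>ln h\<close>.  In stage \<open>t\<close> this expectation contains
  half of \<open>ln det W - ln det Q + p\<close> minus half of the expected \<open>Q\<^sup>-\<^sup>1\<close>-form of the smoothing residual.  Causality removes the cross terms
  with the noise, and the certificate bounds the form by \<open>p\<close> plus the decrease of the expected \<open>\<Theta>\<close>-form of the
  prediction error.  These decreases telescope, so the total loss is bounded independently of \<open>n\<close>.
\<close>

theorem information_lower_bound:
  fixes Q L G \<Theta> :: "real^'p^'p" and \<mu> D b :: real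
  assumes b: "1 < b" and D: "0 \<le> D" and Q: "pos_def Q" and \<Theta>: "pos_semidef \<Theta>" and \<mu>: "0 \<le> \<mu>"
    and cert: "\<And>e. quad (matrix_inv Q) (e - L *v (A *v e)) + quad \<Theta> (A *v e)
        \<le> quad \<Theta> e + \<mu> * (norm e)\<^sup>2"
    and budget: "(transpose L ** matrix_inv Q ** L) \<bullet> Sw + \<Theta> \<bullet> Sw + \<mu> * D \<le> real CARD('p)"
    and fusion: "\<And>u v. let e = v + G *v (u - v) in
       \<mu> * (norm e)\<^sup>2 + quad \<Theta> e \<le> \<mu> * (norm u)\<^sup>2 + quad \<Theta> v"
  shows "\<exists>C. \<forall>n. \<forall>K \<in> srd_admissible M x n D.
     ereal ((real n * ((ln (det Sw) - ln (det Q)) / 2) - C) / ln b)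
       \<le> causal_information b K n"
proof -
  define I where "I = (mat 1 :: real^'p^'p)"
  have I: "pos_def I" by (simp add: I_def pos_def_def)
  have invI: "matrix_inv I = mat 1" unfolding I_def by (rule matrix_inv_eqI) simp
  define p where "p = real CARD('p)"
  define \<kappa> where "\<kappa> = (ln (det Sw) - ln (det Q)) / 2"
  define c0 where "c0 = (\<integral>v. ln (gaussian_density S0 v) \<partial>normal_law S0)"
  define c1 where "c1 = (\<integral>v. quad \<Theta> v \<partial>normal_law S0)"
  define C where "C = c1 / 2 + D / 2 + p * ln (2 * pi) / 2 + c0"
  have "ereal ((real n * \<kappa> - C) / ln b) \<le> causal_information b K n"
    if adm: "K \<in> srd_admissible M x n D" for n K
  proof -
    have K: "K \<in> causal_kernels" using adm by (simp add: srd_admissible_def)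
    define J where "J = joint_law M x K n"
    define prd where "prd = source_law M x n \<Otimes>\<^sub>M distr J (hist (Suc n)) snd"
    interpret J: prob_space J unfolding J_def by (rule prob_space_joint_law[OF K])
    have sJ[measurable_cong]: "sets J = sets (hist_pair (Suc n))" unfolding J_def by (rule sets_joint_law[OF K])
    interpret S: prob_space "source_law M x n" by (rule prob_space_source_law)
    interpret Y: prob_space "distr J (hist (Suc n)) snd" by (rule J.prob_space_distr) measurable
    interpret PP: pair_prob_space "source_law M x n" "distr J (hist (Suc n)) snd" ..
    have prd: "prob_space prd" unfolding prd_def by (rule PP.P.prob_space_axioms)
    have sprd[measurable_cong]: "sets prd = sets (hist_pair (Suc n))"
      unfolding prd_def by (rule sets_pair_measure_cong) simp_all
    have comp: "(\<lambda>u. u t) \<in> hist (Suc n) \<rightarrow>\<^sub>M (borel :: (real^'p) measure)" if "t \<le> n" for t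
      using that by (auto intro!: measurable_hist_component)
    \<comment> \<open>prediction error \<open>v\<close>, estimation error \<open>e\<close>, reconstruction error \<open>d\<close>, noise \<open>wn\<close> and smoothing residual \<open>r\<close>\<close>
    define v where "v = (\<lambda>t q. fst q t - predict A G (snd q) t)"
    define e where "e = (\<lambda>t q. fst q t - estimate A G (snd q) t)"
    define d where "d = (\<lambda>t (q :: (nat \<Rightarrow> real^'p) \<times> (nat \<Rightarrow> real^'p)). fst q t - snd q t)"
    define wn where "wn = (\<lambda>t (q :: (nat \<Rightarrow> real^'p) \<times> (nat \<Rightarrow> real^'p)). fst q (Suc t) - A *v fst q t)"
    define r where "r = (\<lambda>t q. smooth_residual A G L (fst q) (snd q) t)"
    have e_v: "e t q = v t q + G *v (d t q - v t q)" for t q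
      by (simp add: e_def v_def d_def estimate_def matrix_vector_mult_diff_distrib algebra_simps)
    have v_Suc: "v (Suc t) q = A *v e t q + wn t q" for t q
      by (simp only: v_def e_def wn_def predict_Suc) (simp add: matrix_vector_mult_diff_distrib)
    have r_e: "r t q = (e t q - L *v (A *v e t q)) - L *v wn t q" for t q
    proof -
      have "fst q (Suc t) - A *v estimate A G (snd q) t = A *v e t q + wn t q"
        by (simp add: e_def wn_def matrix_vector_mult_diff_distrib)
      then have "r t q = e t q - L *v (A *v e t q + wn t q)" by (simp only: r_def smooth_residual_def e_def)
      then show ?thesis by (simp only: matrix_vector_right_distrib diff_diff_eq)
    qed
    have v_meas: "v t \<in> borel_measurable J" if "t \<le> n" for t
    proof -
      have [measurable]: "(\<lambda>y. predict A G y t) \<in> borel_measurable (hist (Suc n))" using that by (intro predict_measurable) simp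
      note comp[OF that, measurable]
      show ?thesis unfolding v_def by measurable
    qed
    have e_meas: "e t \<in> borel_measurable J" if "t \<le> n" for t
    proof -
      have [measurable]: "(\<lambda>y. estimate A G y t) \<in> borel_measurable (hist (Suc n))" using that by (intro estimate_measurable) simp
      note comp[OF that, measurable]
      show ?thesis unfolding e_def by measurable
    qed
    have d_meas: "d t \<in> borel_measurable J" if "t \<le> n" for t
    proof -
      note comp[OF that, measurable]
      show ?thesis unfolding d_def by measurable
    qed
    have wn_meas: "wn t \<in> borel_measurable J" if "t < n" for t
      unfolding wn_def J_def by (rule noise_measurable_joint[OF K that])
    have d_int: "integrable J (\<lambda>q. (norm (d t q))\<^sup>2)" and d_le: "(\<integral>q. (norm (d t q))\<^sup>2 \<partial>J) \<le> D" if "t \<le> n" for t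
      using srd_admissibleD[OF adm D that] by (simp_all add: J_def d_def)
    have wn_int: "integrable J (\<lambda>q. (norm (wn t q))\<^sup>2)" if "t < n" for t
      unfolding wn_def J_def by (rule noise_integrable_joint[OF K that])
    have ev_int: "t \<le> n \<Longrightarrow> integrable J (\<lambda>q. (norm (v t q))\<^sup>2)" for t
    proof (induction t)
      case 0
      show ?case using state_integrable_joint[OF K, of 0 n] by (simp add: v_def J_def)
    next
      case (Suc t)
      then show ?case unfolding v_Suc e_v
        by (intro integrable_norm_square_add integrable_norm_square_diff integrable_norm_square_matrix wn_int d_int
            borel_measurable_matrix_vector v_meas d_meas wn_meas borel_measurable_add borel_measurable_diff) auto
    qed
    have e_int: "integrable J (\<lambda>q. (norm (e t q))\<^sup>2)" if "t \<le> n" for t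
      unfolding e_v using that
      by (intro integrable_norm_square_add integrable_norm_square_diff integrable_norm_square_matrix ev_int d_int
          borel_measurable_matrix_vector v_meas d_meas borel_measurable_add borel_measurable_diff) auto
    have eL_meas: "(\<lambda>q. e t q - L *v (A *v e t q)) \<in> borel_measurable J" if "t \<le> n" for t
      using e_meas[OF that] by measurable
    have eL_int: "integrable J (\<lambda>q. (norm (e t q - L *v (A *v e t q)))\<^sup>2)" if "t \<le> n" for t
      using that by (intro integrable_norm_square_diff integrable_norm_square_matrix e_int e_meas borel_measurable_matrix_vector) auto
    have r_meas: "r t \<in> borel_measurable J" if "t < n" for t
    proof -
      have [measurable]: "e t \<in> borel_measurable J" "wn t \<in> borel_measurable J"
        using e_meas[of t] wn_meas[of t] that by auto
      show ?thesis unfolding r_e[abs_def] by measurable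
    qed
    have r_int: "integrable J (\<lambda>q. (norm (r t q))\<^sup>2)" if "t < n" for t
      unfolding r_e using that
      by (intro integrable_norm_square_diff[OF eL_meas] integrable_norm_square_matrix eL_int wn_int wn_meas borel_measurable_matrix_vector) auto
    have split: "integrable J (\<lambda>q. quad V (B *v e t q))"
      "(\<integral>q. quad V (B *v e t q + C *v wn t q) \<partial>J) = (\<integral>q. quad V (B *v e t q) \<partial>J) + (transpose C ** V ** C) \<bullet> Sw"
      if tn: "t < n" and V: "pos_semidef V" for t and V B C :: "real^'p^'p"
    proof -
      have past: "e t (truncate_pair (Suc t) q) = e t q" for q
        using estimate_cong[of t "restrict (snd q) {0..<Suc t}" "snd q" A G]
        by (simp add: e_def truncate_pair_def)
      have "(\<lambda>y. estimate A G y t) \<in> borel_measurable (hist (Suc t))" by (intro estimate_measurable) simp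
      moreover have "(\<lambda>u. u t) \<in> hist (Suc t) \<rightarrow>\<^sub>M (borel :: (real^'p) measure)" by (rule measurable_hist_component) simp
      ultimately have m: "e t \<in> borel_measurable (hist_pair (Suc t))"
        unfolding e_def by measurable
      have i: "integrable (joint_law M x K n) (\<lambda>q. (norm (e t q))\<^sup>2)" using e_int[of t] tn by (simp add: J_def)
      show "integrable J (\<lambda>q. quad V (B *v e t q))"
        "(\<integral>q. quad V (B *v e t q + C *v wn t q) \<partial>J) = (\<integral>q. quad V (B *v e t q) \<partial>J) + (transpose C ** V ** C) \<bullet> Sw"
        using quadratic_noise_split(1)[where f="e t" and B=B, OF K tn V m past i] quadratic_noise_split(2)[where f="e t" and B=B and C=C, OF K tn V m past i] by (simp_all add: J_def wn_def)
    qed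
    define a where "a = (\<lambda>t. \<integral>q. quad \<Theta> (v t q) \<partial>J)"
    have \<Theta>s: "transpose \<Theta> = \<Theta>" and \<Theta>0: "\<And>z. 0 \<le> quad \<Theta> z" using \<Theta> by (simp_all add: pos_semidef_def)
    let ?Qi = "matrix_inv Q"
    have Qip: "pos_semidef ?Qi" by (rule pos_def_imp_pos_semidef[OF pos_def_matrix_inv(3)[OF Q]])
    \<comment> \<open>the heart of the bound: certificate, fusion and distortion constraint combined\<close>
    have residual: "(\<integral>q. quad ?Qi (r t q) \<partial>J) \<le> p + a t - a (Suc t)" if tn: "t < n" for t
    proof -
      have tn': "t \<le> n" using tn by simp
      have E: "(mat 1 - L ** A) *v z = z - L *v (A *v z)" for z
        by (simp add: matrix_vector_mult_diff_rdistrib matrix_vector_mul_assoc)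
      have r: "r t q = (mat 1 - L ** A) *v e t q + (- L) *v wn t q" for q
        unfolding r_e E using matrix_vector_mult_diff_rdistrib[of 0 L "wn t q"] by simp
      have 1: "(\<integral>q. quad ?Qi (r t q) \<partial>J) = (\<integral>q. quad ?Qi (e t q - L *v (A *v e t q)) \<partial>J) + (transpose L ** ?Qi ** L) \<bullet> Sw"
      proof -
        have "transpose (- L) ** ?Qi ** (- L) = transpose L ** ?Qi ** L"
          by (simp add: vec_eq_iff matrix_matrix_mult_def transpose_def sum_negf)
        then show ?thesis using split(2)[OF tn Qip, of "mat 1 - L ** A" "- L"] unfolding r E by simp
      qed
      have 2: "a (Suc t) = (\<integral>q. quad \<Theta> (A *v e t q) \<partial>J) + \<Theta> \<bullet> Sw"
        using split(2)[OF tn \<Theta>, of A "mat 1"] by (simp add: a_def v_Suc)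
      have vv: "integrable J (\<lambda>q. quad \<Theta> (v t q))"
        using v_meas[OF tn'] ev_int[OF tn'] by (intro integrable_inner_matrix) auto
      note Aee = split(1)[OF tn \<Theta>, of A] and iE = split(1)[OF tn Qip, of "mat 1 - L ** A", unfolded E]
      have "(\<integral>q. quad ?Qi (e t q - L *v (A *v e t q)) + quad \<Theta> (A *v e t q) \<partial>J)
         \<le> (\<integral>q. \<mu> * (norm (d t q))\<^sup>2 + quad \<Theta> (v t q) \<partial>J)"
      proof (rule integral_mono)
        fix q
        have "\<mu> * (norm (e t q))\<^sup>2 + quad \<Theta> (e t q) \<le> \<mu> * (norm (d t q))\<^sup>2 + quad \<Theta> (v t q)"
          using fusion[of "v t q" "d t q"] by (simp only: Let_def e_v[symmetric])
        then show "quad ?Qi (e t q - L *v (A *v e t q)) + quad \<Theta> (A *v e t q) \<le> \<mu> * (norm (d t q))\<^sup>2 + quad \<Theta> (v t q)"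
          using cert[of "e t q"] by linarith
      qed (use iE Aee vv d_int[OF tn'] in auto)
      also have "\<dots> = \<mu> * (\<integral>q. (norm (d t q))\<^sup>2 \<partial>J) + a t"
        using vv d_int[OF tn'] by (simp add: a_def)
      also have "\<dots> \<le> \<mu> * D + a t" using d_le[OF tn'] \<mu> by (simp add: mult_left_mono)
      finally have 3: "(\<integral>q. quad ?Qi (e t q - L *v (A *v e t q)) \<partial>J) + (\<integral>q. quad \<Theta> (A *v e t q) \<partial>J) \<le> \<mu> * D + a t"
        using iE Aee by simp
      show ?thesis using 1 2 3 budget by (simp add: p_def)
    qed
    \<comment> \<open>the last state is modelled as \<open>N(y\<^sub>n, I)\<close>; any fixed Gaussian would do, at a cost bounded in \<open>n\<close>\<close>
    define h where "h = (\<lambda>q. backward_ratio Q L G (snd q) n (fst q) * gaussian_density I (d n q))"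
    have h0: "0 < h q" for q
      by (simp add: h_def backward_ratio_pos[OF Q] gaussian_density_pos[OF I])
    have h_meas: "h \<in> borel_measurable prd"
    proof -
      note backward_ratio_measurable[of n "Suc n" Q L G, simplified, measurable] and comp[OF order.refl, measurable]
      show ?thesis unfolding h_def d_def by measurable
    qed
    have mass: "(\<integral>\<^sup>+q. ennreal (h q) \<partial>prd) \<le> 1"
    proof -
      have "(\<integral>\<^sup>+q. ennreal (h q) \<partial>prd) = (\<integral>\<^sup>+y. \<integral>\<^sup>+u. ennreal (h (u, y)) \<partial>source_law M x n \<partial>distr J (hist (Suc n)) snd)"
        unfolding prd_def using h_meas by (subst PP.nn_integral_snd[symmetric]) (simp_all add: prd_def)
      also have "\<dots> = (\<integral>\<^sup>+y. 1 \<partial>distr J (hist (Suc n)) snd)"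
      proof (rule nn_integral_cong)
        fix y :: "nat \<Rightarrow> real^'p"
        have bm: "backward_ratio Q L G y n \<in> borel_measurable (hist (Suc n))" by (rule backward_ratio_measurable1) simp
        have "(\<integral>\<^sup>+u. ennreal (h (u, y)) \<partial>source_law M x n)
           = (\<integral>\<^sup>+\<omega>. ennreal (backward_ratio Q L G y n (source_path (Suc n) \<omega>)) * gauss I (x n \<omega> - y n) \<partial>M)"
          unfolding h_def d_def using bm comp[OF order.refl]
          by (subst nn_integral_source_law) (simp_all add: ennreal_mult' backward_ratio_pos[OF Q] less_imp_le source_path_nth)
        also have "\<dots> = (\<integral>\<^sup>+v. gauss I (v - y n) \<partial>lborel)"
          by (rule nn_integral_backward_ratio[OF Q]) measurable
        also have "\<dots> = 1" by (rule nn_integral_gaussian_density_shift[OF I])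
        finally show "(\<integral>\<^sup>+u. ennreal (h (u, y)) \<partial>source_law M x n) = 1" .
      qed
      finally show ?thesis using Y.emeasure_space_1 by simp
    qed
    have ln_ratio: "ln (backward_ratio Q L G (snd q) m (fst q)) = - ln (gaussian_density S0 (fst q 0))
        + (\<Sum>t<m. ln (gaussian_density Q (r t q)) - ln (gaussian_density Sw (wn t q)))" for m q
    proof (induction m)
      case 0
      show ?case using gaussian_density_pos[OF S0_pos_def, of "fst q 0"] by (simp add: ln_div)
    next
      case (Suc m)
      have "ln (backward_ratio Q L G (snd q) (Suc m) (fst q)) = ln (backward_ratio Q L G (snd q) m (fst q)) +
          (ln (gaussian_density Q (r m q)) - ln (gaussian_density Sw (wn m q)))"
        using backward_ratio_pos[OF Q, of L G "snd q" m "fst q"] gaussian_density_pos[OF Q, of "r m q"]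
          gaussian_density_pos[OF Sw_pos_def, of "wn m q"]
        by (simp add: r_def wn_def ln_mult ln_div divide_pos_pos)
      then show ?case using Suc by simp
    qed
    have ln_h: "ln (h q) = - ln (gaussian_density S0 (fst q 0))
        + (\<Sum>t<n. ln (gaussian_density Q (r t q)) - ln (gaussian_density Sw (wn t q))) + ln (gaussian_density I (d n q))" for q
      using backward_ratio_pos[OF Q, of L G "snd q" n "fst q"] gaussian_density_pos[OF I, of "d n q"]
      by (simp add: h_def ln_mult ln_ratio)
    note lg = integrable_ln_gaussian[OF _ J.prob_space_axioms]
    have i0: "integrable J (\<lambda>q. ln (gaussian_density S0 (fst q 0)))"
      unfolding J_def by (rule integrable_ln_gaussian[OF S0_pos_def prob_space_joint_law[OF K] state_measurable_joint[OF K] state_integrable_joint[OF K]]) auto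
    have i1: "integrable J (\<lambda>q. ln (gaussian_density Q (r t q)) - ln (gaussian_density Sw (wn t q)))" if "t < n" for t
      using lg(1)[OF Q r_meas[OF that] r_int[OF that]] lg(1)[OF Sw_pos_def wn_meas[OF that] wn_int[OF that]] by simp
    have i2: "integrable J (\<lambda>q. ln (gaussian_density I (d n q)))"
      by (rule lg(1)[OF I d_meas d_int]) auto
    have isum: "integrable J (\<lambda>q. \<Sum>t<n. ln (gaussian_density Q (r t q)) - ln (gaussian_density Sw (wn t q)))"
      by (rule Bochner_Integration.integrable_sum) (rule i1, simp)
    have ln_h_int: "integrable J (\<lambda>q. ln (h q))"
      unfolding ln_h by (intro Bochner_Integration.integrable_add integrable_minus i0 isum i2)
    have stage: "\<kappa> - (a t - a (Suc t)) / 2 \<le> (\<integral>q. ln (gaussian_density Q (r t q)) - ln (gaussian_density Sw (wn t q)) \<partial>J)" if "t < n" for t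
    proof -
      have Wi: "matrix_inv Sw \<bullet> Sw = p"
        using Sw_pos_def by (simp add: trace_mult_symmetric[symmetric] pos_def_def pos_def_matrix_inv[OF Sw_pos_def] trace_I p_def)
      have "(\<integral>q. quad (matrix_inv Sw) (wn t q) \<partial>J) = p"
        using noise_quadratic[OF K that pos_def_imp_pos_semidef[OF pos_def_matrix_inv(3)[OF Sw_pos_def]]] by (simp add: has_bochner_integral_iff Wi J_def wn_def)
      then show ?thesis
        using residual[OF that] lg[OF Q r_meas[OF that] r_int[OF that]] lg[OF Sw_pos_def wn_meas[OF that] wn_int[OF that]]
        by (simp add: \<kappa>_def field_simps)
    qed
    have last: "- D / 2 - p * ln (2 * pi) / 2 \<le> (\<integral>q. ln (gaussian_density I (d n q)) \<partial>J)"
    proof -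
      have "det I = 1" by (simp add: I_def)
      then show ?thesis using lg(2)[OF I d_meas[OF order.refl] d_int[OF order.refl]] d_le[OF order.refl]
        by (simp add: invI power2_norm_eq_inner p_def)
    qed
    have init: "(\<integral>q. ln (gaussian_density S0 (fst q 0)) \<partial>J) = c0"
      unfolding c0_def J_def by (rule init_integral_joint[OF K, of "\<lambda>v. ln (gaussian_density S0 v)"]) measurable
    have a0: "a 0 = c1"
      unfolding a_def c1_def J_def v_def using init_integral_joint[OF K, of "\<lambda>v. quad \<Theta> v" n] by simp
    have an: "0 \<le> a n" unfolding a_def by (intro integral_nonneg_AE) (simp add: \<Theta>0)
    have "real n * \<kappa> - C \<le> - c0 + (\<Sum>t<n. \<kappa> - (a t - a (Suc t)) / 2) + (- D / 2 - p * ln (2 * pi) / 2)"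
    proof -
      have "(\<Sum>t<n. \<kappa> - (a t - a (Suc t)) / 2) = real n * \<kappa> - (a 0 - a n) / 2"
        using sum_lessThan_telescope'[of a n] by (simp add: sum_subtractf sum_divide_distrib[symmetric])
      then show ?thesis using a0 an by (simp add: C_def field_simps)
    qed
    also have "\<dots> \<le> - c0 + (\<Sum>t<n. \<integral>q. ln (gaussian_density Q (r t q)) - ln (gaussian_density Sw (wn t q)) \<partial>J) + (\<integral>q. ln (gaussian_density I (d n q)) \<partial>J)"
      using stage last by (intro add_mono sum_mono) auto
    also have "\<dots> = (\<integral>q. ln (h q) \<partial>J)"
    proof -
      have "(\<integral>q. ln (h q) \<partial>J) = - (\<integral>q. ln (gaussian_density S0 (fst q 0)) \<partial>J)
        + (\<integral>q. (\<Sum>t<n. ln (gaussian_density Q (r t q)) - ln (gaussian_density Sw (wn t q))) \<partial>J)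
        + (\<integral>q. ln (gaussian_density I (d n q)) \<partial>J)"
        unfolding ln_h
        by (simp only: Bochner_Integration.integral_add[OF Bochner_Integration.integrable_add[OF integrable_minus[OF i0] isum] i2]
            Bochner_Integration.integral_add[OF integrable_minus[OF i0] isum] integral_minus)
      also have "(\<integral>q. (\<Sum>t<n. ln (gaussian_density Q (r t q)) - ln (gaussian_density Sw (wn t q))) \<partial>J)
        = (\<Sum>t<n. \<integral>q. ln (gaussian_density Q (r t q)) - ln (gaussian_density Sw (wn t q)) \<partial>J)"
        by (rule Bochner_Integration.integral_sum) (rule i1, simp)
      finally show ?thesis by (simp only: init)
    qed
    finally have main: "real n * \<kappa> - C \<le> (\<integral>q. ln (h q) \<partial>J)" .
    show ?thesis
    proof (cases "absolutely_continuous prd J \<and> integrable J (entropy_density b prd J)")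
      case True
      have "(real n * \<kappa> - C) / ln b \<le> (\<integral>q. ln (h q) \<partial>J) / ln b"
        using main b by (simp add: divide_right_mono)
      also have "\<dots> \<le> KL_divergence b prd J"
        using True by (intro KL_divergence_ge[OF b prd J.prob_space_axioms _ _ _ h_meas h0 mass ln_h_int]) (simp_all add: sJ sprd)
      finally show ?thesis
        using True ext_mutual_information_joint[OF K, of b n] by (simp add: J_def prd_def)
    next
      case False
      then show ?thesis using ext_mutual_information_joint[OF K, of b n] by (auto simp: J_def prd_def)
    qed
  qed
  then show ?thesis unfolding \<kappa>_def by blast
qed

end

section \<open>The test channel\<close>

lemma density_kernel_measurable:
  fixes f :: "'a \<Rightarrow> 'e::euclidean_space \<Rightarrow> real"
  assumes f: "(\<lambda>(p, z). f p z) \<in> borel_measurable (N \<Otimes>\<^sub>M borel)"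
    and mass: "\<And>p. (\<integral>\<^sup>+z. ennreal (f p z) \<partial>lborel) = 1"
  shows "(\<lambda>p. density lborel (\<lambda>z. ennreal (f p z))) \<in> N \<rightarrow>\<^sub>M prob_algebra borel"
proof (rule measurable_prob_algebraI)
  note [measurable] = f
  have fp[measurable]: "f p \<in> borel_measurable borel" if "p \<in> space N" for p
    using measurable_Pair2[OF f that] by simp
  show ps: "prob_space (density lborel (\<lambda>z. ennreal (f p z)))" if "p \<in> space N" for p
    using fp[OF that] by (intro prob_spaceI) (simp add: emeasure_density mass)
  show "(\<lambda>p. density lborel (\<lambda>z. ennreal (f p z))) \<in> N \<rightarrow>\<^sub>M subprob_algebra borel"
  proof (rule measurable_subprob_algebra)
    show "subprob_space (density lborel (\<lambda>z. ennreal (f p z)))" if "p \<in> space N" for p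
      by (rule prob_space_imp_subprob_space[OF ps[OF that]])
    fix X :: "'e set" assume X[measurable]: "X \<in> sets borel"
    have "(\<lambda>p. \<integral>\<^sup>+z. ennreal (f p z) * indicator X z \<partial>lborel) \<in> borel_measurable N"
      by (rule lborel.borel_measurable_nn_integral) simp
    then show "(\<lambda>p. emeasure (density lborel (\<lambda>z. ennreal (f p z))) X) \<in> borel_measurable N"
      by (subst measurable_cong[where g="\<lambda>p. \<integral>\<^sup>+z. ennreal (f p z) * indicator X z \<partial>lborel"]) (simp_all add: emeasure_density)
  qed simp
qed

lemma inner_congruence:
  fixes A V P :: "real^'n^'n"
  assumes "transpose P = P"
  shows "(transpose A ** V ** A) \<bullet> P = V \<bullet> (A ** P ** transpose A)"
proof -
  have t: "transpose (A ** P ** transpose A) = A ** P ** transpose A"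
    by (simp add: matrix_transpose_mul matrix_mul_assoc assms)
  have "(transpose A ** V ** A) \<bullet> P = trace (transpose A ** (V ** A ** P))"
    by (simp add: trace_mult_symmetric[OF assms, symmetric] matrix_mul_assoc)
  also have "\<dots> = trace ((V ** A ** P) ** transpose A)" by (rule trace_mul_sym)
  also have "\<dots> = V \<bullet> (A ** P ** transpose A)"
    by (simp add: trace_mult_symmetric[OF t, symmetric] matrix_mul_assoc)
  finally show ?thesis .
qed

context gauss_markov
begin

text \<open>
  Covariance of \<open>x\<^sub>t\<close> given \<open>y\<^sup>t\<^sup>-\<^sup>1\<close> when \<open>Pt s\<close> is the error covariance at time \<open>s\<close>.  The conditional mean is
  \<open>A y\<^sub>t\<^sub>-\<^sub>1\<close>, since the test channel reports the conditional mean itself as \<open>y\<^sub>t\<^sub>-\<^sub>1\<close>.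
\<close>

definition prior_cov :: "(nat \<Rightarrow> real^'p^'p) \<Rightarrow> nat \<Rightarrow> real^'p^'p" where
  "prior_cov Pt t = (case t of 0 \<Rightarrow> S0 | Suc s \<Rightarrow> A ** Pt s ** transpose A + Sw)"

definition prior_mean :: "(nat \<Rightarrow> real^'p) \<Rightarrow> nat \<Rightarrow> real^'p" where
  "prior_mean y t = (case t of 0 \<Rightarrow> 0 | Suc s \<Rightarrow> A *v y s)"

lemma prior_mean_measurable: "t \<le> m \<Longrightarrow> (\<lambda>y. prior_mean y t) \<in> borel_measurable (hist m)"
  by (cases t) (auto simp: prior_mean_def intro!: borel_measurable_matrix_vector measurable_hist_component)

lemma prior_mean_cong: "(\<And>i. i < t \<Longrightarrow> y i = y' i) \<Longrightarrow> prior_mean y t = prior_mean y' t"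
  by (cases t) (auto simp: prior_mean_def)

context
  fixes Pt :: "nat \<Rightarrow> real^'p^'p"
  assumes Pt: "\<And>t. pos_def (Pt t)" and Rt: "\<And>t. pos_def (prior_cov Pt t - Pt t)"
begin

text \<open>
  Posterior density of \<open>x\<^sub>t\<close>, given that the output is \<open>z\<close>, over its prior density.
\<close>

definition gain_ratio :: "nat \<Rightarrow> (nat \<Rightarrow> real^'p) \<Rightarrow> (nat \<Rightarrow> real^'p) \<Rightarrow> real^'p \<Rightarrow> real" where
  "gain_ratio t u y z = gaussian_density (Pt t) (u t - z) / gaussian_density (prior_cov Pt t) (u t - prior_mean y t)"

definition output_density :: "nat \<Rightarrow> (nat \<Rightarrow> real^'p) \<Rightarrow> real^'p \<Rightarrow> real" where
  "output_density t y z = gaussian_density (prior_cov Pt t - Pt t) (z - prior_mean y t)"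

text \<open>
  The test channel with prescribed error covariances, obtained from Bayes' formula: the law of the output given past
  outputs, \<open>N(m, \<Pi> - P)\<close>, times posterior over prior.  Working with densities
  avoids the gain and the noise covariance of this Gaussian channel.
\<close>

definition test_kernel :: "(real^'p) kernels" where
  "test_kernel t p = density lborel (\<lambda>z. ennreal (output_density t (fst p) z * gain_ratio t (snd p) (fst p) z))"

definition output_kernel :: "(real^'p) kernels" where
  "output_kernel t p = density lborel (\<lambda>z. ennreal (output_density t (fst p) z))"

text \<open>
  The density of the joint law of \<open>(x\<^sup>m\<^sup>-\<^sup>1, y\<^sup>m\<^sup>-\<^sup>1)\<close> with respect to the product of its marginals.
\<close>

definition info_ratio :: "nat \<Rightarrow> (nat \<Rightarrow> real^'p) \<Rightarrow> (nat \<Rightarrow> real^'p) \<Rightarrow> real" where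
  "info_ratio m u y = (\<Prod>t<m. gain_ratio t u y (y t))"

lemma prior_cov_pos_def: "pos_def (prior_cov Pt t)"
  by (cases t) (auto simp: prior_cov_def S0_pos_def intro!: pos_def_predict pos_def_imp_pos_semidef Pt Sw_pos_def)

lemma gain_ratio_pos: "0 < gain_ratio t u y z"
  by (simp add: gain_ratio_def gaussian_density_pos Pt prior_cov_pos_def)

lemma output_density_pos: "0 < output_density t y z"
  by (simp add: output_density_def gaussian_density_pos Rt)

lemma info_ratio_pos: "0 < info_ratio m u y"
  unfolding info_ratio_def by (intro prod_pos) (simp add: gain_ratio_pos)

lemma gain_ratio_measurable:
  assumes "f \<in> N \<rightarrow>\<^sub>M hist m" "g \<in> N \<rightarrow>\<^sub>M hist k" "t < m" "t \<le> k" and [measurable]: "h \<in> borel_measurable N"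
  shows "(\<lambda>q. gain_ratio t (f q) (g q) (h q)) \<in> borel_measurable N"
proof -
  have [measurable]: "(\<lambda>q. f q t) \<in> borel_measurable N" "(\<lambda>q. prior_mean (g q) t) \<in> borel_measurable N"
    using measurable_compose[OF assms(1) measurable_hist_component[OF assms(3)]]
      measurable_compose[OF assms(2) prior_mean_measurable[OF assms(4)]] by simp_all
  show ?thesis unfolding gain_ratio_def by measurable
qed

lemma output_density_measurable:
  assumes "g \<in> N \<rightarrow>\<^sub>M hist k" "t \<le> k" and [measurable]: "h \<in> borel_measurable N"
  shows "(\<lambda>q. output_density t (g q) (h q)) \<in> borel_measurable N"
proof -
  have [measurable]: "(\<lambda>q. prior_mean (g q) t) \<in> borel_measurable N"
    using measurable_compose[OF assms(1) prior_mean_measurable[OF assms(2)]] by simp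
  show ?thesis unfolding output_density_def by measurable
qed

lemma info_ratio_measurable:
  assumes "f \<in> N \<rightarrow>\<^sub>M hist k" "g \<in> N \<rightarrow>\<^sub>M hist k" "m \<le> k"
  shows "(\<lambda>q. info_ratio m (f q) (g q)) \<in> borel_measurable N"
  unfolding info_ratio_def
proof (rule borel_measurable_prod)
  fix t assume "t \<in> {..<m}"
  then have t: "t < k" using assms(3) by simp
  show "(\<lambda>q. gain_ratio t (f q) (g q) (g q t)) \<in> borel_measurable N"
    using t measurable_compose[OF assms(2) measurable_hist_component[OF t]] assms
    by (intro gain_ratio_measurable[OF assms(1,2)]) auto
qed

text \<open>
  The convolution of \<open>N(0, P)\<close> with \<open>N(m, \<Pi> - P)\<close> is \<open>N(m, \<Pi>)\<close>.
\<close>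

lemma test_kernel_mass: "(\<integral>\<^sup>+z. ennreal (output_density t y z * gain_ratio t u y z) \<partial>lborel) = 1"
proof -
  let ?P = "Pt t" and ?S = "prior_cov Pt t" and ?m = "prior_mean y t"
  have T: "mat 1 ** (?S - ?P) ** transpose (mat 1) + ?P = ?S" by simp
  have "(\<integral>\<^sup>+z. ennreal (output_density t y z * gain_ratio t u y z) \<partial>lborel)
     = (\<integral>\<^sup>+z. gauss (?S - ?P) (z - ?m) * gauss ?P (u t - mat 1 *v z) * ennreal (1 / gaussian_density ?S (u t - ?m)) \<partial>lborel)"
    using gaussian_density_pos[OF prior_cov_pos_def, of t] gaussian_density_pos[OF Pt, of t] gaussian_density_pos[OF Rt, of t]
    by (intro nn_integral_cong) (simp add: output_density_def gain_ratio_def ennreal_mult[symmetric] less_imp_le)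
  also have "\<dots> = gauss ?S (u t - ?m) * ennreal (1 / gaussian_density ?S (u t - ?m))"
    using gaussian_convolution[OF Pt[of t] Rt[of t], where y="?m" and u="u t" and A="mat 1"] unfolding T
    by (subst nn_integral_multc) simp_all
  also have "\<dots> = 1"
    using gaussian_density_pos[OF prior_cov_pos_def, of t "u t - ?m"] by (simp add: ennreal_mult[symmetric] less_imp_le)
  finally show ?thesis .
qed

lemma output_kernel_mass: "(\<integral>\<^sup>+z. ennreal (output_density t y z) \<partial>lborel) = 1"
  unfolding output_density_def by (rule nn_integral_gaussian_density_shift[OF Rt])

lemma test_kernel_causal: "test_kernel \<in> causal_kernels"
  unfolding causal_kernels_def test_kernel_def[abs_def]
proof (intro CollectI allI, rule density_kernel_measurable)
  fix t :: nat
  have 1: "(\<lambda>q. fst (fst q)) \<in> (hist t \<Otimes>\<^sub>M hist (Suc t)) \<Otimes>\<^sub>M borel \<rightarrow>\<^sub>M (hist t :: (nat \<Rightarrow> real^'p) measure)"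
    and 2: "(\<lambda>q. snd (fst q)) \<in> (hist t \<Otimes>\<^sub>M hist (Suc t)) \<Otimes>\<^sub>M borel \<rightarrow>\<^sub>M (hist (Suc t) :: (nat \<Rightarrow> real^'p) measure)"
    by measurable
  show "(\<lambda>(p, z). output_density t (fst p) z * gain_ratio t (snd p) (fst p) z) \<in> borel_measurable ((hist t \<Otimes>\<^sub>M hist (Suc t)) \<Otimes>\<^sub>M borel)"
    unfolding case_prod_beta
    by (intro borel_measurable_times output_density_measurable[OF 1] gain_ratio_measurable[OF 2 1]) simp_all
qed (rule test_kernel_mass)

lemma output_kernel_causal: "output_kernel \<in> causal_kernels"
  unfolding causal_kernels_def output_kernel_def[abs_def]
proof (intro CollectI allI, rule density_kernel_measurable)
  fix t :: nat
  have 1: "(\<lambda>q. fst (fst q)) \<in> (hist t \<Otimes>\<^sub>M hist (Suc t)) \<Otimes>\<^sub>M borel \<rightarrow>\<^sub>M (hist t :: (nat \<Rightarrow> real^'p) measure)"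
    by measurable
  show "(\<lambda>(p, z). output_density t (fst p) z) \<in> borel_measurable ((hist t \<Otimes>\<^sub>M hist (Suc t)) \<Otimes>\<^sub>M borel)"
    unfolding case_prod_beta by (intro output_density_measurable[OF 1]) simp_all
qed (rule output_kernel_mass)

lemma info_ratio_Suc: "info_ratio (Suc m) u (y(m := z)) = info_ratio m u y * gain_ratio m u y z"
proof -
  have "gain_ratio t u (y(m := z)) r = gain_ratio t u y r" if "t \<le> m" for t r
    using prior_mean_cong[of t "y(m := z)" y] that by (simp add: gain_ratio_def)
  then show ?thesis by (simp add: info_ratio_def)
qed

lemma gain_ratio_cong: "u t = u' t \<Longrightarrow> gain_ratio t u y z = gain_ratio t u' y z"
  by (simp add: gain_ratio_def)

lemma info_ratio_cong: "(\<And>i. i < m \<Longrightarrow> u i = u' i) \<Longrightarrow> info_ratio m u y = info_ratio m u' y"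
  unfolding info_ratio_def by (intro prod.cong) (auto intro: gain_ratio_cong)

lemma output_prefix_const: "causal_prefix output_kernel m u = causal_prefix output_kernel m u'"
proof (induction m)
  case 0 then show ?case by (simp add: causal_prefix_0[OF output_kernel_causal])
next
  case (Suc m)
  have k: "output_kernel m (y, restrict u {0..<Suc m}) = output_kernel m (y, restrict u' {0..<Suc m})" for y
    by (simp add: output_kernel_def)
  show ?case unfolding causal_prefix_Suc[OF output_kernel_causal] k Suc ..
qed

text \<open>
  Each step of the test channel has density \<open>gain_ratio\<close> with respect to the output kernel, which ignores the input.
\<close>

lemma nn_integral_test_prefix:
  assumes "f \<in> borel_measurable (hist m)" and "u \<in> space (hist k)" "m \<le> k"
  shows "(\<integral>\<^sup>+y. f y \<partial>causal_prefix test_kernel m u) = (\<integral>\<^sup>+y. ennreal (info_ratio m u y) * f y \<partial>causal_prefix output_kernel m u)"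
  using assms(1,3)
proof (induction m arbitrary: f)
  case 0 then show ?case
    by (simp add: causal_prefix_0[OF output_kernel_causal] causal_prefix_0[OF test_kernel_causal] info_ratio_def)
next
  case (Suc m)
  note f[measurable] = Suc.prems(1)
  have mk: "m \<le> k" "m < k" using Suc.prems by auto
  have upd[measurable]: "(\<lambda>q. (fst q)(m := snd q)) \<in> hist m \<Otimes>\<^sub>M borel \<rightarrow>\<^sub>M (hist (Suc m) :: (nat \<Rightarrow> real^'p) measure)"
    by (rule fun_upd_measurable_hist) measurable
  have c1: "(\<lambda>q. u) \<in> N \<rightarrow>\<^sub>M hist k" for N :: "'z measure" using assms(2) by simp
  have h1[measurable]: "(\<lambda>y. info_ratio m u y) \<in> borel_measurable (hist m)"
  proof -
    have "(\<lambda>q. restrict u {0..<m}) \<in> hist m \<rightarrow>\<^sub>M (hist m :: (nat \<Rightarrow> real^'p) measure)" by (simp add: space_PiM)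
    then have "(\<lambda>y. info_ratio m (restrict u {0..<m}) y) \<in> borel_measurable (hist m)"
      by (rule info_ratio_measurable) auto
    moreover have "info_ratio m (restrict u {0..<m}) y = info_ratio m u y" for y by (rule info_ratio_cong) simp
    ultimately show ?thesis by simp
  qed
  have g1[measurable]: "(\<lambda>q. gain_ratio m u (fst q) (snd q)) \<in> borel_measurable (hist m \<Otimes>\<^sub>M borel)"
    by (rule gain_ratio_measurable[OF c1 measurable_fst mk(2)]) simp_all
  have o1[measurable]: "(\<lambda>q. output_density m (fst q) (snd q)) \<in> borel_measurable (hist m \<Otimes>\<^sub>M borel)"
    by (rule output_density_measurable[OF measurable_fst]) simp_all
  have h2[measurable]: "(\<lambda>y. info_ratio (Suc m) u y) \<in> borel_measurable (hist (Suc m))"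
  proof -
    have "(\<lambda>q. restrict u {0..<Suc m}) \<in> hist (Suc m) \<rightarrow>\<^sub>M (hist (Suc m) :: (nat \<Rightarrow> real^'p) measure)" by (simp add: space_PiM)
    then have "(\<lambda>y. info_ratio (Suc m) (restrict u {0..<Suc m}) y) \<in> borel_measurable (hist (Suc m))"
      by (rule info_ratio_measurable) auto
    moreover have "info_ratio (Suc m) (restrict u {0..<Suc m}) y = info_ratio (Suc m) u y" for y by (rule info_ratio_cong) simp
    ultimately show ?thesis by simp
  qed
  let ?r = "restrict u {0..<Suc m}"
  have gr: "gain_ratio m ?r y z = gain_ratio m u y z" for y z by (rule gain_ratio_cong) simp
  have "(\<integral>\<^sup>+y. f y \<partial>causal_prefix test_kernel (Suc m) u)
     = (\<integral>\<^sup>+y. \<integral>\<^sup>+z. f (y(m := z)) \<partial>test_kernel m (y, ?r) \<partial>causal_prefix test_kernel m u)"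
    by (rule nn_integral_causal_prefix_Suc[OF test_kernel_causal f])
  also have "\<dots> = (\<integral>\<^sup>+y. \<integral>\<^sup>+z. ennreal (output_density m y z * gain_ratio m u y z) * f (y(m := z)) \<partial>lborel \<partial>causal_prefix test_kernel m u)"
  proof (rule nn_integral_cong)
    fix y assume "y \<in> space (causal_prefix test_kernel m u)"
    then have y[measurable]: "y \<in> space (hist m)" by (simp add: space_causal_prefix[OF test_kernel_causal])
    note measurable_Pair2[OF g1 y, simplified, measurable] measurable_Pair2[OF o1 y, simplified, measurable] measurable_Pair2[OF upd y, simplified, measurable]
    show "(\<integral>\<^sup>+z. f (y(m := z)) \<partial>test_kernel m (y, ?r)) = (\<integral>\<^sup>+z. ennreal (output_density m y z * gain_ratio m u y z) * f (y(m := z)) \<partial>lborel)"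
      unfolding test_kernel_def by (subst nn_integral_density) (simp_all add: gr)
  qed
  also have "\<dots> = (\<integral>\<^sup>+y. ennreal (info_ratio m u y) * (\<integral>\<^sup>+z. ennreal (output_density m y z * gain_ratio m u y z) * f (y(m := z)) \<partial>lborel) \<partial>causal_prefix output_kernel m u)"
    by (rule Suc.IH[OF _ mk(1)]) measurable
  also have "\<dots> = (\<integral>\<^sup>+y. \<integral>\<^sup>+z. ennreal (info_ratio (Suc m) u (y(m := z))) * f (y(m := z)) \<partial>output_kernel m (y, ?r) \<partial>causal_prefix output_kernel m u)"
  proof (rule nn_integral_cong)
    fix y assume "y \<in> space (causal_prefix output_kernel m u)"
    then have y[measurable]: "y \<in> space (hist m)" by (simp add: space_causal_prefix[OF output_kernel_causal])
    note measurable_Pair2[OF g1 y, simplified, measurable] measurable_Pair2[OF o1 y, simplified, measurable] measurable_Pair2[OF upd y, simplified, measurable]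
    have "(\<integral>\<^sup>+z. ennreal (info_ratio (Suc m) u (y(m := z))) * f (y(m := z)) \<partial>output_kernel m (y, ?r))
        = (\<integral>\<^sup>+z. ennreal (output_density m y z) * (ennreal (info_ratio m u y * gain_ratio m u y z) * f (y(m := z))) \<partial>lborel)"
      unfolding output_kernel_def by (subst nn_integral_density) (simp_all add: info_ratio_Suc)
    also have "\<dots> = (\<integral>\<^sup>+z. ennreal (info_ratio m u y) * (ennreal (output_density m y z * gain_ratio m u y z) * f (y(m := z))) \<partial>lborel)"
      using info_ratio_pos[of m u y] output_density_pos[of m y] gain_ratio_pos[of m u y]
      by (intro nn_integral_cong) (simp add: ennreal_mult less_imp_le mult_ac)
    also have "\<dots> = ennreal (info_ratio m u y) * (\<integral>\<^sup>+z. ennreal (output_density m y z * gain_ratio m u y z) * f (y(m := z)) \<partial>lborel)"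
      by (rule nn_integral_cmult) measurable
    finally show "ennreal (info_ratio m u y) * (\<integral>\<^sup>+z. ennreal (output_density m y z * gain_ratio m u y z) * f (y(m := z)) \<partial>lborel)
      = (\<integral>\<^sup>+z. ennreal (info_ratio (Suc m) u (y(m := z))) * f (y(m := z)) \<partial>output_kernel m (y, ?r))" by simp
  qed
  also have "\<dots> = (\<integral>\<^sup>+y. ennreal (info_ratio (Suc m) u y) * f y \<partial>causal_prefix output_kernel (Suc m) u)"
    by (rule nn_integral_causal_prefix_Suc[OF output_kernel_causal, symmetric]) measurable
  finally show ?case .
qed

text \<open>
  The Kalman filter as a recursion on conditional laws: for fixed \<open>y\<close>, weighting the source by the information ratio
  makes \<open>x\<^sub>t\<close> Gaussian around \<open>A y\<^sub>t\<^sub>-\<^sub>1\<close> before and around \<open>y\<^sub>t\<close> after the output at time \<open>t\<close>.  The update is Bayes'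
  formula, the prediction is Gaussian convolution.
\<close>

lemma nn_integral_info_ratio:
  fixes \<phi> :: "real^'p \<Rightarrow> ennreal"
  assumes "\<phi> \<in> borel_measurable borel"
  shows nn_integral_info_ratio_prior: "(\<integral>\<^sup>+\<omega>. ennreal (info_ratio t (source_path (Suc t) \<omega>) y) * \<phi> (x t \<omega>) \<partial>M)
      = (\<integral>\<^sup>+v. gauss (prior_cov Pt t) (v - prior_mean y t) * \<phi> v \<partial>lborel)" (is "?prior t \<phi>")
    and nn_integral_info_ratio_posterior: "(\<integral>\<^sup>+\<omega>. ennreal (info_ratio (Suc t) (source_path (Suc t) \<omega>) y) * \<phi> (x t \<omega>) \<partial>M)
      = (\<integral>\<^sup>+v. gauss (Pt t) (v - y t) * \<phi> v \<partial>lborel)" (is "?post t \<phi>")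
proof -
  have post: "?post t \<phi>" if prior: "\<And>\<phi>. \<phi> \<in> borel_measurable borel \<Longrightarrow> ?prior t \<phi>" and [measurable]: "\<phi> \<in> borel_measurable borel" for t \<phi>
  proof -
    let ?g = "\<lambda>v. gaussian_density (Pt t) (v - y t) / gaussian_density (prior_cov Pt t) (v - prior_mean y t)"
    have "(\<integral>\<^sup>+\<omega>. ennreal (info_ratio (Suc t) (source_path (Suc t) \<omega>) y) * \<phi> (x t \<omega>) \<partial>M)
      = (\<integral>\<^sup>+\<omega>. ennreal (info_ratio t (source_path (Suc t) \<omega>) y) * (ennreal (?g (x t \<omega>)) * \<phi> (x t \<omega>)) \<partial>M)"
    proof (rule nn_integral_cong)
      fix \<omega>
      have "info_ratio (Suc t) (source_path (Suc t) \<omega>) y = info_ratio t (source_path (Suc t) \<omega>) y * ?g (x t \<omega>)"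
        by (simp add: info_ratio_def gain_ratio_def source_path_nth)
      then show "ennreal (info_ratio (Suc t) (source_path (Suc t) \<omega>) y) * \<phi> (x t \<omega>)
          = ennreal (info_ratio t (source_path (Suc t) \<omega>) y) * (ennreal (?g (x t \<omega>)) * \<phi> (x t \<omega>))"
        by (simp only: ennreal_mult'[OF less_imp_le[OF info_ratio_pos]] mult.assoc)
    qed
    also have "\<dots> = (\<integral>\<^sup>+v. gauss (prior_cov Pt t) (v - prior_mean y t) * (ennreal (?g v) * \<phi> v) \<partial>lborel)"
      by (rule prior) measurable
    also have "\<dots> = (\<integral>\<^sup>+v. gauss (Pt t) (v - y t) * \<phi> v \<partial>lborel)"
    proof (rule nn_integral_cong)
      fix v
      have "gaussian_density (prior_cov Pt t) (v - prior_mean y t) * ?g v = gaussian_density (Pt t) (v - y t)"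
        using gaussian_density_pos[OF prior_cov_pos_def, of t "v - prior_mean y t"] by simp
      then show "gauss (prior_cov Pt t) (v - prior_mean y t) * (ennreal (?g v) * \<phi> v) = gauss (Pt t) (v - y t) * \<phi> v"
        using gaussian_density_pos[OF prior_cov_pos_def, of t "v - prior_mean y t"]
        by (simp only: mult.assoc[symmetric] ennreal_mult'[symmetric] less_imp_le)
    qed
    finally show ?thesis .
  qed
  have prior: "\<phi> \<in> borel_measurable borel \<Longrightarrow> ?prior t \<phi>" for t \<phi>
  proof (induction t arbitrary: \<phi>)
    case 0
    note [measurable] = 0
    show ?case
      using nn_integral_normal_law[of \<phi> S0]
      by (simp add: info_ratio_def prior_cov_def prior_mean_def) (simp add: distr_init[symmetric] nn_integral_distr)
  next
    case (Suc t)
    note [measurable] = Suc.prems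
    have m[measurable]: "(\<lambda>u. info_ratio (Suc t) u y) \<in> borel_measurable (hist (Suc t))"
    proof -
      have "(\<lambda>q. restrict y {0..<Suc t}) \<in> hist (Suc t) \<rightarrow>\<^sub>M (hist (Suc t) :: (nat \<Rightarrow> real^'p) measure)" by (simp add: space_PiM)
      then have "(\<lambda>u. info_ratio (Suc t) u (restrict y {0..<Suc t})) \<in> borel_measurable (hist (Suc t))"
        by (intro info_ratio_measurable measurable_ident) auto
      moreover have "info_ratio (Suc t) u (restrict y {0..<Suc t}) = info_ratio (Suc t) u y" for u
        unfolding info_ratio_def gain_ratio_def
      proof (rule prod.cong)
        fix s assume "s \<in> {..<Suc t}"
        then have "prior_mean (restrict y {0..<Suc t}) s = prior_mean y s" by (intro prior_mean_cong) simp
        then show "gaussian_density (Pt s) (u s - restrict y {0..<Suc t} s) / gaussian_density (prior_cov Pt s) (u s - prior_mean (restrict y {0..<Suc t}) s)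
           = gaussian_density (Pt s) (u s - y s) / gaussian_density (prior_cov Pt s) (u s - prior_mean y s)"
          using \<open>s \<in> _\<close> by simp
      qed simp
      ultimately show ?thesis by simp
    qed
    have c: "(\<lambda>u. u t) \<in> hist (Suc t) \<rightarrow>\<^sub>M (borel :: (real^'p) measure)" by (rule measurable_hist_component) simp
    define F where "F = (\<lambda>q. ennreal (info_ratio (Suc t) (fst q) y) * \<phi> (A *v fst q t + snd q))"
    have F: "F \<in> borel_measurable (hist (Suc t) \<Otimes>\<^sub>M borel)"
    proof -
      note c[measurable]
      show ?thesis unfolding F_def by measurable
    qed
    have "(\<integral>\<^sup>+\<omega>. ennreal (info_ratio (Suc t) (source_path (Suc (Suc t)) \<omega>) y) * \<phi> (x (Suc t) \<omega>) \<partial>M)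
       = (\<integral>\<^sup>+\<omega>. F (source_path (Suc t) \<omega>, w t \<omega>) \<partial>M)"
    proof (rule nn_integral_cong)
      fix \<omega> assume \<omega>: "\<omega> \<in> space M"
      have "info_ratio (Suc t) (source_path (Suc (Suc t)) \<omega>) y = info_ratio (Suc t) (source_path (Suc t) \<omega>) y"
        by (rule info_ratio_cong) (simp add: source_path_nth)
      then show "ennreal (info_ratio (Suc t) (source_path (Suc (Suc t)) \<omega>) y) * \<phi> (x (Suc t) \<omega>) = F (source_path (Suc t) \<omega>, w t \<omega>)"
        using \<omega> by (simp add: F_def step source_path_nth)
    qed
    also have "\<dots> = (\<integral>\<^sup>+\<omega>. \<integral>\<^sup>+v. F (source_path (Suc t) \<omega>, v) \<partial>normal_law Sw \<partial>M)"
      by (rule nn_integral_path_noise[OF F])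
    also have "\<dots> = (\<integral>\<^sup>+\<omega>. ennreal (info_ratio (Suc t) (source_path (Suc t) \<omega>) y) * (\<integral>\<^sup>+v. gauss Sw (v - A *v x t \<omega>) * \<phi> v \<partial>lborel) \<partial>M)"
    proof (rule nn_integral_cong)
      fix \<omega>
      have "(\<integral>\<^sup>+v. F (source_path (Suc t) \<omega>, v) \<partial>normal_law Sw)
        = ennreal (info_ratio (Suc t) (source_path (Suc t) \<omega>) y) * (\<integral>\<^sup>+v. \<phi> (A *v x t \<omega> + v) \<partial>normal_law Sw)"
        by (simp add: F_def source_path_nth nn_integral_cmult)
      also have "(\<integral>\<^sup>+v. \<phi> (A *v x t \<omega> + v) \<partial>normal_law Sw) = (\<integral>\<^sup>+v. gauss Sw ((A *v x t \<omega> + v) - A *v x t \<omega>) * \<phi> (A *v x t \<omega> + v) \<partial>lborel)"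
        by (subst nn_integral_normal_law) simp_all
      also have "\<dots> = (\<integral>\<^sup>+v. gauss Sw (v - A *v x t \<omega>) * \<phi> v \<partial>lborel)"
        by (rule nn_integral_lborel_translate) measurable
      finally show "(\<integral>\<^sup>+v. F (source_path (Suc t) \<omega>, v) \<partial>normal_law Sw)
        = ennreal (info_ratio (Suc t) (source_path (Suc t) \<omega>) y) * (\<integral>\<^sup>+v. gauss Sw (v - A *v x t \<omega>) * \<phi> v \<partial>lborel)" .
    qed
    also have "\<dots> = (\<integral>\<^sup>+u. gauss (Pt t) (u - y t) * (\<integral>\<^sup>+v. gauss Sw (v - A *v u) * \<phi> v \<partial>lborel) \<partial>lborel)"
      by (rule post[OF Suc.IH]; measurable)
    also have "\<dots> = (\<integral>\<^sup>+u. \<integral>\<^sup>+v. gauss (Pt t) (u - y t) * gauss Sw (v - A *v u) * \<phi> v \<partial>lborel \<partial>lborel)"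
      by (simp add: nn_integral_cmult[symmetric] mult.assoc)
    also have "\<dots> = (\<integral>\<^sup>+v. \<integral>\<^sup>+u. gauss (Pt t) (u - y t) * gauss Sw (v - A *v u) * \<phi> v \<partial>lborel \<partial>lborel)"
      by (rule lborel_pair.Fubini') measurable
    also have "\<dots> = (\<integral>\<^sup>+v. gauss (prior_cov Pt (Suc t)) (v - prior_mean y (Suc t)) * \<phi> v \<partial>lborel)"
      by (simp add: nn_integral_multc gaussian_convolution[OF Sw_pos_def Pt] prior_cov_def prior_mean_def)
    finally show ?case .
  qed
  show "?prior t \<phi>" by (rule prior[OF assms])
  show "?post t \<phi>" by (rule post[OF prior assms])
qed

definition output_law :: "nat \<Rightarrow> (nat \<Rightarrow> real^'p) measure" where
  "output_law n = causal_prefix output_kernel (Suc n) (\<lambda>_. undefined)"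

lemma prob_space_output_law: "prob_space (output_law n)"
  using causal_prefix_prob[OF output_kernel_causal] by (simp add: output_law_def space_prob_algebra)

lemma sets_output_law [measurable_cong]: "sets (output_law n) = sets (hist (Suc n))"
  by (simp add: output_law_def sets_causal_prefix[OF output_kernel_causal])

lemma nn_integral_test_joint:
  assumes f[measurable]: "f \<in> borel_measurable (hist_pair (Suc n))"
  shows "(\<integral>\<^sup>+q. f q \<partial>joint_law M x test_kernel n)
    = (\<integral>\<^sup>+y. \<integral>\<^sup>+\<omega>. ennreal (info_ratio (Suc n) (source_path (Suc n) \<omega>) y) * f (source_path (Suc n) \<omega>, y) \<partial>M \<partial>output_law n)"
proof -
  interpret Y: prob_space "output_law n" by (rule prob_space_output_law)
  interpret PP: pair_sigma_finite M "output_law n" ..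
  have i[measurable]: "(\<lambda>q. info_ratio (Suc n) (source_path (Suc n) (fst q)) (snd q)) \<in> borel_measurable (M \<Otimes>\<^sub>M output_law n)"
    by (rule info_ratio_measurable) measurable
  have "(\<integral>\<^sup>+q. f q \<partial>joint_law M x test_kernel n)
     = (\<integral>\<^sup>+\<omega>. \<integral>\<^sup>+y. f (source_path (Suc n) \<omega>, y) \<partial>causal_prefix test_kernel (Suc n) (source_path (Suc n) \<omega>) \<partial>M)"
    by (rule nn_integral_joint_law[OF test_kernel_causal f])
  also have "\<dots> = (\<integral>\<^sup>+\<omega>. \<integral>\<^sup>+y. ennreal (info_ratio (Suc n) (source_path (Suc n) \<omega>) y) * f (source_path (Suc n) \<omega>, y) \<partial>output_law n \<partial>M)"
  proof (rule nn_integral_cong)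
    fix \<omega> assume "\<omega> \<in> space M"
    then have u[measurable]: "source_path (Suc n) \<omega> \<in> space (hist (Suc n))"
      using measurable_space[OF source_path_measurable] by blast
    show "(\<integral>\<^sup>+y. f (source_path (Suc n) \<omega>, y) \<partial>causal_prefix test_kernel (Suc n) (source_path (Suc n) \<omega>))
        = (\<integral>\<^sup>+y. ennreal (info_ratio (Suc n) (source_path (Suc n) \<omega>) y) * f (source_path (Suc n) \<omega>, y) \<partial>output_law n)"
      unfolding output_law_def output_prefix_const[of "Suc n" "\<lambda>_. undefined" "source_path (Suc n) \<omega>"]
      by (rule nn_integral_test_prefix[OF _ u order.refl]) measurable
  qed
  also have "\<dots> = (\<integral>\<^sup>+y. \<integral>\<^sup>+\<omega>. ennreal (info_ratio (Suc n) (source_path (Suc n) \<omega>) y) * f (source_path (Suc n) \<omega>, y) \<partial>M \<partial>output_law n)"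
    by (rule PP.Fubini'[symmetric]) measurable
  finally show ?thesis .
qed

text \<open>
  The information ratio has mass \<open>1\<close> over the source for every \<open>y\<close>, so the reference law of the outputs is their true law.
\<close>

lemma distr_test_joint_snd: "distr (joint_law M x test_kernel n) (hist (Suc n)) snd = output_law n"
proof (rule measure_eqI)
  note sets_joint_law[OF test_kernel_causal, measurable_cong]
  show "sets (distr (joint_law M x test_kernel n) (hist (Suc n)) snd) = sets (output_law n)" by (simp add: sets_output_law)
  fix X assume "X \<in> sets (distr (joint_law M x test_kernel n) (hist (Suc n)) snd)"
  then have X[measurable]: "X \<in> sets (hist (Suc n))" by simp
  have "emeasure (distr (joint_law M x test_kernel n) (hist (Suc n)) snd) X = (\<integral>\<^sup>+p. indicator X (snd p) \<partial>joint_law M x test_kernel n)"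
    by (subst nn_integral_indicator[symmetric], simp, rule nn_integral_distr) simp_all
  also have "\<dots> = (\<integral>\<^sup>+y. \<integral>\<^sup>+\<omega>. ennreal (info_ratio (Suc n) (source_path (Suc n) \<omega>) y) * indicator X y \<partial>M \<partial>output_law n)"
    by (subst nn_integral_test_joint) simp_all
  also have "\<dots> = (\<integral>\<^sup>+y. indicator X y \<partial>output_law n)"
  proof (rule nn_integral_cong)
    fix y
    have "(\<integral>\<^sup>+\<omega>. ennreal (info_ratio (Suc n) (source_path (Suc n) \<omega>) y) * indicator X y \<partial>M)
        = (\<integral>\<^sup>+v. gauss (Pt n) (v - y n) * indicator X y \<partial>lborel)"
      by (rule nn_integral_info_ratio_posterior[of "\<lambda>_. indicator X y"]) simp
    also have "\<dots> = indicator X y"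
      by (simp add: nn_integral_multc nn_integral_gaussian_density_shift[OF Pt])
    finally show "(\<integral>\<^sup>+\<omega>. ennreal (info_ratio (Suc n) (source_path (Suc n) \<omega>) y) * indicator X y \<partial>M) = indicator X y" .
  qed
  also have "\<dots> = emeasure (output_law n) X" by (simp add: sets_output_law)
  finally show "emeasure (distr (joint_law M x test_kernel n) (hist (Suc n)) snd) X = emeasure (output_law n) X" .
qed

lemma test_joint_density:
  "joint_law M x test_kernel n = density (source_law M x n \<Otimes>\<^sub>M output_law n) (\<lambda>q. ennreal (info_ratio (Suc n) (fst q) (snd q)))"
proof (rule measure_eqI)
  interpret Y: prob_space "output_law n" by (rule prob_space_output_law)
  interpret S: prob_space "source_law M x n" by (rule prob_space_source_law)
  interpret PP: pair_sigma_finite "source_law M x n" "output_law n" ..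
  have s: "sets (source_law M x n \<Otimes>\<^sub>M output_law n) = sets (hist_pair (Suc n))"
    by (rule sets_pair_measure_cong) (simp_all add: sets_output_law)
  show "sets (joint_law M x test_kernel n) = sets (density (source_law M x n \<Otimes>\<^sub>M output_law n) (\<lambda>q. ennreal (info_ratio (Suc n) (fst q) (snd q))))"
    by (simp only: sets_density s sets_joint_law[OF test_kernel_causal])
  have i[measurable]: "(\<lambda>q. info_ratio (Suc n) (fst q) (snd q)) \<in> borel_measurable (source_law M x n \<Otimes>\<^sub>M output_law n)"
    by (rule info_ratio_measurable) measurable
  fix X assume "X \<in> sets (joint_law M x test_kernel n)"
  then have X[measurable]: "X \<in> sets (hist_pair (Suc n))" by (simp add: sets_joint_law[OF test_kernel_causal])
  then have X': "X \<in> sets (source_law M x n \<Otimes>\<^sub>M output_law n)" by (simp only: s)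
  have "emeasure (joint_law M x test_kernel n) X = (\<integral>\<^sup>+q. indicator X q \<partial>joint_law M x test_kernel n)"
    by (simp add: sets_joint_law[OF test_kernel_causal])
  also have "\<dots> = (\<integral>\<^sup>+y. \<integral>\<^sup>+\<omega>. ennreal (info_ratio (Suc n) (source_path (Suc n) \<omega>) y) * indicator X (source_path (Suc n) \<omega>, y) \<partial>M \<partial>output_law n)"
    by (rule nn_integral_test_joint) simp
  also have "\<dots> = (\<integral>\<^sup>+y. \<integral>\<^sup>+u. ennreal (info_ratio (Suc n) u y) * indicator X (u, y) \<partial>source_law M x n \<partial>output_law n)"
  proof (rule nn_integral_cong)
    fix y assume "y \<in> space (output_law n)"
    then have y[measurable]: "y \<in> space (hist (Suc n))" using sets_eq_imp_space_eq[OF sets_output_law] by simp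
    have [measurable]: "(\<lambda>u. info_ratio (Suc n) u y) \<in> borel_measurable (hist (Suc n))"
      by (rule info_ratio_measurable) (use y in measurable)
    show "(\<integral>\<^sup>+\<omega>. ennreal (info_ratio (Suc n) (source_path (Suc n) \<omega>) y) * indicator X (source_path (Suc n) \<omega>, y) \<partial>M)
       = (\<integral>\<^sup>+u. ennreal (info_ratio (Suc n) u y) * indicator X (u, y) \<partial>source_law M x n)"
      by (subst nn_integral_source_law) simp_all
  qed
  also have "\<dots> = (\<integral>\<^sup>+q. ennreal (info_ratio (Suc n) (fst q) (snd q)) * indicator X q \<partial>(source_law M x n \<Otimes>\<^sub>M output_law n))"
    using X' by (subst PP.nn_integral_snd[symmetric]) simp_all
  also have "\<dots> = emeasure (density (source_law M x n \<Otimes>\<^sub>M output_law n) (\<lambda>q. ennreal (info_ratio (Suc n) (fst q) (snd q)))) X"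
    using X' by (simp add: emeasure_density)
  finally show "emeasure (joint_law M x test_kernel n) X
     = emeasure (density (source_law M x n \<Otimes>\<^sub>M output_law n) (\<lambda>q. ennreal (info_ratio (Suc n) (fst q) (snd q)))) X" .
qed

lemma test_error_quadratic:
  assumes tn: "t \<le> n" and V: "pos_semidef V"
  shows "(\<integral>\<^sup>+q. ennreal (quad V (fst q t - snd q t)) \<partial>joint_law M x test_kernel n) = ennreal (V \<bullet> Pt t)"
proof -
  have c: "(\<lambda>u. u t) \<in> hist (Suc t) \<rightarrow>\<^sub>M (borel :: (real^'p) measure)" by (rule measurable_hist_component) simp
  interpret Y: prob_space "output_law t" by (rule prob_space_output_law)
  let ?f = "\<lambda>q. ennreal (quad V (fst q t - snd q t))"
  have f: "?f \<in> borel_measurable (hist_pair (Suc t))"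
  proof -
    note c[measurable]
    show ?thesis by measurable
  qed
  have tr: "truncate_pair (Suc t) \<in> joint_law M x test_kernel n \<rightarrow>\<^sub>M hist_pair (Suc t)"
    using truncate_pair_measurable[of "Suc t" "Suc n"] tn
    by (simp cong: measurable_cong_sets add: sets_joint_law[OF test_kernel_causal])
  have "(\<integral>\<^sup>+q. ?f q \<partial>joint_law M x test_kernel n) = (\<integral>\<^sup>+q. ?f (truncate_pair (Suc t) q) \<partial>joint_law M x test_kernel n)"
    by (intro nn_integral_cong) (simp add: truncate_pair_def)
  also have "\<dots> = (\<integral>\<^sup>+q. ?f q \<partial>joint_law M x test_kernel t)"
    unfolding distr_joint_law_truncate[OF test_kernel_causal tn, symmetric]
    by (rule nn_integral_distr[symmetric, OF tr]) (use f in simp)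
  also have "\<dots> = (\<integral>\<^sup>+y. \<integral>\<^sup>+\<omega>. ennreal (info_ratio (Suc t) (source_path (Suc t) \<omega>) y) * ennreal (quad V (x t \<omega> - y t)) \<partial>M \<partial>output_law t)"
    by (subst nn_integral_test_joint[OF f]) (simp add: source_path_nth)
  also have "\<dots> = (\<integral>\<^sup>+y. ennreal (V \<bullet> Pt t) \<partial>output_law t)"
  proof (rule nn_integral_cong)
    fix y :: "nat \<Rightarrow> real^'p"
    have "(\<integral>\<^sup>+\<omega>. ennreal (info_ratio (Suc t) (source_path (Suc t) \<omega>) y) * ennreal (quad V (x t \<omega> - y t)) \<partial>M)
      = (\<integral>\<^sup>+v. gauss (Pt t) (v - y t) * ennreal (quad V (v - y t)) \<partial>lborel)"
      by (rule nn_integral_info_ratio_posterior) measurable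
    also have "\<dots> = (\<integral>\<^sup>+v. gauss (Pt t) v * ennreal (quad V v) \<partial>lborel)"
      using nn_integral_lborel_translate[of "\<lambda>v. gauss (Pt t) v * ennreal (quad V v)" "- y t"] by simp
    also have "\<dots> = ennreal (V \<bullet> Pt t)"
      using nn_integral_gaussian_quadratic[OF Pt V, of t] Pt[of t] by (simp add: trace_mult_symmetric pos_def_def)
    finally show "(\<integral>\<^sup>+\<omega>. ennreal (info_ratio (Suc t) (source_path (Suc t) \<omega>) y) * ennreal (quad V (x t \<omega> - y t)) \<partial>M) = ennreal (V \<bullet> Pt t)" .
  qed
  also have "\<dots> = ennreal (V \<bullet> Pt t)" by (simp add: Y.emeasure_space_1)
  finally show ?thesis .
qed

lemma test_kernel_admissible:
  assumes "\<And>t. trace (Pt t) \<le> D"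
  shows "test_kernel \<in> srd_admissible M x n D"
proof -
  have I: "pos_semidef (mat 1 :: real^'p^'p)" by (simp add: pos_semidef_def)
  have tr: "mat 1 \<bullet> Pt t = trace (Pt t)" for t
    using Pt[of t] trace_mult_symmetric[of "Pt t" "mat 1"] by (simp add: pos_def_def)
  show ?thesis
    unfolding srd_admissible_def
  proof (intro CollectI conjI allI impI test_kernel_causal)
    fix t assume "t \<le> n"
    from test_error_quadratic[OF this I] show "(\<integral>\<^sup>+(u, y). ennreal ((norm (u t - y t))\<^sup>2) \<partial>joint_law M x test_kernel n) \<le> ennreal D"
      using assms[of t] by (simp add: case_prod_unfold power2_norm_eq_inner tr ennreal_leI)
  qed
qed

text \<open>
  The logarithm of the information ratio is a sum of differences of Gaussian log-densities.  Each of the two quadratic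
  forms in a summand has expectation \<open>p\<close>, so only the determinants survive.
\<close>

theorem test_channel_information:
  assumes b: "1 < b"
  shows "causal_information b test_kernel n
     = ereal ((\<Sum>t<Suc n. (ln (det (prior_cov Pt t)) - ln (det (Pt t))) / 2) / ln b)"
proof -
  define J where "J = joint_law M x test_kernel n"
  define prd where "prd = source_law M x n \<Otimes>\<^sub>M output_law n"
  define h where "h = (\<lambda>q. info_ratio (Suc n) (fst q) (snd q))"
  define p where "p = real CARD('p)"
  note K = test_kernel_causal
  interpret J: prob_space J unfolding J_def by (rule prob_space_joint_law[OF K])
  have sJ[measurable_cong]: "sets J = sets (hist_pair (Suc n))" unfolding J_def by (rule sets_joint_law[OF K])
  interpret Y: prob_space "output_law n" by (rule prob_space_output_law)
  interpret S: prob_space "source_law M x n" by (rule prob_space_source_law)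
  have sprd[measurable_cong]: "sets prd = sets (hist_pair (Suc n))"
    unfolding prd_def by (rule sets_pair_measure_cong) (simp_all add: sets_output_law)
  have h_meas[measurable]: "h \<in> borel_measurable prd"
    unfolding h_def by (rule info_ratio_measurable) measurable
  have h_measJ[measurable]: "h \<in> borel_measurable J"
    unfolding h_def by (rule info_ratio_measurable) measurable
  have J: "J = density prd (\<lambda>q. ennreal (h q))" unfolding J_def prd_def h_def by (rule test_joint_density)
  have ac: "absolutely_continuous prd J" unfolding J by (rule absolutely_continuousI_density) measurable
  have "AE q in prd. ennreal (h q) = RN_deriv prd J q"
    by (rule RN_deriv_unique_sigma_finite[OF _ J[symmetric] J.sigma_finite_measure_axioms]) measurable
  then have "AE q in J. ennreal (h q) = RN_deriv prd J q"
    by (rule absolutely_continuous_AE[OF _ ac, rotated]) (simp add: sJ sprd)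
  then have ae: "AE q in J. entropy_density b prd J q = ln (h q) / ln b"
    by eventually_elim
       (simp add: entropy_density_def log_def[symmetric], metis enn2real_ennreal h_def info_ratio_pos less_imp_le log_def)
  define e where "e = (\<lambda>t (q :: (nat \<Rightarrow> real^'p) \<times> (nat \<Rightarrow> real^'p)). fst q t - snd q t)"
  define v where "v = (\<lambda>t (q :: (nat \<Rightarrow> real^'p) \<times> (nat \<Rightarrow> real^'p)). fst q t - prior_mean (snd q) t)"
  define wn where "wn = (\<lambda>t (q :: (nat \<Rightarrow> real^'p) \<times> (nat \<Rightarrow> real^'p)). fst q (Suc t) - A *v fst q t)"
  have v_Suc: "v (Suc t) q = A *v e t q + wn t q" for t q
    by (simp add: v_def e_def wn_def prior_mean_def matrix_vector_mult_diff_distrib)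
  have comp: "(\<lambda>u. u t) \<in> hist (Suc n) \<rightarrow>\<^sub>M (borel :: (real^'p) measure)" if "t \<le> n" for t
    using that by (auto intro!: measurable_hist_component)
  have e_meas: "e t \<in> borel_measurable J" if "t \<le> n" for t
  proof -
    note comp[OF that, measurable]
    show ?thesis unfolding e_def by measurable
  qed
  have v_meas: "v t \<in> borel_measurable J" if "t \<le> n" for t
  proof -
    have [measurable]: "(\<lambda>y. prior_mean y t) \<in> borel_measurable (hist (Suc n))" using that by (intro prior_mean_measurable) simp
    note comp[OF that, measurable]
    show ?thesis unfolding v_def by measurable
  qed
  have wn_meas: "wn t \<in> borel_measurable J" if "t < n" for t
    unfolding wn_def J_def by (rule noise_measurable_joint[OF K that])
  have I: "pos_semidef (mat 1 :: real^'p^'p)" by (simp add: pos_semidef_def)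
  have e_int: "integrable J (\<lambda>q. (norm (e t q))\<^sup>2)" if "t \<le> n" for t
    using test_error_quadratic[OF that I] e_meas[OF that]
    by (intro integrableI_nonneg) (simp_all add: J_def e_def power2_norm_eq_inner)
  have eq: "(\<integral>q. quad V (e t q) \<partial>J) = V \<bullet> Pt t" if tn: "t \<le> n" and V: "pos_semidef V" and nn: "0 \<le> V \<bullet> Pt t" for t V
  proof -
    have i: "integrable J (\<lambda>q. quad V (e t q))"
      by (rule integrable_inner_matrix[OF e_meas[OF tn] e_meas[OF tn] e_int[OF tn] e_int[OF tn]])
    have "ennreal (\<integral>q. quad V (e t q) \<partial>J) = (\<integral>\<^sup>+q. ennreal (quad V (e t q)) \<partial>J)"
      by (rule nn_integral_eq_integral[symmetric, OF i]) (use V in \<open>simp add: pos_semidef_def\<close>)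
    also have "\<dots> = ennreal (V \<bullet> Pt t)" unfolding J_def e_def by (rule test_error_quadratic[OF tn V])
    finally show ?thesis using nn V by (subst (asm) ennreal_inj) (auto simp: pos_semidef_def intro!: integral_nonneg_AE)
  qed
  have wn_int: "integrable J (\<lambda>q. (norm (wn t q))\<^sup>2)" if "t < n" for t
    unfolding wn_def J_def by (rule noise_integrable_joint[OF K that])
  have v_int: "integrable J (\<lambda>q. (norm (v t q))\<^sup>2)" if tn: "t \<le> n" for t
  proof (cases t)
    case 0
    then show ?thesis using state_integrable_joint[OF K, of 0 n] by (simp add: v_def J_def prior_mean_def)
  next
    case (Suc s)
    then show ?thesis using tn unfolding Suc v_Suc
      by (intro integrable_norm_square_add integrable_norm_square_matrix e_int wn_int e_meas wn_meas borel_measurable_matrix_vector) auto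
  qed
  have inv_inner: "matrix_inv S' \<bullet> S' = p" if "pos_def S'" for S' :: "real^'p^'p"
    using that by (simp add: trace_mult_symmetric[symmetric] pos_def_def pos_def_matrix_inv[OF that] trace_I p_def)
  have inner_nonneg: "0 \<le> V \<bullet> S'" if V: "pos_semidef V" and S': "pos_def S'" for V S' :: "real^'p^'p"
  proof -
    obtain B :: "real^'p^'p" where B: "S' = B ** transpose B" by (rule pos_def_factor[OF S'])
    show ?thesis using V unfolding B outer_columns
      by (simp add: inner_sum_right inner_outer pos_semidef_def sum_nonneg)
  qed
  have vq: "(\<integral>q. quad (matrix_inv (prior_cov Pt t)) (v t q) \<partial>J) = p" if tn: "t \<le> n" for t
  proof (cases t)
    case 0
    have "(\<integral>q. quad (matrix_inv S0) (v 0 q) \<partial>J) = (\<integral>z. quad (matrix_inv S0) z \<partial>normal_law S0)"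
      unfolding J_def using init_integral_joint[OF K, of "\<lambda>z. quad (matrix_inv S0) z" n] by (simp add: v_def prior_mean_def)
    also have "\<dots> = trace (matrix_inv S0 ** S0)"
      using has_bochner_integral_normal_law_quadratic[OF S0_pos_def pos_def_imp_pos_semidef[OF pos_def_matrix_inv(3)[OF S0_pos_def]]]
      by (simp add: has_bochner_integral_iff)
    also have "\<dots> = p" by (simp add: pos_def_matrix_inv[OF S0_pos_def] trace_I p_def)
    finally show ?thesis by (simp add: 0 prior_cov_def)
  next
    case (Suc s)
    have sn: "s < n" "s \<le> n" using tn Suc by auto
    define V where "V = matrix_inv (prior_cov Pt t)"
    have Vp: "pos_def V" unfolding V_def by (rule pos_def_matrix_inv(3)[OF prior_cov_pos_def])
    then have Vs: "transpose V = V" and V: "pos_semidef V" by (simp_all add: pos_def_def pos_def_imp_pos_semidef)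
    have AVA: "pos_semidef (transpose A ** V ** A)"
      unfolding pos_semidef_def
    proof (intro conjI allI)
      show "transpose (transpose A ** V ** A) = transpose A ** V ** A" by (simp add: matrix_transpose_mul matrix_mul_assoc Vs)
      show "0 \<le> quad (transpose A ** V ** A) z" for z
        using V congruence_quadratic[of z "transpose A" V] by (simp only: transpose_transpose pos_semidef_def)
    qed
    have split: "(\<integral>q. quad V (A *v e s q + mat 1 *v wn s q) \<partial>J) = (\<integral>q. quad V (A *v e s q) \<partial>J) + (transpose (mat 1) ** V ** mat 1) \<bullet> Sw"
      unfolding J_def wn_def
    proof (rule quadratic_noise_split(2)[OF K sn(1) V])
      show "e s (truncate_pair (Suc s) q) = e s q" for q by (simp add: e_def truncate_pair_def)
      have [measurable]: "(\<lambda>u. u s) \<in> hist (Suc s) \<rightarrow>\<^sub>M (borel :: (real^'p) measure)" by (rule measurable_hist_component) simp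
      show "e s \<in> borel_measurable (hist_pair (Suc s))" unfolding e_def by measurable
      show "integrable (joint_law M x test_kernel n) (\<lambda>q. (norm (e s q))\<^sup>2)" using e_int[OF sn(2)] by (simp add: J_def)
    qed
    have AV: "quad V (A *v e s q) = quad (transpose A ** V ** A) (e s q)" for q
      using congruence_quadratic[of "e s q" "transpose A" V] by (simp only: transpose_transpose)
    have Ps: "transpose (Pt s) = Pt s" using Pt by (simp add: pos_def_def)
    have "(\<integral>q. quad V (v t q) \<partial>J) = (transpose A ** V ** A) \<bullet> Pt s + V \<bullet> Sw"
      using split eq[OF sn(2) AVA inner_nonneg[OF AVA Pt]] by (simp add: Suc v_Suc AV)
    also have "\<dots> = V \<bullet> prior_cov Pt t"
      by (simp add: Suc prior_cov_def inner_right_distrib inner_congruence[OF Ps])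
    also have "\<dots> = p" unfolding V_def by (rule inv_inner[OF prior_cov_pos_def])
    finally show ?thesis by (simp only: V_def)
  qed
  note lg = integrable_ln_gaussian[OF _ J.prob_space_axioms]
  have ln_h: "ln (h q) = (\<Sum>t<Suc n. ln (gaussian_density (Pt t) (e t q)) - ln (gaussian_density (prior_cov Pt t) (v t q)))" for q
  proof -
    have "ln (h q) = (\<Sum>t<Suc n. ln (gain_ratio t (fst q) (snd q) (snd q t)))"
      unfolding h_def info_ratio_def by (rule ln_prod) (simp, rule less_imp_neq[OF gain_ratio_pos, symmetric])
    also have "\<dots> = (\<Sum>t<Suc n. ln (gaussian_density (Pt t) (e t q)) - ln (gaussian_density (prior_cov Pt t) (v t q)))"
      by (intro sum.cong refl)
         (simp add: gain_ratio_def e_def v_def ln_div less_imp_neq[OF gaussian_density_pos[OF Pt], symmetric]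
           less_imp_neq[OF gaussian_density_pos[OF prior_cov_pos_def], symmetric])
    finally show ?thesis .
  qed
  have i1: "integrable J (\<lambda>q. ln (gaussian_density (Pt t) (e t q)) - ln (gaussian_density (prior_cov Pt t) (v t q)))" if "t \<le> n" for t
    using lg(1)[OF Pt e_meas[OF that] e_int[OF that]] lg(1)[OF prior_cov_pos_def v_meas[OF that] v_int[OF that]] by simp
  have stage: "(\<integral>q. ln (gaussian_density (Pt t) (e t q)) - ln (gaussian_density (prior_cov Pt t) (v t q)) \<partial>J)
      = (ln (det (prior_cov Pt t)) - ln (det (Pt t))) / 2" if "t \<le> n" for t
  proof -
    have "(\<integral>q. quad (matrix_inv (Pt t)) (e t q) \<partial>J) = p"
      using eq[OF that pos_def_imp_pos_semidef[OF pos_def_matrix_inv(3)[OF Pt]], of t] inv_inner[OF Pt] by (simp add: p_def)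
    then show ?thesis
      using vq[OF that] lg[OF Pt e_meas[OF that] e_int[OF that], of t] lg[OF prior_cov_pos_def v_meas[OF that] v_int[OF that], of t]
      by (simp add: field_simps)
  qed
  have int_h: "integrable J (\<lambda>q. ln (h q))"
    unfolding ln_h by (rule Bochner_Integration.integrable_sum) (rule i1, simp)
  have "(\<integral>q. ln (h q) \<partial>J) = (\<Sum>t<Suc n. \<integral>q. ln (gaussian_density (Pt t) (e t q)) - ln (gaussian_density (prior_cov Pt t) (v t q)) \<partial>J)"
    unfolding ln_h by (rule Bochner_Integration.integral_sum) (rule i1, simp)
  also have "\<dots> = (\<Sum>t<Suc n. (ln (det (prior_cov Pt t)) - ln (det (Pt t))) / 2)"
    by (intro sum.cong refl stage) simp
  finally have val: "(\<integral>q. ln (h q) \<partial>J) = (\<Sum>t<Suc n. (ln (det (prior_cov Pt t)) - ln (det (Pt t))) / 2)" .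
  have ed_meas[measurable]: "entropy_density b prd J \<in> borel_measurable J"
    using measurable_entropy_density[of b prd J] by (simp add: measurable_cong_sets[OF trans[OF sJ sprd[symmetric]] refl])
  have "integrable J (entropy_density b prd J)"
    using int_h by (subst integrable_cong_AE[OF _ _ ae]) auto
  moreover have "KL_divergence b prd J = (\<integral>q. ln (h q) / ln b \<partial>J)"
    unfolding KL_divergence_def by (rule integral_cong_AE[OF _ _ ae]) measurable
  moreover have "(\<integral>q. ln (h q) / ln b \<partial>J) = (\<integral>q. ln (h q) \<partial>J) / ln b" by simp
  ultimately show ?thesis
    using ext_mutual_information_joint[OF K, of b n] ac val distr_test_joint_snd[of n]
    by (simp add: J_def[symmetric] prd_def[symmetric])
qed

end

end

section \<open>The upper bound\<close>

lemma pos_def_scaleR: "0 < c \<Longrightarrow> pos_def S \<Longrightarrow> pos_def (c *\<^sub>R S)"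
  by (simp add: pos_def_def transpose_scalar scaleR_quadratic)

lemma pos_def_dominates:
  fixes S P :: "real^'n^'n"
  assumes S: "pos_def S"
  obtains c where "0 < c" "c \<le> 1" "\<And>v. c * quad P v \<le> quad S v / 2"
proof -
  obtain m where m: "0 < m" "\<And>v. m * (norm v)\<^sup>2 \<le> quad S v" using pos_def_coercive[OF S] by blast
  define k where "k = \<bar>onorm ((*v) P)\<bar> + 1"
  have k: "0 < k" by (simp add: k_def)
  define c where "c = min 1 (m / (2 * k))"
  have c: "0 < c" "c \<le> 1" "c * k \<le> m / 2" using m k by (auto simp: c_def min_def field_simps)
  have "c * quad P v \<le> quad S v / 2" for v
  proof -
    have "quad P v \<le> onorm ((*v) P) * (norm v)\<^sup>2" by (rule quadratic_le_norm)
    also have "\<dots> \<le> k * (norm v)\<^sup>2" by (intro mult_right_mono) (auto simp: k_def)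
    finally have "c * quad P v \<le> c * (k * (norm v)\<^sup>2)" using c by (intro mult_left_mono) auto
    also have "\<dots> = (c * k) * (norm v)\<^sup>2" by simp
    also have "\<dots> \<le> m / 2 * (norm v)\<^sup>2" using c by (intro mult_right_mono) auto
    also have "\<dots> \<le> quad S v / 2" using m(2)[of v] by simp
    finally show ?thesis .
  qed
  with c that show ?thesis by blast
qed

context gauss_markov
begin

text \<open>
  The test channel needs \<open>prior_cov - Pt\<close> definite at every time, but at the optimum \<open>A P A\<^sup>T + W - P\<close> may be singular.
  Therefore the error covariances are \<open>c\<^sub>t P\<close> with \<open>c\<^sub>t < 1\<close>: the start \<open>c\<^sub>0\<close> is small enough for \<open>S0\<close>, and \<open>c\<^sub>t\<close>
  increases to \<open>1\<close> so slowly that the noise \<open>W\<close> always leaves room.  Since \<open>1 - c\<^sub>t\<close> decays geometrically, the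
  excess over the limit rate has a bounded sum.
\<close>

theorem information_upper_bound:
  fixes P Q :: "real^'p^'p" and D b :: real
  assumes b: "1 < b" and P: "pos_def P" and Q: "pos_def Q" and F: "relaxed_feasible (transpose A) Sw D P Q"
  shows "\<exists>C. \<forall>n. \<exists>K \<in> srd_admissible M x n D.
     causal_information b K n
       \<le> ereal ((real n * ((ln (det Sw) - ln (det Q)) / 2) + C) / ln b)"
proof -
  obtain c0' where c0': "0 < c0'" "c0' \<le> 1" "\<And>v. c0' * quad P v \<le> quad S0 v / 2"
    by (rule pos_def_dominates[OF S0_pos_def, of P]) (rule that)
  obtain \<delta>' where \<delta>': "0 < \<delta>'" "\<delta>' \<le> 1" "\<And>v. \<delta>' * quad P v \<le> quad Sw v / 2"
    by (rule pos_def_dominates[OF Sw_pos_def, of P]) (rule that)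
  \<comment> \<open>halving makes the bounds strict: \<open>\<delta> < 1\<close>, and likewise \<open>c0 < 1\<close> below\<close>
  define \<delta> where "\<delta> = \<delta>' / 2"
  have Ps: "transpose P = P" using P by (simp add: pos_def_def)
  have Pq: "v \<noteq> 0 \<Longrightarrow> 0 < quad P v" "0 \<le> quad P v" for v
    using P pos_def_imp_pos_semidef[OF P] by (auto simp: pos_def_def pos_semidef_def)
  have \<delta>: "0 < \<delta>" "\<delta> < 1" "\<delta> * quad P v \<le> quad Sw v / 2" for v
  proof -
    have "\<delta> * quad P v \<le> \<delta>' * quad P v"
      using \<delta>' Pq(2)[of v] by (intro mult_right_mono) (auto simp: \<delta>_def)
    then show "\<delta> * quad P v \<le> quad Sw v / 2" using \<delta>'(3)[of v] by simp
  qed (use \<delta>' in \<open>simp_all add: \<delta>_def\<close>)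
  define c0 where "c0 = c0' / 2"
  have c0: "0 < c0" "c0 < 1" using c0' by (simp_all add: c0_def)
  define c where "c = (\<lambda>t::nat. 1 - (1 - c0) * (1 - \<delta>) ^ t)"
  define Pt where "Pt = (\<lambda>t. c t *\<^sub>R P)"
  have pw: "0 \<le> (1 - \<delta>) ^ t" "(1 - \<delta>) ^ t \<le> 1" for t using \<delta> by (auto intro: power_le_one)
  have c_ge: "c0 \<le> c t" for t
  proof -
    have "(1 - c0) * (1 - \<delta>) ^ t \<le> (1 - c0) * 1" using c0 pw by (intro mult_left_mono) auto
    then show ?thesis by (simp add: c_def)
  qed
  have c_le: "c t \<le> 1" for t using c0 pw[of t] by (simp add: c_def)
  have c_pos: "0 < c t" for t using c_ge[of t] c0 by simp
  have c_step: "c (Suc t) - c t = \<delta> * (1 - c t)" for t by (simp add: c_def algebra_simps)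
  have Pt_pd: "pos_def (Pt t)" for t unfolding Pt_def by (rule pos_def_scaleR[OF c_pos P])
  have gap: "quad P v \<le> quad P (transpose A *v v) + quad Sw v" for v
    using F by (auto simp: relaxed_feasible_def gap_form_def)
  have Swq: "v \<noteq> 0 \<Longrightarrow> 0 < quad Sw v" for v using Sw_pos_def by (simp add: pos_def_def)
  have Rt_pd: "pos_def (prior_cov Pt t - Pt t)" for t
  proof (cases t)
    case 0
    have "0 < quad (S0 - c0 *\<^sub>R P) v" if v: "v \<noteq> 0" for v
    proof -
      have "c0 * quad P v < c0' * quad P v" using Pq(1)[OF v] c0' by (simp add: c0_def)
      also have "\<dots> \<le> quad S0 v / 2" by (rule c0'(3))
      also have "\<dots> \<le> quad S0 v" using S0_pos_def v by (auto simp: pos_def_def less_imp_le)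
      finally show ?thesis by (simp add: matrix_vector_mult_diff_rdistrib inner_diff_right scaleR_quadratic)
    qed
    then show ?thesis using S0_pos_def
      by (simp add: 0 prior_cov_def Pt_def c_def pos_def_def transpose_diff transpose_scalar Ps)
  next
    case (Suc s)
    have t: "transpose (prior_cov Pt t - Pt t) = prior_cov Pt t - Pt t"
      using Sw_pos_def by (simp add: Suc prior_cov_def Pt_def pos_def_def transpose_diff transpose_add transpose_scalar
          matrix_transpose_mul matrix_mul_assoc Ps)
    have "0 < quad (prior_cov Pt t - Pt t) v" if v: "v \<noteq> 0" for v
    proof -
      define a where "a = quad P v"
      define a' where "a' = quad P (transpose A *v v)"
      define s' where "s' = quad Sw v"
      have "quad (prior_cov Pt t - Pt t) v = c s * a' + s' - c (Suc s) * a"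
        by (simp only: Suc prior_cov_def nat.case Pt_def matrix_vector_mult_diff_rdistrib matrix_vector_mult_add_rdistrib
            inner_diff_right inner_right_distrib congruence_quadratic scaleR_quadratic a_def a'_def s'_def)
      moreover have "c s * (a - s') \<le> c s * a'" using gap[of v] c_pos[of s] by (intro mult_left_mono) (auto simp: a_def a'_def s'_def)
      moreover have "c (Suc s) * a = c s * a + (1 - c s) * (\<delta> * a)"
      proof -
        have cs: "c (Suc s) = c s + \<delta> * (1 - c s)" using c_step[of s] by linarith
        show ?thesis unfolding cs by (simp add: algebra_simps)
      qed
      moreover have "(1 - c s) * (\<delta> * a) \<le> (1 - c s) * (s' / 2)" using \<delta>(3)[of v] c_le[of s] by (intro mult_left_mono) (auto simp: a_def s'_def)
      moreover have "0 < (1 - c s) * (s' / 2)"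
      proof -
        have "c s < 1" using c0 \<delta>(2) by (simp add: c_def)
        then show ?thesis using Swq[OF v] by (simp add: s'_def)
      qed
      moreover have "c s * (a - s') = c s * a - c s * s'" by (simp add: right_diff_distrib)
      moreover have "(1 - c s) * (s' / 2) = s' / 2 - c s * s' / 2" by (simp add: field_simps)
      ultimately show ?thesis by linarith
    qed
    then show ?thesis using t by (simp add: pos_def_def)
  qed
  define p where "p = real CARD('p)"
  define \<kappa> where "\<kappa> = (ln (det Sw) - ln (det Q)) / 2"
  have det_Pt: "ln (det (Pt t)) = p * ln (c t) + ln (det P)" for t
  proof -
    have "Pt t = diag (\<lambda>_. c t) ** P"
      by (simp add: Pt_def vec_eq_iff diag_def matrix_matrix_mult_def if_distrib[where f="\<lambda>x. x * _"] cong: if_cong)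
    then have "det (Pt t) = c t ^ CARD('p) * det P" by (simp add: det_mul det_diag)
    then show ?thesis
      using c_pos[of t] pos_def_det_pos[OF P] by (simp add: ln_mult ln_realpow p_def)
  qed
  have neg_ln: "- ln (c t) \<le> (1 - \<delta>) ^ t / c0" for t
  proof -
    have "- ln (c t) = ln (1 / c t)" using c_pos[of t] by (simp add: ln_div)
    also have "\<dots> \<le> 1 / c t - 1" using c_pos[of t] by (intro ln_le_minus_one) simp
    also have "\<dots> = (1 - c t) / c t" using c_pos[of t] by (simp add: field_simps)
    also have "\<dots> \<le> (1 - \<delta>) ^ t / c0"
    proof (rule frac_le)
      show "1 - c t \<le> (1 - \<delta>) ^ t"
        using c0 pw(1)[of t] mult_right_mono[of "1 - c0" 1 "(1 - \<delta>) ^ t"] by (simp add: c_def)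
    qed (use pw[of t] c0 c_ge[of t] in auto)
    finally show ?thesis .
  qed
  let ?T = "A ** P ** transpose A + Sw" and ?Z = "smooth_cov A Sw P"
  \<comment> \<open>\<open>c\<^sub>t \<le> 1\<close> puts the prior below \<open>T = A P A\<^sup>T + W\<close>, and \<open>det Z det T = det P det W\<close> with \<open>Q \<preceq> Z\<close>\<close>
  have prior_Suc: "ln (det (prior_cov Pt (Suc s))) \<le> ln (det Sw) - ln (det Q) + ln (det P)" for s
  proof -
    have pd: "pos_def (prior_cov Pt (Suc s))"
      using Pt_pd[of s] by (simp add: prior_cov_def pos_def_predict pos_def_imp_pos_semidef Sw_pos_def)
    have "det (prior_cov Pt (Suc s)) \<le> det ?T"
    proof (rule det_mono[OF pd])
      show "transpose ?T = ?T" using smooth_cov_inv(6)[OF Sw_pos_def P, of A] by (simp add: pos_def_def)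
      fix v
      have "c s * quad P (transpose A *v v) \<le> 1 * quad P (transpose A *v v)"
        by (rule mult_right_mono[OF c_le Pq(2)])
      then show "quad (prior_cov Pt (Suc s)) v \<le> quad ?T v"
        by (simp only: prior_cov_def nat.case Pt_def matrix_vector_mult_add_rdistrib inner_right_distrib congruence_quadratic scaleR_quadratic)
    qed
    then have 1: "ln (det (prior_cov Pt (Suc s))) \<le> ln (det ?T)"
      using pos_def_det_pos[OF pd] by simp
    have Zp: "0 < det ?Z" and Tp: "0 < det ?T"
      using pos_def_det_pos[OF smooth_cov_inv(2)[OF Sw_pos_def P, of A]] pos_def_det_pos[OF smooth_cov_inv(6)[OF Sw_pos_def P, of A]] by auto
    have "ln (det ?Z * det ?T) = ln (det P * det Sw)" by (simp only: det_smooth_cov[OF Sw_pos_def P])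
    then have 2: "ln (det ?Z) + ln (det ?T) = ln (det P) + ln (det Sw)"
      using Zp Tp pos_def_det_pos[OF P] pos_def_det_pos[OF Sw_pos_def] by (simp add: ln_mult)
    have "det Q \<le> det ?Z"
    proof (rule det_mono[OF Q])
      show "transpose ?Z = ?Z" using smooth_cov_inv(2)[OF Sw_pos_def P, of A] by (simp add: pos_def_def)
      show "quad Q v \<le> quad ?Z v" for v
        by (rule smooth_cov_upper[OF Sw_pos_def P]) (use F in \<open>simp add: relaxed_feasible_def schur_form_def\<close>)
    qed
    then have "ln (det Q) \<le> ln (det ?Z)" using pos_def_det_pos[OF Q] by simp
    then show ?thesis using 1 2 by simp
  qed
  have stage: "(ln (det (prior_cov Pt (Suc s))) - ln (det (Pt s))) / 2 \<le> \<kappa> + p / (2 * c0) * (1 - \<delta>) ^ s" for s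
  proof -
    define y where "y = p * ((1 - \<delta>) ^ s / c0)"
    have "p * - ln (c s) \<le> y" unfolding y_def by (intro mult_left_mono neg_ln) (simp add: p_def)
    then have "ln (det (prior_cov Pt (Suc s))) - ln (det (Pt s)) \<le> ln (det Sw) - ln (det Q) + y"
      using prior_Suc[of s] by (simp add: det_Pt)
    then have "(ln (det (prior_cov Pt (Suc s))) - ln (det (Pt s))) / 2
        \<le> (ln (det Sw) - ln (det Q) + p * ((1 - \<delta>) ^ s / c0)) / 2"
      unfolding y_def by (intro divide_right_mono) simp_all
    also have "\<dots> = \<kappa> + p / (2 * c0) * (1 - \<delta>) ^ s" using c0 by (simp add: \<kappa>_def field_simps)
    finally show ?thesis .
  qed
  define C where "C = (ln (det S0) + p / c0 - ln (det P)) / 2 + p / (2 * c0) / \<delta>"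
  have total: "(\<Sum>t<Suc n. (ln (det (prior_cov Pt t)) - ln (det (Pt t))) / 2) \<le> real n * \<kappa> + C" for n
  proof -
    have "(\<Sum>t<Suc n. (ln (det (prior_cov Pt t)) - ln (det (Pt t))) / 2)
        = (\<Sum>t<Suc n. ln (det (prior_cov Pt t)) / 2) - (\<Sum>t<Suc n. ln (det (Pt t)) / 2)"
      by (simp add: sum_subtractf diff_divide_distrib)
    also have "\<dots> = (ln (det (prior_cov Pt 0)) / 2 + (\<Sum>s<n. ln (det (prior_cov Pt (Suc s))) / 2)) - ((\<Sum>s<n. ln (det (Pt s)) / 2) + ln (det (Pt n)) / 2)"
      by (simp only: sum.lessThan_Suc_shift[of "\<lambda>t. ln (det (prior_cov Pt t)) / 2"] sum.lessThan_Suc[of "\<lambda>t. ln (det (Pt t)) / 2"])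
    also have "\<dots> = (ln (det S0) - ln (det (Pt n))) / 2 + (\<Sum>s<n. (ln (det (prior_cov Pt (Suc s))) - ln (det (Pt s))) / 2)"
      by (simp add: prior_cov_def sum_subtractf diff_divide_distrib)
    also have "\<dots> \<le> (ln (det S0) + p / c0 - ln (det P)) / 2 + (\<Sum>s<n. \<kappa> + p / (2 * c0) * (1 - \<delta>) ^ s)"
    proof (intro add_mono sum_mono stage)
      have "- ln (c n) \<le> 1 / c0"
        using neg_ln[of n] divide_right_mono[OF pw(2)[of n], of c0] c0 by simp
      then have "p * - ln (c n) \<le> p * (1 / c0)" by (intro mult_left_mono) (simp_all add: p_def)
      then have "ln (det S0) - ln (det (Pt n)) \<le> ln (det S0) + p / c0 - ln (det P)" by (simp add: det_Pt)
      then show "(ln (det S0) - ln (det (Pt n))) / 2 \<le> (ln (det S0) + p / c0 - ln (det P)) / 2"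
        by (intro divide_right_mono) simp_all
    qed
    also have "(\<Sum>s<n. \<kappa> + p / (2 * c0) * (1 - \<delta>) ^ s) = real n * \<kappa> + p / (2 * c0) * (\<Sum>s<n. (1 - \<delta>) ^ s)"
      by (simp add: sum.distrib sum_distrib_left)
    finally have 1: "(\<Sum>t<Suc n. (ln (det (prior_cov Pt t)) - ln (det (Pt t))) / 2)
        \<le> (ln (det S0) + p / c0 - ln (det P)) / 2 + (real n * \<kappa> + p / (2 * c0) * (\<Sum>s<n. (1 - \<delta>) ^ s))" .
    have "(\<Sum>s<n. (1 - \<delta>) ^ s) \<le> 1 / \<delta>"
    proof -
      have "1 - (1 - \<delta>) ^ n = \<delta> * (\<Sum>s<n. (1 - \<delta>) ^ s)" using one_diff_power_eq[of "1 - \<delta>" n] by simp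
      then have "\<delta> * (\<Sum>s<n. (1 - \<delta>) ^ s) \<le> 1" using pw(1)[of n] by linarith
      then show ?thesis using \<delta>(1) by (simp add: field_simps)
    qed
    then have "p / (2 * c0) * (\<Sum>s<n. (1 - \<delta>) ^ s) \<le> p / (2 * c0) * (1 / \<delta>)"
      using c0 by (intro mult_left_mono) (simp_all add: p_def)
    then show ?thesis using 1 by (simp add: C_def)
  qed
  have tr: "trace (Pt t) \<le> D" for t
  proof -
    have "0 \<le> trace P" using pos_semidef_entry_bound[OF pos_def_imp_pos_semidef[OF P]] by (meson abs_ge_zero order_trans)
    then have "c t * trace P \<le> 1 * trace P" by (rule mult_right_mono[OF c_le])
    then show ?thesis using F by (simp add: Pt_def trace_scaleR relaxed_feasible_def)
  qed
  have "\<exists>K \<in> srd_admissible M x n D.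
     causal_information b K n \<le> ereal ((real n * \<kappa> + C) / ln b)" for n
  proof (rule bexI)
    show "test_kernel Pt \<in> srd_admissible M x n D" by (rule test_kernel_admissible[OF Pt_pd Rt_pd tr])
    show "causal_information b (test_kernel Pt) n \<le> ereal ((real n * \<kappa> + C) / ln b)"
      unfolding test_channel_information[OF Pt_pd Rt_pd b] using total[of n] b by (simp add: divide_right_mono)
  qed
  then show ?thesis unfolding \<kappa>_def by blast
qed

end

section \<open>The asymptotic rate\<close>

text \<open>
  Bounds that are affine in \<open>n\<close> leave only their slope after division by the length \<open>n + 1\<close> of the horizon.
\<close>

lemma affine_average_tendsto: "(\<lambda>n. (real n * k + C) / l / real (n + 1)) \<longlonglongrightarrow> k / l"
proof -
  have "(\<lambda>n. (k + (C - k) * inverse (real (Suc n))) / l) \<longlonglongrightarrow> (k + (C - k) * 0) / l"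
    unfolding divide_inverse by (intro tendsto_intros LIMSEQ_inverse_real_of_nat)
  moreover have "(k + (C - k) * inverse (real (Suc n))) / l = (real n * k + C) / l / real (n + 1)" for n
    by (simp add: field_simps)
  ultimately show ?thesis by simp
qed

theorem mainTheorem2:
  fixes M :: "'w measure"
    and A Sw S0 :: "real^'p^'p"
    and x w :: "nat \<Rightarrow> 'w \<Rightarrow> real^'p"
    and b D :: real
  assumes "1 < b"
    and "gauss_markov M A Sw S0 x w"
    and "0 < D"
  shows "convergent (\<lambda>n. srd_finite b M x n D) \<and>
    (\<exists>P Q. is_arg_min (sdp_objective b Sw) (sdp_feasible A Sw D) (P, Q) \<and>
           srd b M x D = ereal (sdp_objective b Sw (P, Q)))"
proof -
  interpret gauss_markov M A Sw S0 x w by fact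
  have b: "1 < b" and D: "0 < D" by fact+
  have lb: "0 < ln b" using b by simp
  obtain P Q :: "real^'p^'p" where P: "pos_def P" and Q: "pos_def Q" and F: "relaxed_feasible (transpose A) Sw D P Q"
    and opt: "\<And>P' Q'. pos_def P' \<Longrightarrow> pos_def Q' \<Longrightarrow> relaxed_feasible (transpose A) Sw D P' Q' \<Longrightarrow> det Q' \<le> det Q"
    by (rule optimum_exists[OF Sw_pos_def D, of "transpose A"]) blast
  have FO: "matrix_inv Q \<bullet> (Q' - Q) \<le> 0" if "relaxed_feasible (transpose A) Sw D P' Q'" for P' Q'
    by (rule first_order_optimality[OF Sw_pos_def D P Q F opt that])
  obtain L \<Theta> :: "real^'p^'p" and \<mu> :: real where \<Theta>: "pos_semidef \<Theta>" and \<mu>: "0 \<le> \<mu>"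
    and cert: "\<And>e. (e - L *v (transpose (transpose A) *v e)) \<bullet> (matrix_inv Q *v (e - L *v (transpose (transpose A) *v e)))
        + (transpose (transpose A) *v e) \<bullet> (\<Theta> *v (transpose (transpose A) *v e)) \<le> e \<bullet> (\<Theta> *v e) + \<mu> * (norm e)\<^sup>2"
    and budget: "(transpose L ** matrix_inv Q ** L) \<bullet> Sw + \<Theta> \<bullet> Sw + \<mu> * D \<le> real CARD('p)"
    by (rule optimality_certificate[OF Sw_pos_def D Q FO]) (assumption, rule that)
  obtain G :: "real^'p^'p" where fusion: "\<And>u v. let e = v + G *v (u - v) in
       \<mu> * (norm e)\<^sup>2 + e \<bullet> (\<Theta> *v e) \<le> \<mu> * (norm u)\<^sup>2 + v \<bullet> (\<Theta> *v v)"
    by (rule fusion_gain_exists[OF \<mu> \<Theta>]) blast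
  define \<kappa> where "\<kappa> = (ln (det Sw) - ln (det Q)) / 2"
  obtain C1 where C1: "\<And>n K. K \<in> srd_admissible M x n D \<Longrightarrow>
     ereal ((real n * \<kappa> - C1) / ln b) \<le> causal_information b K n"
    using information_lower_bound[OF b less_imp_le[OF D] Q \<Theta> \<mu> cert[unfolded transpose_transpose] budget fusion]
    unfolding \<kappa>_def by blast
  obtain C2 where C2: "\<And>n. \<exists>K \<in> srd_admissible M x n D.
     causal_information b K n \<le> ereal ((real n * \<kappa> + C2) / ln b)"
    using information_upper_bound[OF b P Q F] unfolding \<kappa>_def by blast
  have lower: "ereal ((real n * \<kappa> + (- C1)) / ln b / real (n + 1)) \<le> srd_finite b M x n D" for n
    unfolding srd_finite_def
  proof (rule INF_greatest)
    fix K assume "K \<in> srd_admissible M x n D"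
    from ereal_mult_left_mono[OF C1[OF this], of "ereal (1 / real (n + 1))"]
    show "ereal ((real n * \<kappa> + (- C1)) / ln b / real (n + 1))
      \<le> ereal (1 / real (n + 1)) * causal_information b K n"
      by (simp add: mult.commute)
  qed
  have upper: "srd_finite b M x n D \<le> ereal ((real n * \<kappa> + C2) / ln b / real (n + 1))" for n
  proof -
    obtain K where K: "K \<in> srd_admissible M x n D"
      and le: "causal_information b K n \<le> ereal ((real n * \<kappa> + C2) / ln b)"
      using C2[of n] by blast
    have "srd_finite b M x n D \<le> ereal (1 / real (n + 1)) * causal_information b K n"
      unfolding srd_finite_def by (rule INF_lower[OF K])
    also have "\<dots> \<le> ereal ((real n * \<kappa> + C2) / ln b / real (n + 1))"
      using ereal_mult_left_mono[OF le, of "ereal (1 / real (n + 1))"] by (simp add: mult.commute)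
    finally show ?thesis .
  qed
  have lim: "(\<lambda>n. srd_finite b M x n D) \<longlonglongrightarrow> ereal (\<kappa> / ln b)"
  proof (rule tendsto_sandwich)
    show "\<forall>\<^sub>F n in sequentially. ereal ((real n * \<kappa> + (- C1)) / ln b / real (n + 1)) \<le> srd_finite b M x n D"
      by (rule always_eventually, rule allI, rule lower)
    show "\<forall>\<^sub>F n in sequentially. srd_finite b M x n D \<le> ereal ((real n * \<kappa> + C2) / ln b / real (n + 1))"
      by (rule always_eventually, rule allI, rule upper)
    show "(\<lambda>n. ereal ((real n * \<kappa> + (- C1)) / ln b / real (n + 1))) \<longlonglongrightarrow> ereal (\<kappa> / ln b)"
      by (rule tendsto_ereal[OF affine_average_tendsto])
    show "(\<lambda>n. ereal ((real n * \<kappa> + C2) / ln b / real (n + 1))) \<longlonglongrightarrow> ereal (\<kappa> / ln b)"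
      by (rule tendsto_ereal[OF affine_average_tendsto])
  qed
  have obj: "sdp_objective b Sw (P', Q') = (ln (det Sw) - ln (det Q')) / 2 / ln b" for P' Q'
    by (simp add: sdp_objective_def log_def diff_divide_distrib)
  have "is_arg_min (sdp_objective b Sw) (sdp_feasible A Sw D) (P, Q)"
    unfolding is_arg_min_def
  proof (intro conjI notI)
    show "sdp_feasible A Sw D (P, Q)" using P Q F by (simp add: sdp_feasible_iff[OF Sw_pos_def])
    assume "\<exists>y. sdp_feasible A Sw D y \<and> sdp_objective b Sw y < sdp_objective b Sw (P, Q)"
    then obtain P' Q' where f: "sdp_feasible A Sw D (P', Q')" and less: "sdp_objective b Sw (P', Q') < sdp_objective b Sw (P, Q)"
      by auto
    from f have 1: "pos_def P'" "pos_def Q'" "relaxed_feasible (transpose A) Sw D P' Q'"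
      by (simp_all add: sdp_feasible_iff[OF Sw_pos_def])
    have "ln (det Q') \<le> ln (det Q)" using opt[OF 1] pos_def_det_pos[OF 1(2)] by simp
    then show False using less lb unfolding obj by (simp add: divide_less_cancel)
  qed
  moreover have "srd b M x D = ereal (sdp_objective b Sw (P, Q))"
    unfolding srd_def obj \<kappa>_def[symmetric] by (rule limI[OF lim])
  ultimately show ?thesis using lim by (auto simp: convergent_def)
qed

end
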